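(* Let $Q$ be the quiver with nodes $i,a,b,c,f,g,h,j$ and arrows $$\lambda:i\to a,\ \alpha:a\to b,\ \beta:b\to c,\ \epsilon:b\to f,\ \zeta:c\to g,\ \iota:f\to g,\ \kappa:g\to h,\ \mu:h\to j,$$ and let $R$ be given by the relations $$\alpha\cdot\beta=0,\quad \iota\cdot\kappa=0,\quad \beta\cdot\zeta=\epsilon\cdot\iota,\quad \lambda\cdot\alpha\cdot\epsilon=0,\quad \zeta\cdot\kappa\cdot\mu=0.$$ Then in the abelian category $\mathrm{Adel}(\mathcal{C}(Q,R)^{\oplus})$ there is a commutative diagram with rows $$(0\to a\to 0)\xrightarrow{\{\alpha\}}(0\to b\to 0)\xrightarrow{\{\beta\}}(0\to c\to 0)\xrightarrow{\{\zeta\cdot\kappa\}}(0\to h\xrightarrow{\mu}j),$$ $$(i\xrightarrow{\lambda}a\to 0)\xrightarrow{\{\alpha\cdot\epsilon\}}(0\to f\to 0)\xrightarrow{\{\iota\}}(0\to g\to 0)\xrightarrow{\{\kappa\}}(0\to h\to 0)$$ and vertical morphisms (from the first row to the second, from left to right) $\delta:=\{\mathrm{id}_a\}$, $\{\epsilon\}$, $\{\zeta\}$, $\eta:=\{\mathrm{id}_h\}$. In this diagram the composition of any two consecutive horizontal morphisms is zero, $\delta$ is an epimorphism and $\eta$ is a monomorphism. Moreover, there is a monomorphism $$\mathrm{H}\big(\ker\{\epsilon\}\to\ker\{\zeta\}\to\mathrm{H}(\{\beta\},\{\zeta\cdot\kappa\})\big)\hookrightarrow\mathrm{coker}\big(\mathrm{H}(\{\alpha\},\{\beta\})\xrightarrow{\mathrm{H}(\{\epsilon\})}\mathrm{H}(\{\alpha\cdot\epsilon\},\{\iota\})\big);$$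 in particular, $\ker\{\zeta\}$ admits a filtration whose graded parts are given by subquotients of the three objects $\ker\{\epsilon\}$, $\mathrm{H}(\{\beta\},\{\zeta\cdot\kappa\})$, $\mathrm{H}(\{\alpha\cdot\epsilon\},\{\iota\})$; in particular, if these three objects are zero, then $\{\zeta\}$ is a monomorphism.
   Context: Composition is written in diagrammatic order: $\alpha\cdot\beta$ means first $\alpha$, then $\beta$. For a quiver $Q$ and a set $R$ of $\mathbb{Z}$-linear relations between its paths, $\mathcal{C}(Q,R)$ is the $\mathbb{Z}$-linear category whose objects are the nodes of $Q$ and whose morphisms are $\mathbb{Z}$-linear combinations of paths of $Q$ modulo the relations $R$. For a $\mathbb{Z}$-linear category $\mathbf{C}$, $\mathbf{C}^{\oplus}$ is its additive closure: objects are finite (possibly empty) tuples of objects of $\mathbf{C}$ (formal direct sums) and morphisms are matrices of morphisms of $\mathbf{C}$. The Adelman category $\mathrm{Adel}(\mathbf{A})$ of an additive category $\mathbf{A}$: its objects are composable pairs $(r_x\xrightarrow{\rho_x}x\xrightarrow{\gamma_x}c_x)$ of morphisms in $\mathbf{A}$ (no condition on $\rho_x\cdot\gamma_x$). A morphism, written $\{\varphi\}$, from $(r_x\xrightarrow{\rho_x}x\xrightarrow{\gamma_x}c_x)$ to $(r_y\xrightarrow{\rho_y}y\xrightarrow{\gamma_y}c_y)$ is given by a morphism $\varphi:x\to y$ in $\mathbf{A}$ such that there exist $\omega: r_x\to r_y$ and $\psi: c_x\to c_y$ with $\rho_x\cdot\varphi=\omega\cdot\rho_y$ and $\gamma_x\cdot\psi=\varphi\cdot\gamma_y$;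 two such morphisms $\{\varphi\},\{\varphi'\}$ are equal if there exist $\sigma_1: x\to r_y$ and $\sigma_2:c_x\to y$ with $\varphi-\varphi'=\sigma_1\cdot\rho_y+\gamma_x\cdot\sigma_2$. Composition and addition are induced from $\mathbf{A}$. $\mathrm{Adel}(\mathbf{A})$ is an abelian category. For a composable pair $x\xrightarrow{\varphi}y\xrightarrow{\psi}z$ in an abelian category (not necessarily $\varphi\cdot\psi=0$), its homology $\mathrm{H}(\varphi,\psi)=\mathrm{H}(x\xrightarrow{\varphi}y\xrightarrow{\psi}z)$ is the image of the composite $\ker(\psi)\hookrightarrow y\twoheadrightarrow\mathrm{coker}(\varphi)$; it is functorial in morphisms of composable pairs. The morphism $\mathrm{H}(\{\epsilon\})$ is induced by $(\delta,\{\epsilon\},\{\zeta\})$ from the pair $(\{\alpha\},\{\beta\})$ to the pair $(\{\alpha\cdot\epsilon\},\{\iota\})$. The morphism $\ker\{\epsilon\}\to\ker\{\zeta\}$ is induced by $\{\beta\}$. The morphism $\ker\{\zeta\}\to\mathrm{H}(\{\beta\},\{\zeta\cdot\kappa\})$ is the composite of the inclusion of $\ker\{\zeta\}$ into the kernel of $\{\zeta\cdot\kappa\}:(0\to c\to 0)\to(0\to h\xrightarrow{\mu}j)$ with the canonical epimorphism from that kernel onto $\mathrm{H}(\{\beta\},\{\zeta\cdot\kappa\})$. *)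

theory Defs
  imports "HOL-Library.Poly_Mapping" "HOL-Library.Multiset" "Jordan_Normal_Form.Matrix"
begin

section \<open>Preadditive and abelian categories\<close>

text \<open>
  Composition is diagrammatic throughout: \<open>f \<odot> g\<close> is first \<open>f\<close>, then \<open>g\<close>.
  The fields are meaningful only on \<open>Obj\<close> and \<open>Arr\<close>; \<open>Comp\<close> only on composable,
  \<open>Add\<close> only on parallel arrows; \<open>Nul x y\<close> is the zero arrow from \<open>x\<close> to \<open>y\<close>.
\<close>

record ('o, 'm) precat =
  Obj :: "'o set"
  Arr :: "'m set"
  Dom :: "'m \<Rightarrow> 'o"
  Cod :: "'m \<Rightarrow> 'o"
  Ident :: "'o \<Rightarrow> 'm"
  Comp :: "'m \<Rightarrow> 'm \<Rightarrow> 'm"  (infixl "\<odot>\<index>" 70)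
  Add :: "'m \<Rightarrow> 'm \<Rightarrow> 'm"  (infixl "\<oplus>\<index>" 65)
  Nul :: "'o \<Rightarrow> 'o \<Rightarrow> 'm"

definition Hom :: "('o, 'm) precat \<Rightarrow> 'o \<Rightarrow> 'o \<Rightarrow> 'm set" where
  "Hom C x y = {f \<in> Arr C. Dom C f = x \<and> Cod C f = y}"

locale preadditive_category =
  fixes C :: "('o, 'm) precat" (structure)
  assumes Dom_in: "f \<in> Arr C \<Longrightarrow> Dom C f \<in> Obj C"
    and Cod_in: "f \<in> Arr C \<Longrightarrow> Cod C f \<in> Obj C"
    and Ident_in: "x \<in> Obj C \<Longrightarrow> Ident C x \<in> Hom C x x"
    and Comp_in: "f \<in> Hom C x y \<Longrightarrow> g \<in> Hom C y z \<Longrightarrow> f \<odot> g \<in> Hom C x z"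
    and Comp_assoc: "f \<in> Hom C w x \<Longrightarrow> g \<in> Hom C x y \<Longrightarrow> h \<in> Hom C y z
          \<Longrightarrow> (f \<odot> g) \<odot> h = f \<odot> (g \<odot> h)"
    and Ident_left: "f \<in> Hom C x y \<Longrightarrow> Ident C x \<odot> f = f"
    and Ident_right: "f \<in> Hom C x y \<Longrightarrow> f \<odot> Ident C y = f"
    and Nul_in: "x \<in> Obj C \<Longrightarrow> y \<in> Obj C \<Longrightarrow> Nul C x y \<in> Hom C x y"
    and Add_in: "f \<in> Hom C x y \<Longrightarrow> g \<in> Hom C x y \<Longrightarrow> f \<oplus> g \<in> Hom C x y"
    and Add_assoc: "f \<in> Hom C x y \<Longrightarrow> g \<in> Hom C x y \<Longrightarrow> h \<in> Hom C x y
          \<Longrightarrow> (f \<oplus> g) \<oplus> h = f \<oplus> (g \<oplus> h)"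
    and Add_commute: "f \<in> Hom C x y \<Longrightarrow> g \<in> Hom C x y \<Longrightarrow> f \<oplus> g = g \<oplus> f"
    and Add_Nul: "f \<in> Hom C x y \<Longrightarrow> f \<oplus> Nul C x y = f"
    and Add_inverse: "f \<in> Hom C x y \<Longrightarrow> \<exists>g \<in> Hom C x y. f \<oplus> g = Nul C x y"
    and Comp_Add_left: "f \<in> Hom C x y \<Longrightarrow> f' \<in> Hom C x y \<Longrightarrow> g \<in> Hom C y z
          \<Longrightarrow> (f \<oplus> f') \<odot> g = (f \<odot> g) \<oplus> (f' \<odot> g)"
    and Comp_Add_right: "f \<in> Hom C x y \<Longrightarrow> g \<in> Hom C y z \<Longrightarrow> g' \<in> Hom C y z
          \<Longrightarrow> f \<odot> (g \<oplus> g') = (f \<odot> g) \<oplus> (f \<odot> g')"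

definition monic :: "('o, 'm) precat \<Rightarrow> 'm \<Rightarrow> bool" where
  "monic C f \<longleftrightarrow> f \<in> Arr C \<and>
     (\<forall>w \<in> Obj C. \<forall>g \<in> Hom C w (Dom C f). \<forall>h \<in> Hom C w (Dom C f).
        g \<odot>\<^bsub>C\<^esub> f = h \<odot>\<^bsub>C\<^esub> f \<longrightarrow> g = h)"

definition epic :: "('o, 'm) precat \<Rightarrow> 'm \<Rightarrow> bool" where
  "epic C f \<longleftrightarrow> f \<in> Arr C \<and>
     (\<forall>z \<in> Obj C. \<forall>g \<in> Hom C (Cod C f) z. \<forall>h \<in> Hom C (Cod C f) z.
        f \<odot>\<^bsub>C\<^esub> g = f \<odot>\<^bsub>C\<^esub> h \<longrightarrow> g = h)"

definition zero_object :: "('o, 'm) precat \<Rightarrow> 'o \<Rightarrow> bool" where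
  "zero_object C z \<longleftrightarrow> z \<in> Obj C \<and>
     (\<forall>x \<in> Obj C. (\<exists>!f. f \<in> Hom C x z) \<and> (\<exists>!f. f \<in> Hom C z x))"

definition is_kernel :: "('o, 'm) precat \<Rightarrow> 'm \<Rightarrow> 'm \<Rightarrow> bool" where
  "is_kernel C f k \<longleftrightarrow> k \<in> Hom C (Dom C k) (Dom C f) \<and>
     k \<odot>\<^bsub>C\<^esub> f = Nul C (Dom C k) (Cod C f) \<and>
     (\<forall>w \<in> Obj C. \<forall>t \<in> Hom C w (Dom C f). t \<odot>\<^bsub>C\<^esub> f = Nul C w (Cod C f) \<longrightarrow>
        (\<exists>!u. u \<in> Hom C w (Dom C k) \<and> u \<odot>\<^bsub>C\<^esub> k = t))"

definition is_cokernel :: "('o, 'm) precat \<Rightarrow> 'm \<Rightarrow> 'm \<Rightarrow> bool" where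
  "is_cokernel C f c \<longleftrightarrow> c \<in> Hom C (Cod C f) (Cod C c) \<and>
     f \<odot>\<^bsub>C\<^esub> c = Nul C (Dom C f) (Cod C c) \<and>
     (\<forall>z \<in> Obj C. \<forall>t \<in> Hom C (Cod C f) z. f \<odot>\<^bsub>C\<^esub> t = Nul C (Dom C f) z \<longrightarrow>
        (\<exists>!u. u \<in> Hom C (Cod C c) z \<and> c \<odot>\<^bsub>C\<^esub> u = t))"

locale abelian_category = preadditive_category +
  assumes zero_object_exists: "\<exists>z. zero_object C z"
    and biproduct_exists: "x \<in> Obj C \<Longrightarrow> y \<in> Obj C \<Longrightarrow>
          \<exists>s i j p q. i \<in> Hom C x s \<and> j \<in> Hom C y s \<and> p \<in> Hom C s x \<and> q \<in> Hom C s y \<and>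
            i \<odot> p = Ident C x \<and> j \<odot> q = Ident C y \<and>
            i \<odot> q = Nul C x y \<and> j \<odot> p = Nul C y x \<and>
            (p \<odot> i) \<oplus> (q \<odot> j) = Ident C s"
    and kernel_exists: "f \<in> Arr C \<Longrightarrow> \<exists>k. is_kernel C f k"
    and cokernel_exists: "f \<in> Arr C \<Longrightarrow> \<exists>c. is_cokernel C f c"
    and monic_is_kernel: "monic C f \<Longrightarrow> \<exists>g \<in> Arr C. is_kernel C g f"
    and epic_is_cokernel: "epic C f \<Longrightarrow> \<exists>g \<in> Arr C. is_cokernel C g f"

text \<open>
  Kernels, cokernels and images are fixed by choice among the isomorphic candidates, as
  arrows: \<open>ker C f\<close> is the embedding with object \<open>Ker C f\<close>, and \<open>coker C f\<close> the projection
  onto \<open>Coker C f\<close>.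
\<close>

definition ker :: "('o, 'm) precat \<Rightarrow> 'm \<Rightarrow> 'm" where
  "ker C f = (SOME k. is_kernel C f k)"

definition coker :: "('o, 'm) precat \<Rightarrow> 'm \<Rightarrow> 'm" where
  "coker C f = (SOME c. is_cokernel C f c)"

definition Ker :: "('o, 'm) precat \<Rightarrow> 'm \<Rightarrow> 'o" where
  "Ker C f = Dom C (ker C f)"

definition Coker :: "('o, 'm) precat \<Rightarrow> 'm \<Rightarrow> 'o" where
  "Coker C f = Cod C (coker C f)"

definition img :: "('o, 'm) precat \<Rightarrow> 'm \<Rightarrow> 'm" where
  "img C f = ker C (coker C f)"

definition Img :: "('o, 'm) precat \<Rightarrow> 'm \<Rightarrow> 'o" where
  "Img C f = Dom C (img C f)"

text \<open>The maps induced on kernels and cokernels by (one component of) a commutative square.\<close>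

definition ker_map :: "('o, 'm) precat \<Rightarrow> 'm \<Rightarrow> 'm \<Rightarrow> 'm \<Rightarrow> 'm" where
  "ker_map C f g v =
     (THE u. u \<in> Hom C (Ker C f) (Ker C g) \<and> u \<odot>\<^bsub>C\<^esub> ker C g = ker C f \<odot>\<^bsub>C\<^esub> v)"

definition coker_map :: "('o, 'm) precat \<Rightarrow> 'm \<Rightarrow> 'm \<Rightarrow> 'm \<Rightarrow> 'm" where
  "coker_map C f g v =
     (THE u. u \<in> Hom C (Coker C f) (Coker C g) \<and> coker C f \<odot>\<^bsub>C\<^esub> u = v \<odot>\<^bsub>C\<^esub> coker C g)"

text \<open>The inclusion of \<open>Ker C f\<close> into \<open>Ker C g\<close>, for arrows with common domain.\<close>

definition ker_incl :: "('o, 'm) precat \<Rightarrow> 'm \<Rightarrow> 'm \<Rightarrow> 'm" where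
  "ker_incl C f g =
     (THE u. u \<in> Hom C (Ker C f) (Ker C g) \<and> u \<odot>\<^bsub>C\<^esub> ker C g = ker C f)"

definition homology_arrow :: "('o, 'm) precat \<Rightarrow> 'm \<Rightarrow> 'm \<Rightarrow> 'm" where
  "homology_arrow C f g = ker C g \<odot>\<^bsub>C\<^esub> coker C f"

definition homology :: "('o, 'm) precat \<Rightarrow> 'm \<Rightarrow> 'm \<Rightarrow> 'o" where
  "homology C f g = Img C (homology_arrow C f g)"

definition homology_proj :: "('o, 'm) precat \<Rightarrow> 'm \<Rightarrow> 'm \<Rightarrow> 'm" where
  "homology_proj C f g =
     (THE e. e \<in> Hom C (Ker C g) (homology C f g) \<and>
             e \<odot>\<^bsub>C\<^esub> img C (homology_arrow C f g) = homology_arrow C f g)"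

text \<open>
  For a morphism \<open>(u, v, w)\<close> of composable pairs from \<open>(f, g)\<close> to \<open>(f', g')\<close>, the induced map
  on homology depends on \<open>v\<close> only; \<open>u\<close> and \<open>w\<close> guarantee that it exists.
\<close>

definition homology_map :: "('o, 'm) precat \<Rightarrow> 'm \<times> 'm \<Rightarrow> 'm \<times> 'm \<Rightarrow> 'm \<Rightarrow> 'm" where
  "homology_map C = (\<lambda>(f, g) (f', g') v.
     (THE h. h \<in> Hom C (homology C f g) (homology C f' g') \<and>
             h \<odot>\<^bsub>C\<^esub> img C (homology_arrow C f' g') =
             img C (homology_arrow C f g) \<odot>\<^bsub>C\<^esub> coker_map C f f' v))"

definition subquotient :: "('o, 'm) precat \<Rightarrow> 'o \<Rightarrow> 'o \<Rightarrow> bool" where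
  "subquotient C s y \<longleftrightarrow>
     (\<exists>t \<in> Obj C. (\<exists>m \<in> Hom C t y. monic C m) \<and> (\<exists>e \<in> Hom C t s. epic C e))"

text \<open>
  A filtration \<open>0 = F 0 \<hookrightarrow> F 1 \<hookrightarrow> \<dots> \<hookrightarrow> F n = x\<close> whose graded parts are subquotients of the
  objects in the list \<open>ys\<close>, each of which is used once, in some order \<open>zs\<close>.
\<close>

definition filtered_by_subquotients :: "('o, 'm) precat \<Rightarrow> 'o \<Rightarrow> 'o list \<Rightarrow> bool" where
  "filtered_by_subquotients C x ys \<longleftrightarrow>
     (\<exists>F m zs. mset zs = mset ys \<and> zero_object C (F 0) \<and> F (length ys) = x \<and>
        (\<forall>k < length ys. m k \<in> Hom C (F k) (F (Suc k)) \<and> monic C (m k) \<and>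
                         subquotient C (Coker C (m k)) (zs ! k)))"


section \<open>The category of a quiver with relations\<close>

record ('v, 'e) quiver =
  nodes :: "'v set"
  arrows :: "'e set"
  source :: "'e \<Rightarrow> 'v"
  target :: "'e \<Rightarrow> 'v"

text \<open>A path is its start node with a list of arrows; \<open>(x, [])\<close> is the empty path at \<open>x\<close>.\<close>

type_synonym ('v, 'e) path = "'v \<times> 'e list"
type_synonym ('v, 'e) lincomb = "('v, 'e) path \<Rightarrow>\<^sub>0 int"

fun walk :: "('v, 'e) quiver \<Rightarrow> 'v \<Rightarrow> 'e list \<Rightarrow> 'v \<Rightarrow> bool" where
  "walk Q x [] y \<longleftrightarrow> x \<in> nodes Q \<and> x = y"
| "walk Q x (e # es) y \<longleftrightarrow>
     x \<in> nodes Q \<and> e \<in> arrows Q \<and> source Q e = x \<and> walk Q (target Q e) es y"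

definition lincombs :: "('v, 'e) quiver \<Rightarrow> 'v \<Rightarrow> 'v \<Rightarrow> ('v, 'e) lincomb set" where
  "lincombs Q x y = {f. Poly_Mapping.keys f \<subseteq> {(x, es) | es. walk Q x es y}}"

definition lincomb_of :: "('v, 'e) path \<Rightarrow> ('v, 'e) lincomb" where
  "lincomb_of p = Poly_Mapping.single p 1"

definition lincomb_mult :: "('v, 'e) lincomb \<Rightarrow> ('v, 'e) lincomb \<Rightarrow> ('v, 'e) lincomb" where
  "lincomb_mult f g = (\<Sum>p \<in> Poly_Mapping.keys f. \<Sum>q \<in> Poly_Mapping.keys g.
     Poly_Mapping.single (fst p, snd p @ snd q) (Poly_Mapping.lookup f p * Poly_Mapping.lookup g q))"

text \<open>
  The two-sided ideal generated by \<open>R\<close>. It contains negatives because \<open>f\<close> in \<open>gen\<close> ranges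
  over all linear combinations.
\<close>

inductive_set rel_ideal ::
  "('v, 'e) quiver \<Rightarrow> ('v, 'e) lincomb set \<Rightarrow> 'v \<Rightarrow> 'v \<Rightarrow> ('v, 'e) lincomb set"
  for Q :: "('v, 'e) quiver" and R :: "('v, 'e) lincomb set" and x :: 'v and y :: 'v where
  zero: "0 \<in> rel_ideal Q R x y"
| gen: "r \<in> R \<Longrightarrow> r \<in> lincombs Q x' y' \<Longrightarrow> f \<in> lincombs Q x x' \<Longrightarrow> g \<in> lincombs Q y' y
        \<Longrightarrow> lincomb_mult (lincomb_mult f r) g \<in> rel_ideal Q R x y"
| add: "f \<in> rel_ideal Q R x y \<Longrightarrow> g \<in> rel_ideal Q R x y \<Longrightarrow> f + g \<in> rel_ideal Q R x y"

definition path_rel ::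
  "('v, 'e) quiver \<Rightarrow> ('v, 'e) lincomb set \<Rightarrow> 'v \<Rightarrow> 'v
     \<Rightarrow> (('v, 'e) lincomb \<times> ('v, 'e) lincomb) set" where
  "path_rel Q R x y =
     {(f, g). f \<in> lincombs Q x y \<and> g \<in> lincombs Q x y \<and> f - g \<in> rel_ideal Q R x y}"

type_synonym ('v, 'e) quiver_arr = "'v \<times> 'v \<times> ('v, 'e) lincomb set"

definition quiver_cat ::
  "('v, 'e) quiver \<Rightarrow> ('v, 'e) lincomb set \<Rightarrow> ('v, ('v, 'e) quiver_arr) precat" where
  "quiver_cat Q R = \<lparr>
     Obj = nodes Q,
     Arr = {(x, y, F). x \<in> nodes Q \<and> y \<in> nodes Q \<and> F \<in> lincombs Q x y // path_rel Q R x y},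
     Dom = (\<lambda>(x, y, F). x),
     Cod = (\<lambda>(x, y, F). y),
     Ident = (\<lambda>x. (x, x, path_rel Q R x x `` {lincomb_of (x, [])})),
     Comp = (\<lambda>(x, y, F) (y', z, G).
               (x, z, \<Union>f \<in> F. \<Union>g \<in> G. path_rel Q R x z `` {lincomb_mult f g})),
     Add = (\<lambda>(x, y, F) (x', y', G). (x, y, \<Union>f \<in> F. \<Union>g \<in> G. path_rel Q R x y `` {f + g})),
     Nul = (\<lambda>x y. (x, y, path_rel Q R x y `` {0}))\<rparr>"

definition arrow_class ::
  "('v, 'e) quiver \<Rightarrow> ('v, 'e) lincomb set \<Rightarrow> 'e \<Rightarrow> ('v, 'e) quiver_arr" where
  "arrow_class Q R e = (let x = source Q e; y = target Q e
     in (x, y, path_rel Q R x y `` {lincomb_of (x, [e])}))"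


section \<open>The additive closure\<close>

text \<open>
  Objects are tuples, i.e. lists. With diagrammatic composition an arrow from \<open>xs\<close> to \<open>ys\<close> is a
  matrix with rows indexed by \<open>xs\<close> and columns indexed by \<open>ys\<close>.
\<close>

type_synonym ('o, 'm) add_arr = "'o list \<times> 'o list \<times> 'm mat"

definition arr_sum :: "('o, 'm) precat \<Rightarrow> 'o \<Rightarrow> 'o \<Rightarrow> 'm list \<Rightarrow> 'm" where
  "arr_sum C x y fs = foldr (Add C) fs (Nul C x y)"

definition additive_closure :: "('o, 'm) precat \<Rightarrow> ('o list, ('o, 'm) add_arr) precat" where
  "additive_closure C = \<lparr>
     Obj = {xs. set xs \<subseteq> Obj C},
     Arr = {(xs, ys, M). set xs \<subseteq> Obj C \<and> set ys \<subseteq> Obj C \<and>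
              M \<in> carrier_mat (length xs) (length ys) \<and>
              (\<forall>i < length xs. \<forall>j < length ys. M $$ (i, j) \<in> Hom C (xs ! i) (ys ! j))},
     Dom = (\<lambda>(xs, ys, M). xs),
     Cod = (\<lambda>(xs, ys, M). ys),
     Ident = (\<lambda>xs. (xs, xs, mat (length xs) (length xs)
        (\<lambda>(i, j). if i = j then Ident C (xs ! i) else Nul C (xs ! i) (xs ! j)))),
     Comp = (\<lambda>(xs, ys, M) (ys', zs, N). (xs, zs, mat (length xs) (length zs)
        (\<lambda>(i, k). arr_sum C (xs ! i) (zs ! k)
                    (map (\<lambda>j. M $$ (i, j) \<odot>\<^bsub>C\<^esub> N $$ (j, k)) [0..<length ys])))),
     Add = (\<lambda>(xs, ys, M) (xs', ys', N). (xs, ys, mat (length xs) (length ys)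
        (\<lambda>(i, j). M $$ (i, j) \<oplus>\<^bsub>C\<^esub> N $$ (i, j)))),
     Nul = (\<lambda>xs ys. (xs, ys, mat (length xs) (length ys) (\<lambda>(i, j). Nul C (xs ! i) (ys ! j))))\<rparr>"

definition singleton_arr :: "('o, 'm) precat \<Rightarrow> 'm \<Rightarrow> ('o, 'm) add_arr" where
  "singleton_arr C f = ([Dom C f], [Cod C f], mat 1 1 (\<lambda>_. f))"


section \<open>The Adelman category\<close>

text \<open>
  The object \<open>r \<rightarrow> x \<rightarrow> c\<close> is the pair of its two arrows \<open>\<rho>\<close> and \<open>\<gamma>\<close>.
\<close>

type_synonym 'm adel_obj = "'m \<times> 'm"
type_synonym 'm adel_arr = "'m adel_obj \<times> 'm adel_obj \<times> 'm set"

definition adel_reps :: "('o, 'm) precat \<Rightarrow> 'm adel_obj \<Rightarrow> 'm adel_obj \<Rightarrow> 'm set" where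
  "adel_reps A = (\<lambda>(\<rho>, \<gamma>) (\<rho>', \<gamma>').
     {\<phi> \<in> Hom A (Cod A \<rho>) (Cod A \<rho>').
        (\<exists>\<omega> \<in> Hom A (Dom A \<rho>) (Dom A \<rho>'). \<rho> \<odot>\<^bsub>A\<^esub> \<phi> = \<omega> \<odot>\<^bsub>A\<^esub> \<rho>') \<and>
        (\<exists>\<psi> \<in> Hom A (Cod A \<gamma>) (Cod A \<gamma>'). \<gamma> \<odot>\<^bsub>A\<^esub> \<psi> = \<phi> \<odot>\<^bsub>A\<^esub> \<gamma>')})"

text \<open>The condition \<open>\<phi> - \<phi>' = \<sigma>\<^sub>1 \<odot> \<rho>' + \<gamma> \<odot> \<sigma>\<^sub>2\<close>, written without subtraction.\<close>

definition adel_rel ::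
  "('o, 'm) precat \<Rightarrow> 'm adel_obj \<Rightarrow> 'm adel_obj \<Rightarrow> ('m \<times> 'm) set" where
  "adel_rel A X Y = {(\<phi>, \<phi>'). \<phi> \<in> adel_reps A X Y \<and> \<phi>' \<in> adel_reps A X Y \<and>
     (case X of (\<rho>, \<gamma>) \<Rightarrow> case Y of (\<rho>', \<gamma>') \<Rightarrow>
        \<exists>\<sigma>\<^sub>1 \<in> Hom A (Cod A \<rho>) (Dom A \<rho>'). \<exists>\<sigma>\<^sub>2 \<in> Hom A (Cod A \<gamma>) (Cod A \<rho>').
          \<phi> = \<phi>' \<oplus>\<^bsub>A\<^esub> ((\<sigma>\<^sub>1 \<odot>\<^bsub>A\<^esub> \<rho>') \<oplus>\<^bsub>A\<^esub> (\<gamma> \<odot>\<^bsub>A\<^esub> \<sigma>\<^sub>2)))}"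

definition adel_class ::
  "('o, 'm) precat \<Rightarrow> 'm adel_obj \<Rightarrow> 'm adel_obj \<Rightarrow> 'm \<Rightarrow> 'm adel_arr" where
  "adel_class A X Y \<phi> = (X, Y, adel_rel A X Y `` {\<phi>})"

definition adelman :: "('o, 'm) precat \<Rightarrow> ('m adel_obj, 'm adel_arr) precat" where
  "adelman A = (let Ob = {(\<rho>, \<gamma>). \<rho> \<in> Arr A \<and> \<gamma> \<in> Arr A \<and> Cod A \<rho> = Dom A \<gamma>} in \<lparr>
     Obj = Ob,
     Arr = {(X, Y, F). X \<in> Ob \<and> Y \<in> Ob \<and> F \<in> adel_reps A X Y // adel_rel A X Y},
     Dom = (\<lambda>(X, Y, F). X),
     Cod = (\<lambda>(X, Y, F). Y),
     Ident = (\<lambda>X. adel_class A X X (Ident A (Cod A (fst X)))),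
     Comp = (\<lambda>(X, Y, F) (Y', Z, G).
               (X, Z, \<Union>\<phi> \<in> F. \<Union>\<psi> \<in> G. adel_rel A X Z `` {\<phi> \<odot>\<^bsub>A\<^esub> \<psi>})),
     Add = (\<lambda>(X, Y, F) (X', Y', G).
               (X, Y, \<Union>\<phi> \<in> F. \<Union>\<psi> \<in> G. adel_rel A X Y `` {\<phi> \<oplus>\<^bsub>A\<^esub> \<psi>})),
     Nul = (\<lambda>X Y. adel_class A X Y (Nul A (Cod A (fst X)) (Cod A (fst Y))))\<rparr>)"


section \<open>The quiver with relations\<close>

datatype node = ni | na | nb | nc | nf | ng | nh | nj

datatype arrow = Lambda | Alpha | Beta | Epsilon | Zeta | Iota | Kappa | Mu

fun arrow_ends :: "arrow \<Rightarrow> node \<times> node" where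
  "arrow_ends Lambda = (ni, na)"
| "arrow_ends Alpha = (na, nb)"
| "arrow_ends Beta = (nb, nc)"
| "arrow_ends Epsilon = (nb, nf)"
| "arrow_ends Zeta = (nc, ng)"
| "arrow_ends Iota = (nf, ng)"
| "arrow_ends Kappa = (ng, nh)"
| "arrow_ends Mu = (nh, nj)"

definition Q0 :: "(node, arrow) quiver" where
  "Q0 = \<lparr>nodes = UNIV, arrows = UNIV,
         source = (\<lambda>e. fst (arrow_ends e)), target = (\<lambda>e. snd (arrow_ends e))\<rparr>"

text \<open>A relation \<open>f = g\<close> is recorded as the linear combination \<open>f - g\<close>.\<close>

definition R0 :: "(node, arrow) lincomb set" where
  "R0 = {lincomb_of (na, [Alpha, Beta]),
         lincomb_of (nf, [Iota, Kappa]),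
         lincomb_of (nb, [Beta, Zeta]) - lincomb_of (nb, [Epsilon, Iota]),
         lincomb_of (ni, [Lambda, Alpha, Epsilon]),
         lincomb_of (nc, [Zeta, Kappa, Mu])}"

type_synonym arr0 = "(node, (node, arrow) quiver_arr) add_arr"

definition A0 :: "(node list, arr0) precat" where
  "A0 = additive_closure (quiver_cat Q0 R0)"

definition Ad :: "(arr0 adel_obj, arr0 adel_arr) precat" where
  "Ad = adelman A0"

definition ar :: "arrow \<Rightarrow> arr0" where
  "ar e = singleton_arr (quiver_cat Q0 R0) (arrow_class Q0 R0 e)"

text \<open>The zero object of the additive closure is the empty tuple \<open>[]\<close>.\<close>

definition plain :: "node \<Rightarrow> arr0 adel_obj" where
  "plain x = (Nul A0 [] [x], Nul A0 [x] [])"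

definition obj_la :: "arr0 adel_obj" where  \<comment> \<open>\<open>i \<rightarrow> a \<rightarrow> 0\<close>\<close>
  "obj_la = (ar Lambda, Nul A0 [na] [])"

definition obj_hm :: "arr0 adel_obj" where  \<comment> \<open>\<open>0 \<rightarrow> h \<rightarrow> j\<close>\<close>
  "obj_hm = (Nul A0 [] [nh], ar Mu)"

end

theory Submission
  imports Defs
begin

text \<open>
  The diagram statement holds in every abelian category, by a chase. Let \<open>x\<close> be an element of
  \<open>ker \<zeta>\<close>. It lies in \<open>ker \<zeta>\<kappa>\<close> because \<open>\<eta>\<close> is a monomorphism, and it vanishes in \<open>H(\<beta>, \<zeta>\<kappa>)\<close>
  iff \<open>x = \<beta>(b)\<close> for some \<open>b\<close>. Then \<open>\<iota>(\<epsilon>(b)) = \<zeta>(\<beta>(b)) = 0\<close>, so \<open>\<epsilon>(b)\<close> has a class in \<open>H(\<alpha>\<epsilon>, \<iota>)\<close>.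
  As \<open>b\<close> is unique up to \<open>ker \<beta>\<close>, this class is well defined modulo the image of \<open>H(\<alpha>, \<beta>)\<close>. It is
  zero there iff \<open>\<epsilon>(b) = \<epsilon>(b') + \<epsilon>(\<alpha>(a))\<close> with \<open>\<beta>(b') = 0\<close>; the element \<open>a\<close> exists because \<open>\<delta>\<close> is an
  epimorphism. In that case \<open>b - b' - \<alpha>(a)\<close> lies in \<open>ker \<epsilon>\<close> and has the same image \<open>x\<close> under \<open>\<beta>\<close>; so
  the class is zero iff \<open>x\<close> comes from \<open>ker \<epsilon>\<close>. This is the monomorphism \<open>homology_monic\<close> of the
  locale \<open>two_complexes\<close>. It bounds the middle step of the filtration
  \<open>0 \<subseteq> im (ker \<epsilon> \<rightarrow> ker \<zeta>) \<subseteq> ker (ker \<zeta> \<rightarrow> H(\<beta>, \<zeta>\<kappa>)) \<subseteq> ker \<zeta>\<close>, whose bottom is a quotient of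
  \<open>ker \<epsilon>\<close> and whose top is a subobject of \<open>H(\<beta>, \<zeta>\<kappa>)\<close>.

  An element of \<open>X\<close> here is any arrow into \<open>X\<close>, and existence of elements is meant locally, that is
  after composing with some epimorphism. This is sound because epimorphisms lift elements
  (\<open>local_lift\<close>) and because an element that vanishes in the cokernel of \<open>f\<close> is locally in the
  image of \<open>f\<close> (\<open>local_preimage\<close>).

  The Adelman category of an additive category is abelian because all constructions can be written
  down on representatives. The cokernel of \<open>\<phi>\<close> from \<open>r \<rightarrow> x \<rightarrow> c\<close> to \<open>r' \<rightarrow> y \<rightarrow> c'\<close> is
  \<open>r' \<oplus> x \<rightarrow> y \<oplus> c \<rightarrow> c' \<oplus> c\<close>, and kernels are dual (\<open>rep_cokernel_exists\<close>, \<open>rep_kernel_exists\<close>).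
  If \<open>\<phi>\<close> is a monomorphism, the vanishing of its explicit kernel is an equation
  \<open>1 = s\<rho> + \<gamma>p + \<phi>q\<close>, and the almost-retraction \<open>q\<close> yields the lifts that make \<open>\<phi>\<close> a kernel of its
  cokernel (\<open>rep_monic_is_kernel\<close>). The remaining layers, the path category modulo relations and
  its matrices, are preadditive and additive for formal reasons.
\<close>

(* Rings and modules use the same two symbols, which would make every sum and composite ambiguous. *)
no_notation ring.add (infixl "\<oplus>\<index>" 65)
no_notation module.smult (infixl "\<odot>\<index>" 70)

section \<open>Calculus in preadditive categories\<close>

lemma in_Hom: "f \<in> Hom C x y \<longleftrightarrow> f \<in> Arr C \<and> Dom C f = x \<and> Cod C f = y"
  by (auto simp: Hom_def)

definition neg :: "('o, 'm) precat \<Rightarrow> 'm \<Rightarrow> 'm" where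
  "neg C f = (SOME g. g \<in> Hom C (Dom C f) (Cod C f) \<and> f \<oplus>\<^bsub>C\<^esub> g = Nul C (Dom C f) (Cod C f))"

text \<open>
  The axioms are restated with the hypothesis \<open>f \<in> Hom C x y\<close> split into \<open>f \<in> Arr C\<close>, \<open>Dom C f = x\<close>
  and \<open>Cod C f = y\<close>. In this form the simplifier can check composability of arbitrary composites,
  which membership in a hom-set does not allow because the middle object of a composite would
  have to be guessed.
\<close>

context preadditive_category
begin

declare Dom_in [simp] Cod_in [simp]

lemma Ident_simps [simp]:
  assumes "x \<in> Obj C"
  shows "Ident C x \<in> Arr C" "Dom C (Ident C x) = x" "Cod C (Ident C x) = x"
  using Ident_in[OF assms] by (auto simp: in_Hom)

lemma Nul_simps [simp]:
  assumes "x \<in> Obj C" "y \<in> Obj C"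
  shows "Nul C x y \<in> Arr C" "Dom C (Nul C x y) = x" "Cod C (Nul C x y) = y"
  using Nul_in[OF assms] by (auto simp: in_Hom)

lemma Comp_simps [simp]:
  assumes "f \<in> Arr C" "g \<in> Arr C" "Cod C f = Dom C g"
  shows "f \<odot> g \<in> Arr C" "Dom C (f \<odot> g) = Dom C f" "Cod C (f \<odot> g) = Cod C g"
  using Comp_in[of f "Dom C f" "Cod C f" g "Cod C g"] assms by (auto simp: in_Hom)

lemma Add_simps [simp]:
  assumes "f \<in> Arr C" "g \<in> Arr C" "Dom C f = Dom C g" "Cod C f = Cod C g"
  shows "f \<oplus> g \<in> Arr C" "Dom C (f \<oplus> g) = Dom C f" "Cod C (f \<oplus> g) = Cod C f"
  using Add_in[of f "Dom C f" "Cod C f" g] assms by (auto simp: in_Hom)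

lemma assoc [simp]:
  assumes "f \<in> Arr C" "g \<in> Arr C" "h \<in> Arr C" "Cod C f = Dom C g" "Cod C g = Dom C h"
  shows "(f \<odot> g) \<odot> h = f \<odot> (g \<odot> h)"
  using Comp_assoc[of f "Dom C f" "Dom C g" g "Dom C h" h "Cod C h"] assms by (auto simp: in_Hom)

lemma Ident_Comp [simp]: "f \<in> Arr C \<Longrightarrow> Dom C f = x \<Longrightarrow> Ident C x \<odot> f = f"
  using Ident_left[of f x "Cod C f"] by (auto simp: in_Hom)

lemma Comp_Ident [simp]: "f \<in> Arr C \<Longrightarrow> Cod C f = x \<Longrightarrow> f \<odot> Ident C x = f"
  using Ident_right[of f "Dom C f" x] by (auto simp: in_Hom)

lemma add_assoc:
  assumes "f \<in> Arr C" "g \<in> Arr C" "h \<in> Arr C"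
    "Dom C f = Dom C g" "Cod C f = Cod C g" "Dom C g = Dom C h" "Cod C g = Cod C h"
  shows "(f \<oplus> g) \<oplus> h = f \<oplus> (g \<oplus> h)"
  using Add_assoc[of f "Dom C f" "Cod C f" g h] assms by (auto simp: in_Hom)

lemma add_commute:
  assumes "f \<in> Arr C" "g \<in> Arr C" "Dom C f = Dom C g" "Cod C f = Cod C g"
  shows "f \<oplus> g = g \<oplus> f"
  using Add_commute[of f "Dom C f" "Cod C f" g] assms by (auto simp: in_Hom)

lemma add_left_commute:
  assumes "f \<in> Arr C" "g \<in> Arr C" "h \<in> Arr C"
    "Dom C f = Dom C g" "Cod C f = Cod C g" "Dom C g = Dom C h" "Cod C g = Cod C h"
  shows "f \<oplus> (g \<oplus> h) = g \<oplus> (f \<oplus> h)"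
  by (metis assms add_assoc add_commute)

lemmas add_ac = add_assoc add_commute add_left_commute

lemma Comp_add_left:
  assumes "f \<in> Arr C" "f' \<in> Arr C" "g \<in> Arr C"
    "Dom C f = Dom C f'" "Cod C f = Cod C f'" "Cod C f' = Dom C g"
  shows "(f \<oplus> f') \<odot> g = (f \<odot> g) \<oplus> (f' \<odot> g)"
  using Comp_Add_left[of f "Dom C f" "Cod C f" f' g "Cod C g"] assms by (auto simp: in_Hom)

lemma Comp_add_right:
  assumes "f \<in> Arr C" "g \<in> Arr C" "g' \<in> Arr C"
    "Dom C g = Dom C g'" "Cod C g = Cod C g'" "Cod C f = Dom C g'"
  shows "f \<odot> (g \<oplus> g') = (f \<odot> g) \<oplus> (f \<odot> g')"
  using Comp_Add_right[of f "Dom C f" "Cod C f" g "Cod C g" g'] assms by (auto simp: in_Hom)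

lemmas distribs = Comp_add_left Comp_add_right

lemma add_Nul [simp]: "f \<in> Arr C \<Longrightarrow> Dom C f = x \<Longrightarrow> Cod C f = y \<Longrightarrow> f \<oplus> Nul C x y = f"
  using Add_Nul[of f x y] by (auto simp: in_Hom)

lemma Nul_add [simp]: "f \<in> Arr C \<Longrightarrow> Dom C f = x \<Longrightarrow> Cod C f = y \<Longrightarrow> Nul C x y \<oplus> f = f"
  by (metis Cod_in Dom_in Nul_simps add_Nul add_commute)

lemma neg_in:
  assumes "f \<in> Arr C"
  shows "neg C f \<in> Hom C (Dom C f) (Cod C f) \<and> f \<oplus> neg C f = Nul C (Dom C f) (Cod C f)"
proof -
  have "f \<in> Hom C (Dom C f) (Cod C f)" using assms by (simp add: in_Hom)
  then have "\<exists>g. g \<in> Hom C (Dom C f) (Cod C f) \<and> f \<oplus> g = Nul C (Dom C f) (Cod C f)"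
    using Add_inverse by blast
  then show ?thesis unfolding neg_def by (rule someI_ex)
qed

lemma neg_simps [simp]:
  assumes "f \<in> Arr C"
  shows "neg C f \<in> Arr C" "Dom C (neg C f) = Dom C f" "Cod C (neg C f) = Cod C f"
    "f \<oplus> neg C f = Nul C (Dom C f) (Cod C f)" "neg C f \<oplus> f = Nul C (Dom C f) (Cod C f)"
proof -
  show *: "neg C f \<in> Arr C" "Dom C (neg C f) = Dom C f" "Cod C (neg C f) = Cod C f"
    "f \<oplus> neg C f = Nul C (Dom C f) (Cod C f)"
    using neg_in[OF assms] by (auto simp: in_Hom)
  then show "neg C f \<oplus> f = Nul C (Dom C f) (Cod C f)"
    by (metis add_commute assms)
qed

lemma add_neg_cancel [simp]:
  assumes "f \<in> Arr C" "g \<in> Arr C" "Dom C f = Dom C g" "Cod C f = Cod C g"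
  shows "f \<oplus> (neg C f \<oplus> g) = g" "neg C f \<oplus> (f \<oplus> g) = g"
  using assms by (simp_all flip: add_assoc)

lemma add_left_cancel:
  assumes "f \<in> Arr C" "g \<in> Arr C" "h \<in> Arr C"
    "Dom C f = Dom C g" "Cod C f = Cod C g" "Dom C f = Dom C h" "Cod C f = Cod C h"
  shows "f \<oplus> g = f \<oplus> h \<longleftrightarrow> g = h"
  using add_neg_cancel(2)[of f g] add_neg_cancel(2)[of f h] assms by metis

lemma neg_unique:
  assumes "f \<in> Arr C" "g \<in> Arr C" "Dom C f = Dom C g" "Cod C f = Cod C g"
    "f \<oplus> g = Nul C (Dom C g) (Cod C g)"
  shows "g = neg C f"
  using add_left_cancel[of f g "neg C f"] assms by simp

lemma Nul_Comp [simp]: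
  assumes "f \<in> Arr C" "w \<in> Obj C" "Dom C f = x"
  shows "Nul C w x \<odot> f = Nul C w (Cod C f)"
proof -
  have x: "x \<in> Obj C" using assms by auto
  have "(Nul C w x \<oplus> Nul C w x) \<odot> f = Nul C w x \<odot> f"
    using assms x by simp
  then have "(Nul C w x \<odot> f) \<oplus> (Nul C w x \<odot> f) = (Nul C w x \<odot> f) \<oplus> Nul C w (Cod C f)"
    using assms x by (subst (asm) Comp_add_left) auto
  then show ?thesis
    using assms x by (subst (asm) add_left_cancel) auto
qed

lemma Comp_Nul [simp]:
  assumes "f \<in> Arr C" "y \<in> Obj C" "Cod C f = x"
  shows "f \<odot> Nul C x y = Nul C (Dom C f) y"
proof -
  have x: "x \<in> Obj C" using assms by auto
  have "f \<odot> (Nul C x y \<oplus> Nul C x y) = f \<odot> Nul C x y"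
    using assms x by simp
  then have "(f \<odot> Nul C x y) \<oplus> (f \<odot> Nul C x y) = (f \<odot> Nul C x y) \<oplus> Nul C (Dom C f) y"
    using assms x by (subst (asm) Comp_add_right) auto
  then show ?thesis
    using assms x by (subst (asm) add_left_cancel) auto
qed

lemma neg_Comp:
  assumes "f \<in> Arr C" "g \<in> Arr C" "Cod C f = Dom C g"
  shows "neg C f \<odot> g = neg C (f \<odot> g)"
  by (rule neg_unique) (use assms in \<open>simp_all flip: Comp_add_left\<close>)

lemma Comp_neg:
  assumes "f \<in> Arr C" "g \<in> Arr C" "Cod C f = Dom C g"
  shows "f \<odot> neg C g = neg C (f \<odot> g)"
  by (rule neg_unique) (use assms in \<open>simp_all flip: Comp_add_right\<close>)

lemma neg_neg [simp]: "f \<in> Arr C \<Longrightarrow> neg C (neg C f) = f"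
  by (rule neg_unique[symmetric]) auto

lemma neg_Nul [simp]: "x \<in> Obj C \<Longrightarrow> y \<in> Obj C \<Longrightarrow> neg C (Nul C x y) = Nul C x y"
  by (rule neg_unique[symmetric]) auto

lemma neg_add:
  assumes "f \<in> Arr C" "g \<in> Arr C" "Dom C f = Dom C g" "Cod C f = Cod C g"
  shows "neg C (f \<oplus> g) = neg C f \<oplus> neg C g"
  by (rule neg_unique[symmetric])
    (use assms in \<open>simp_all add: add_assoc add_left_commute[of g "neg C f"]\<close>)

lemma diff_eq_Nul_iff:
  assumes "f \<in> Arr C" "g \<in> Arr C" "Dom C f = Dom C g" "Cod C f = Cod C g"
  shows "f \<oplus> neg C g = Nul C (Dom C g) (Cod C g) \<longleftrightarrow> f = g"
proof
  assume "f \<oplus> neg C g = Nul C (Dom C g) (Cod C g)"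
  then have "neg C g = neg C f" using assms by (intro neg_unique) auto
  then show "f = g" using assms neg_neg by metis
qed (use assms in auto)

lemma monic_iff:
  "monic C f \<longleftrightarrow> f \<in> Arr C \<and> (\<forall>g \<in> Arr C. Cod C g = Dom C f \<longrightarrow>
     g \<odot> f = Nul C (Dom C g) (Cod C f) \<longrightarrow> g = Nul C (Dom C g) (Dom C f))" (is "?L \<longleftrightarrow> ?R")
proof
  assume L: ?L
  show ?R
  proof (intro conjI ballI impI)
    show f: "f \<in> Arr C" using L by (simp add: monic_def)
    fix g assume g: "g \<in> Arr C" "Cod C g = Dom C f" "g \<odot> f = Nul C (Dom C g) (Cod C f)"
    have "g \<odot> f = Nul C (Dom C g) (Dom C f) \<odot> f" using f g by simp
    moreover have "\<forall>w \<in> Obj C. \<forall>g \<in> Hom C w (Dom C f). \<forall>h \<in> Hom C w (Dom C f).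
        g \<odot> f = h \<odot> f \<longrightarrow> g = h" using L by (simp add: monic_def)
    moreover have "g \<in> Hom C (Dom C g) (Dom C f)" "Dom C g \<in> Obj C"
      "Nul C (Dom C g) (Dom C f) \<in> Hom C (Dom C g) (Dom C f)"
      using f g by (auto simp: in_Hom)
    ultimately show "g = Nul C (Dom C g) (Dom C f)" by blast
  qed
next
  assume R: ?R
  show ?L unfolding monic_def
  proof (intro conjI ballI impI)
    show f: "f \<in> Arr C" using R by simp
    fix w g h
    assume *: "w \<in> Obj C" "g \<in> Hom C w (Dom C f)" "h \<in> Hom C w (Dom C f)" "g \<odot> f = h \<odot> f"
    then have "(g \<oplus> neg C h) \<odot> f = Nul C w (Cod C f)"
      using f by (simp add: Comp_add_left in_Hom neg_Comp)
    then have "g \<oplus> neg C h = Nul C (Dom C h) (Cod C h)"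
      using R * by (auto simp: in_Hom dest: bspec[of _ _ "g \<oplus> neg C h"])
    then show "g = h" using * by (subst (asm) diff_eq_Nul_iff) (auto simp: in_Hom)
  qed
qed

lemma monicD:
  assumes "monic C f" "g \<in> Arr C" "h \<in> Arr C" "Dom C g = Dom C h"
    "Cod C g = Dom C f" "Cod C h = Dom C f" "g \<odot> f = h \<odot> f"
  shows "g = h"
proof -
  have "g \<in> Hom C (Dom C g) (Dom C f)" "h \<in> Hom C (Dom C g) (Dom C f)" "Dom C g \<in> Obj C"
    using assms by (auto simp: in_Hom)
  then show ?thesis using assms(1,7) unfolding monic_def by blast
qed

lemma epicD:
  assumes "epic C f" "g \<in> Arr C" "h \<in> Arr C" "Cod C g = Cod C h"
    "Dom C g = Cod C f" "Dom C h = Cod C f" "f \<odot> g = f \<odot> h"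
  shows "g = h"
proof -
  have "g \<in> Hom C (Cod C f) (Cod C g)" "h \<in> Hom C (Cod C f) (Cod C g)" "Cod C g \<in> Obj C"
    using assms by (auto simp: in_Hom)
  then show ?thesis using assms(1,7) unfolding epic_def by blast
qed

end

section \<open>Opposite categories\<close>

text \<open>
  Cokernels in \<open>C\<close> are kernels in the opposite category. Below, every statement about kernels or
  monomorphisms that needs work is proved once and dualised along this construction.
\<close>

definition opposite :: "('o, 'm) precat \<Rightarrow> ('o, 'm) precat" where
  "opposite C = \<lparr>Obj = Obj C, Arr = Arr C, Dom = Cod C, Cod = Dom C, Ident = Ident C,
     Comp = (\<lambda>f g. g \<odot>\<^bsub>C\<^esub> f), Add = Add C, Nul = (\<lambda>x y. Nul C y x)\<rparr>"

lemma opposite_simps [simp]: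
  "Obj (opposite C) = Obj C" "Arr (opposite C) = Arr C" "Dom (opposite C) = Cod C"
  "Cod (opposite C) = Dom C" "Ident (opposite C) = Ident C"
  "f \<odot>\<^bsub>opposite C\<^esub> g = g \<odot>\<^bsub>C\<^esub> f" "Add (opposite C) = Add C"
  "Nul (opposite C) x y = Nul C y x"
  by (simp_all add: opposite_def)

lemma Hom_opposite [simp]: "Hom (opposite C) x y = Hom C y x"
  by (auto simp: Hom_def)

lemma monic_opposite [simp]: "monic (opposite C) f \<longleftrightarrow> epic C f"
  by (simp add: monic_def epic_def)

lemma epic_opposite [simp]: "epic (opposite C) f \<longleftrightarrow> monic C f"
  by (simp add: monic_def epic_def)

lemma is_kernel_opposite [simp]: "is_kernel (opposite C) f k \<longleftrightarrow> is_cokernel C f k"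
  by (simp add: is_kernel_def is_cokernel_def)

lemma is_cokernel_opposite [simp]: "is_cokernel (opposite C) f k \<longleftrightarrow> is_kernel C f k"
  by (simp add: is_kernel_def is_cokernel_def)

lemma zero_object_opposite [simp]: "zero_object (opposite C) z \<longleftrightarrow> zero_object C z"
  by (auto simp: zero_object_def)

lemma (in preadditive_category) preadditive_opposite: "preadditive_category (opposite C)"
proof (unfold_locales, goal_cases)
  case (5 f w x g y h z)
  then show ?case using Comp_assoc[of h z y g x f w] by simp
next
  case 9 then show ?case by (simp add: Add_in)
next
  case 10 then show ?case by (simp add: Add_assoc)
next
  case 11 then show ?case using Add_commute by simp
next
  case 13 then show ?case by (simp add: Add_inverse)
qed (auto intro: Ident_in Nul_in Comp_in Comp_Add_left Comp_Add_right simp: Ident_left Ident_right Add_Nul)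

lemma (in preadditive_category) epic_iff:
  "epic C f \<longleftrightarrow> f \<in> Arr C \<and> (\<forall>g \<in> Arr C. Dom C g = Cod C f \<longrightarrow>
     f \<odot> g = Nul C (Dom C f) (Cod C g) \<longrightarrow> g = Nul C (Cod C f) (Cod C g))"
  using preadditive_category.monic_iff[OF preadditive_opposite, of f] by simp


section \<open>The category of a quiver with relations is preadditive\<close>

text \<open>
  The product is the bilinear extension of concatenation of paths. Written with \<open>frag_extend\<close>, its
  identities reduce to single paths by \<open>frag_induction\<close>.
\<close>

lemma lincomb_mult_frag_extend:
  "lincomb_mult f g = frag_extend (\<lambda>p. frag_extend (\<lambda>q. frag_of (fst p, snd p @ snd q)) g) f"
proof -
  have *: "frag_cmul c (Poly_Mapping.single x d) = Poly_Mapping.single x (c * d)"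
    for c d and x :: "'a \<times> 'b list"
    by (rule poly_mapping_eqI) (simp add: lookup_single when_def)
  show ?thesis
    unfolding lincomb_mult_def frag_extend_def frag_cmul_sum
    by (simp add: * frag_cmul_sum)
qed

lemma lincomb_mult_simps [simp]:
  "lincomb_mult 0 g = 0" "lincomb_mult f 0 = 0"
  "lincomb_mult (f + f') g = lincomb_mult f g + lincomb_mult f' g"
  "lincomb_mult f (g + g') = lincomb_mult f g + lincomb_mult f g'"
  "lincomb_mult (f - f') g = lincomb_mult f g - lincomb_mult f' g"
  "lincomb_mult f (g - g') = lincomb_mult f g - lincomb_mult f g'"
  "lincomb_mult (- f) g = - lincomb_mult f g"
  "lincomb_mult (lincomb_of (x, es)) (lincomb_of (y, es')) = lincomb_of (x, es @ es')"
proof -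
  show add: "lincomb_mult f (g + g') = lincomb_mult f g + lincomb_mult f g'" for g g'
    using subset_UNIV unfolding lincomb_mult_frag_extend
    by (induction f rule: frag_induction) (simp_all add: frag_extend_add frag_extend_diff algebra_simps)
  show 0: "lincomb_mult f 0 = 0"
    using add[of 0 0] by simp
  show "lincomb_mult f (g - g') = lincomb_mult f g - lincomb_mult f g'"
    using add[of "g - g'" g'] by (simp add: algebra_simps)
qed (simp_all add: lincomb_mult_frag_extend frag_extend_add frag_extend_diff frag_extend_minus lincomb_of_def)

lemma lincomb_mult_assoc:
  "lincomb_mult (lincomb_mult f g) h = lincomb_mult f (lincomb_mult g h)"
proof -
  have fgh: "lincomb_mult (lincomb_mult (lincomb_of p) (lincomb_of q)) (lincomb_of r) =
      lincomb_mult (lincomb_of p) (lincomb_mult (lincomb_of q) (lincomb_of r))"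
    for p q r :: "'a \<times> 'b list"
    by (cases p; cases q; cases r) simp
  have gh: "lincomb_mult (lincomb_mult (lincomb_of p) (lincomb_of q)) h =
      lincomb_mult (lincomb_of p) (lincomb_mult (lincomb_of q) h)" for p q
    using subset_UNIV by (induction h rule: frag_induction) (simp_all add: fgh flip: lincomb_of_def)
  have h: "lincomb_mult (lincomb_mult (lincomb_of p) g) h =
      lincomb_mult (lincomb_of p) (lincomb_mult g h)" for p
    using subset_UNIV by (induction g rule: frag_induction) (simp_all add: gh flip: lincomb_of_def)
  show ?thesis
    using subset_UNIV by (induction f rule: frag_induction) (simp_all add: h flip: lincomb_of_def)
qed

lemma walk_append: "walk Q x es y \<Longrightarrow> walk Q y es' z \<Longrightarrow> walk Q x (es @ es') z"
  by (induction es arbitrary: x) auto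

lemma lincombs_closed [simp, intro]:
  "0 \<in> lincombs Q x y"
  "f \<in> lincombs Q x y \<Longrightarrow> g \<in> lincombs Q x y \<Longrightarrow> f + g \<in> lincombs Q x y"
  "f \<in> lincombs Q x y \<Longrightarrow> g \<in> lincombs Q x y \<Longrightarrow> f - g \<in> lincombs Q x y"
  "f \<in> lincombs Q x y \<Longrightarrow> - f \<in> lincombs Q x y"
  "walk Q x es y \<Longrightarrow> lincomb_of (x, es) \<in> lincombs Q x y"
  unfolding lincombs_def lincomb_of_def using keys_add[of f g] keys_diff[of f g]
  by fastforce+

lemma lincomb_mult_in_lincombs [simp, intro]:
  assumes "f \<in> lincombs Q x y" "g \<in> lincombs Q y z"
  shows "lincomb_mult f g \<in> lincombs Q x z"
proof -
  have "Poly_Mapping.keys (lincomb_mult f g) \<subseteq>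
      (\<Union>p \<in> Poly_Mapping.keys f. \<Union>q \<in> Poly_Mapping.keys g. {(fst p, snd p @ snd q)})"
    unfolding lincomb_mult_frag_extend
    by (rule order_trans[OF keys_frag_extend] UN_mono subset_refl)+ simp
  then show ?thesis
    using assms walk_append[of Q x _ y _ z] unfolding lincombs_def by fastforce
qed

lemma lincomb_mult_empty_path:
  assumes "f \<in> lincombs Q x y"
  shows "lincomb_mult (lincomb_of (x, [])) f = f" "lincomb_mult f (lincomb_of (y', [])) = f"
proof -
  have "lincomb_mult (lincomb_of (x, [])) f = frag_extend frag_of f"
    unfolding lincomb_mult_frag_extend lincomb_of_def
    using assms by (auto simp: lincombs_def intro!: frag_extend_eq)
  then show "lincomb_mult (lincomb_of (x, [])) f = f"
    using frag_expansion by metis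
  show "lincomb_mult f (lincomb_of (y', [])) = f"
    unfolding lincomb_mult_frag_extend lincomb_of_def
    using frag_expansion[of f] by simp
qed

text \<open>
  The generating rule absorbs scalars, signs and further factors into the outer factors \<open>f\<close> and
  \<open>g\<close>; hence the relations generate a two-sided ideal although only sums are added explicitly.
\<close>

lemma rel_ideal_uminus: "f \<in> rel_ideal Q R x y \<Longrightarrow> - f \<in> rel_ideal Q R x y"
proof (induction rule: rel_ideal.induct)
  case (gen r x' y' f g)
  then have "lincomb_mult (lincomb_mult (- f) r) g \<in> rel_ideal Q R x y"
    by (intro rel_ideal.gen) auto
  then show ?case by simp
next
  case (add f g)
  then show ?case
    using rel_ideal.add[of "- f" Q R x y "- g"] by (simp add: algebra_simps)
qed (auto intro: rel_ideal.zero)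

lemma rel_ideal_mult_left:
  "f \<in> rel_ideal Q R x y \<Longrightarrow> h \<in> lincombs Q w x \<Longrightarrow> lincomb_mult h f \<in> rel_ideal Q R w y"
proof (induction rule: rel_ideal.induct)
  case (gen r x' y' f g)
  then have "lincomb_mult (lincomb_mult (lincomb_mult h f) r) g \<in> rel_ideal Q R w y"
    by (intro rel_ideal.gen) auto
  then show ?case by (simp add: lincomb_mult_assoc)
qed (auto intro: rel_ideal.zero rel_ideal.add)

lemma rel_ideal_mult_right:
  "f \<in> rel_ideal Q R x y \<Longrightarrow> h \<in> lincombs Q y z \<Longrightarrow> lincomb_mult f h \<in> rel_ideal Q R x z"
proof (induction rule: rel_ideal.induct)
  case (gen r x' y' f g)
  then have "lincomb_mult (lincomb_mult f r) (lincomb_mult g h) \<in> rel_ideal Q R x z"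
    by (intro rel_ideal.gen) auto
  then show ?case by (simp add: lincomb_mult_assoc)
qed (auto intro: rel_ideal.zero rel_ideal.add)

lemma equiv_path_rel: "equiv (lincombs Q x y) (path_rel Q R x y)"
proof (rule equivI)
  show "refl_on (lincombs Q x y) (path_rel Q R x y)"
    by (auto simp: refl_on_def path_rel_def intro: rel_ideal.zero)
  show "sym (path_rel Q R x y)"
    using rel_ideal_uminus by (fastforce simp: sym_def path_rel_def)
  show "trans (path_rel Q R x y)"
    using rel_ideal.add by (fastforce simp: trans_def path_rel_def)
qed (auto simp: path_rel_def)

definition path_class ::
  "('v, 'e) quiver \<Rightarrow> ('v, 'e) lincomb set \<Rightarrow> 'v \<Rightarrow> 'v \<Rightarrow> ('v, 'e) lincomb \<Rightarrow> ('v, 'e) quiver_arr" where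
  "path_class Q R x y f = (x, y, path_rel Q R x y `` {f})"

lemma path_class_eq_iff:
  assumes "f \<in> lincombs Q x y" "g \<in> lincombs Q x y"
  shows "path_class Q R x y f = path_class Q R x y g \<longleftrightarrow> f - g \<in> rel_ideal Q R x y"
  using eq_equiv_class_iff[OF equiv_path_rel assms, of R] assms
  by (auto simp: path_class_def path_rel_def)

lemma Hom_quiver_cat:
  "f \<in> Hom (quiver_cat Q R) x y \<longleftrightarrow>
     x \<in> nodes Q \<and> y \<in> nodes Q \<and> (\<exists>f0 \<in> lincombs Q x y. f = path_class Q R x y f0)"
  by (auto simp: Hom_def quiver_cat_def path_class_def quotient_def)

lemma path_class_in_Hom:
  "x \<in> nodes Q \<Longrightarrow> y \<in> nodes Q \<Longrightarrow> f \<in> lincombs Q x y \<Longrightarrow>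
     path_class Q R x y f \<in> Hom (quiver_cat Q R) x y"
  by (auto simp: Hom_quiver_cat)

lemma path_class_Comp:
  assumes "f \<in> lincombs Q x y" "g \<in> lincombs Q y z"
  shows "path_class Q R x y f \<odot>\<^bsub>quiver_cat Q R\<^esub> path_class Q R y z g =
    path_class Q R x z (lincomb_mult f g)"
proof -
  have "(\<Union>f' \<in> path_rel Q R x y `` {f}. \<Union>g' \<in> path_rel Q R y z `` {g}.
      path_rel Q R x z `` {lincomb_mult f' g'}) = path_rel Q R x z `` {lincomb_mult f g}"
  proof (rule UN_equiv_class2[OF equiv_path_rel equiv_path_rel _ assms])
    show "congruent2 (path_rel Q R x y) (path_rel Q R y z)
        (\<lambda>f g. path_rel Q R x z `` {lincomb_mult f g})"
    proof (rule congruent2I[OF equiv_path_rel equiv_path_rel])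
      fix g f f' assume *: "g \<in> lincombs Q y z" "(f, f') \<in> path_rel Q R x y"
      then have "lincomb_mult (f - f') g \<in> rel_ideal Q R x z"
        by (intro rel_ideal_mult_right) (auto simp: path_rel_def)
      with * show "path_rel Q R x z `` {lincomb_mult f g} = path_rel Q R x z `` {lincomb_mult f' g}"
        by (intro equiv_class_eq[OF equiv_path_rel]) (auto simp: path_rel_def)
    next
      fix f g g' assume *: "f \<in> lincombs Q x y" "(g, g') \<in> path_rel Q R y z"
      then have "lincomb_mult f (g - g') \<in> rel_ideal Q R x z"
        by (intro rel_ideal_mult_left) (auto simp: path_rel_def)
      with * show "path_rel Q R x z `` {lincomb_mult f g} = path_rel Q R x z `` {lincomb_mult f g'}"
        by (intro equiv_class_eq[OF equiv_path_rel]) (auto simp: path_rel_def)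
    qed
  qed
  then show ?thesis by (simp add: quiver_cat_def path_class_def)
qed

lemma path_class_Add:
  assumes "f \<in> lincombs Q x y" "g \<in> lincombs Q x y"
  shows "path_class Q R x y f \<oplus>\<^bsub>quiver_cat Q R\<^esub> path_class Q R x y g = path_class Q R x y (f + g)"
proof -
  have "(\<Union>f' \<in> path_rel Q R x y `` {f}. \<Union>g' \<in> path_rel Q R x y `` {g}.
      path_rel Q R x y `` {f' + g'}) = path_rel Q R x y `` {f + g}"
  proof (rule UN_equiv_class2[OF equiv_path_rel equiv_path_rel _ assms])
    show "congruent2 (path_rel Q R x y) (path_rel Q R x y)
        (\<lambda>f g. path_rel Q R x y `` {f + g})"
      by (rule congruent2I[OF equiv_path_rel equiv_path_rel];
          rule equiv_class_eq[OF equiv_path_rel]) (auto simp: path_rel_def)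
  qed
  then show ?thesis by (simp add: quiver_cat_def path_class_def)
qed

lemma quiver_cat_simps:
  "Obj (quiver_cat Q R) = nodes Q"
  "Ident (quiver_cat Q R) x = path_class Q R x x (lincomb_of (x, []))"
  "Nul (quiver_cat Q R) x y = path_class Q R x y 0"
  by (simp_all add: quiver_cat_def path_class_def)

theorem preadditive_quiver_cat: "preadditive_category (quiver_cat Q R)"
proof (unfold_locales, goal_cases)
  case (3 x)
  then show ?case by (auto simp: quiver_cat_simps intro!: path_class_in_Hom)
next
  case (8 x y)
  then show ?case by (auto simp: quiver_cat_simps intro!: path_class_in_Hom)
next
  case (13 f x y)
  then obtain f0 where "f0 \<in> lincombs Q x y" "f = path_class Q R x y f0" "x \<in> nodes Q" "y \<in> nodes Q"
    by (auto simp: Hom_quiver_cat)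
  then show ?case
    by (intro bexI[of _ "path_class Q R x y (- f0)"])
      (auto simp: path_class_Add quiver_cat_simps intro!: path_class_in_Hom)
qed (auto simp: Hom_quiver_cat path_class_Comp path_class_Add lincomb_mult_assoc lincomb_mult_empty_path
       quiver_cat_simps ac_simps, auto simp: quiver_cat_def)


section \<open>Additive categories\<close>

definition is_biproduct ::
  "('o, 'm) precat \<Rightarrow> 'o \<Rightarrow> 'o \<Rightarrow> 'o \<Rightarrow> 'm \<Rightarrow> 'm \<Rightarrow> 'm \<Rightarrow> 'm \<Rightarrow> bool" where
  "is_biproduct C x y s i j p q \<longleftrightarrow>
     i \<in> Hom C x s \<and> j \<in> Hom C y s \<and> p \<in> Hom C s x \<and> q \<in> Hom C s y \<and>
     i \<odot>\<^bsub>C\<^esub> p = Ident C x \<and> j \<odot>\<^bsub>C\<^esub> q = Ident C y \<and>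
     i \<odot>\<^bsub>C\<^esub> q = Nul C x y \<and> j \<odot>\<^bsub>C\<^esub> p = Nul C y x \<and>
     (p \<odot>\<^bsub>C\<^esub> i) \<oplus>\<^bsub>C\<^esub> (q \<odot>\<^bsub>C\<^esub> j) = Ident C s"

lemma is_biproduct_opposite [simp]:
  "is_biproduct (opposite C) x y s p q i j \<longleftrightarrow> is_biproduct C x y s i j p q"
  by (auto simp: is_biproduct_def)

lemma (in preadditive_category) is_biproduct_simps:
  assumes "is_biproduct C x y s i j p q"
  shows "i \<in> Arr C" "j \<in> Arr C" "p \<in> Arr C" "q \<in> Arr C"
    "Dom C i = x" "Cod C i = s" "Dom C j = y" "Cod C j = s"
    "Dom C p = s" "Cod C p = x" "Dom C q = s" "Cod C q = y" "s \<in> Obj C"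
    "i \<odot> p = Ident C x" "j \<odot> q = Ident C y" "i \<odot> q = Nul C x y" "j \<odot> p = Nul C y x"
    "\<And>f. f \<in> Arr C \<Longrightarrow> Dom C f = x \<Longrightarrow> i \<odot> (p \<odot> f) = f"
    "\<And>f. f \<in> Arr C \<Longrightarrow> Dom C f = y \<Longrightarrow> j \<odot> (q \<odot> f) = f"
    "\<And>f. f \<in> Arr C \<Longrightarrow> Dom C f = y \<Longrightarrow> i \<odot> (q \<odot> f) = Nul C x (Cod C f)"
    "\<And>f. f \<in> Arr C \<Longrightarrow> Dom C f = x \<Longrightarrow> j \<odot> (p \<odot> f) = Nul C y (Cod C f)"
proof -
  show t: "i \<in> Arr C" "j \<in> Arr C" "p \<in> Arr C" "q \<in> Arr C"
    "Dom C i = x" "Cod C i = s" "Dom C j = y" "Cod C j = s"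
    "Dom C p = s" "Cod C p = x" "Dom C q = s" "Cod C q = y"
    and e: "i \<odot> p = Ident C x" "j \<odot> q = Ident C y" "i \<odot> q = Nul C x y" "j \<odot> p = Nul C y x"
    using assms by (auto simp: is_biproduct_def in_Hom)
  show s: "s \<in> Obj C" using t Cod_in by metis
  have o: "x \<in> Obj C" "y \<in> Obj C" using t Dom_in by metis+
  show "i \<odot> (p \<odot> f) = f" "j \<odot> (p \<odot> f) = Nul C y (Cod C f)" if "f \<in> Arr C" "Dom C f = x" for f
    using that t o by (simp_all add: e flip: assoc)
  show "j \<odot> (q \<odot> f) = f" "i \<odot> (q \<odot> f) = Nul C x (Cod C f)" if "f \<in> Arr C" "Dom C f = y" for f
    using that t o by (simp_all add: e flip: assoc)
qed

lemma is_biproduct_Ident: "is_biproduct C x y s i j p q \<Longrightarrow> (p \<odot>\<^bsub>C\<^esub> i) \<oplus>\<^bsub>C\<^esub> (q \<odot>\<^bsub>C\<^esub> j) = Ident C s"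
  by (simp add: is_biproduct_def)

locale additive_category = preadditive_category +
  assumes zero_exists: "\<exists>z. zero_object C z"
    and is_biproduct_exists: "x \<in> Obj C \<Longrightarrow> y \<in> Obj C \<Longrightarrow> \<exists>s i j p q. is_biproduct C x y s i j p q"

lemma (in additive_category) additive_opposite: "additive_category (opposite C)"
proof -
  interpret op: preadditive_category "opposite C" by (rule preadditive_opposite)
  show ?thesis
  proof
    show "\<exists>z. zero_object (opposite C) z" using zero_exists by simp
    fix x y assume "x \<in> Obj (opposite C)" "y \<in> Obj (opposite C)"
    then obtain s i j p q where "is_biproduct C x y s i j p q"
      using is_biproduct_exists[of x y] by auto
    then have "is_biproduct (opposite C) x y s p q i j" by simp
    then show "\<exists>s i j p q. is_biproduct (opposite C) x y s i j p q" by blast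
  qed
qed

lemma (in preadditive_category) zero_objectI:
  assumes "z \<in> Obj C" "Ident C z = Nul C z z"
  shows "zero_object C z"
  unfolding zero_object_def
proof (intro conjI ballI)
  fix x assume x: "x \<in> Obj C"
  have "f = Nul C x z" if "f \<in> Hom C x z" for f
    using that assms Comp_Ident[of f z] Comp_Nul[of f z z] by (auto simp: in_Hom)
  then show "\<exists>!f. f \<in> Hom C x z" using Nul_in[OF x assms(1)] by blast
  have "f = Nul C z x" if "f \<in> Hom C z x" for f
    using that assms Ident_Comp[of f z] Nul_Comp[of f z z] by (auto simp: in_Hom)
  then show "\<exists>!f. f \<in> Hom C z x" using Nul_in[OF assms(1) x] by blast
qed fact

section \<open>The additive closure\<close>

context preadditive_category
begin

text \<open>
  The entries of a matrix product are sums over an initial segment of the natural numbers. Indexing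
  sums by a list keeps every law a list induction and matches the shape of these entries.
\<close>

definition lsum :: "'o \<Rightarrow> 'o \<Rightarrow> (nat \<Rightarrow> 'm) \<Rightarrow> nat list \<Rightarrow> 'm" where
  "lsum x y F js = arr_sum C x y (map F js)"

lemma lsum_Nil [simp]: "lsum x y F [] = Nul C x y"
  by (simp add: lsum_def arr_sum_def)

lemma lsum_Cons [simp]: "lsum x y F (j # js) = F j \<oplus> lsum x y F js"
  by (simp add: lsum_def arr_sum_def)

lemma lsum_in:
  assumes "x \<in> Obj C" "y \<in> Obj C" "\<And>j. j \<in> set js \<Longrightarrow> F j \<in> Hom C x y"
  shows "lsum x y F js \<in> Hom C x y"
  using assms(3) by (induction js) (auto intro: Nul_in Add_in assms)

lemma lsum_cong:
  "(\<And>j. j \<in> set js \<Longrightarrow> F j = G j) \<Longrightarrow> lsum x y F js = lsum x y G js"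
  by (induction js) auto

text \<open>
  With \<open>=simp=>\<close> the membership \<open>j \<in> set [0..<n]\<close> is itself simplified to \<open>j < n\<close> before it is used
  to evaluate matrix entries under the sum.
\<close>

lemma lsum_cong_simp [cong]:
  assumes "x = x'" "y = y'" "js = js'" "\<And>j. j \<in> set js' =simp=> F j = G j"
  shows "lsum x y F js = lsum x' y' G js'"
  using assms(4) unfolding assms(1-3) simp_implies_def by (rule lsum_cong)

lemma lsum_Nul:
  assumes "x \<in> Obj C" "y \<in> Obj C" "\<And>j. j \<in> set js \<Longrightarrow> F j = Nul C x y"
  shows "lsum x y F js = Nul C x y"
  using assms(3) by (induction js) (auto simp: assms)

lemma lsum_delta:
  assumes "x \<in> Obj C" "y \<in> Obj C" "F i \<in> Hom C x y" "distinct js" "i \<in> set js"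
    "\<And>j. j \<in> set js \<Longrightarrow> j \<noteq> i \<Longrightarrow> F j = Nul C x y"
  shows "lsum x y F js = F i"
  using assms(4-)
proof (induction js)
  case (Cons j js)
  show ?case
  proof (cases "j = i")
    case True
    have "F l = Nul C x y" if "l \<in> set js" for l
      using Cons.prems(1,2) that True by (intro Cons.prems(3)) auto
    then have "lsum x y F js = Nul C x y"
      by (intro lsum_Nul assms(1,2))
    then show ?thesis using True assms by (auto simp: in_Hom)
  next
    case False
    then have "F j = Nul C x y" "lsum x y F js = F i"
      using Cons by auto
    then show ?thesis using assms by (auto simp: in_Hom)
  qed
qed simp

lemma lsum_add:
  assumes "x \<in> Obj C" "y \<in> Obj C" "\<And>j. j \<in> set js \<Longrightarrow> F j \<in> Hom C x y"
    "\<And>j. j \<in> set js \<Longrightarrow> G j \<in> Hom C x y"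
  shows "lsum x y (\<lambda>j. F j \<oplus> G j) js = lsum x y F js \<oplus> lsum x y G js"
  using assms(3,4)
proof (induction js)
  case (Cons j js)
  have "lsum x y F js \<in> Hom C x y" "lsum x y G js \<in> Hom C x y"
    using Cons.prems by (intro lsum_in assms(1,2); simp)+
  with Cons show ?case by (simp add: in_Hom add_assoc add_left_commute[of "G j"])
qed (simp add: assms)

lemma lsum_Comp:
  assumes "x \<in> Obj C" "y \<in> Obj C" "\<And>j. j \<in> set js \<Longrightarrow> F j \<in> Hom C x y" "g \<in> Hom C y z"
  shows "lsum x y F js \<odot> g = lsum x z (\<lambda>j. F j \<odot> g) js"
  using assms(3)
proof (induction js)
  case (Cons j js)
  have "lsum x y F js \<in> Hom C x y"
    using Cons.prems by (intro lsum_in assms(1,2); simp)+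
  with Cons assms show ?case by (simp add: in_Hom Comp_add_left)
qed (use assms in \<open>auto simp: in_Hom\<close>)

lemma Comp_lsum:
  assumes "y \<in> Obj C" "z \<in> Obj C" "\<And>j. j \<in> set js \<Longrightarrow> F j \<in> Hom C y z" "g \<in> Hom C x y"
  shows "g \<odot> lsum y z F js = lsum x z (\<lambda>j. g \<odot> F j) js"
  using assms(3)
proof (induction js)
  case (Cons j js)
  have "lsum y z F js \<in> Hom C y z"
    using Cons.prems by (intro lsum_in assms(1,2); simp)+
  with Cons assms show ?case by (simp add: in_Hom Comp_add_right)
qed (use assms in \<open>auto simp: in_Hom\<close>)

lemma lsum_swap:
  assumes "x \<in> Obj C" "y \<in> Obj C"
    "\<And>i j. i \<in> set is \<Longrightarrow> j \<in> set js \<Longrightarrow> F i j \<in> Hom C x y"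
  shows "lsum x y (\<lambda>i. lsum x y (F i) js) is = lsum x y (\<lambda>j. lsum x y (\<lambda>i. F i j) is) js"
  using assms(3)
proof (induction "is")
  case Nil
  then show ?case using lsum_Nul[OF assms(1,2)] by simp
next
  case (Cons i "is")
  then show ?case by (simp add: lsum_add[OF assms(1,2)] lsum_in[OF assms(1,2)])
qed

abbreviation Cl :: "('o list, ('o, 'm) add_arr) precat" where
  "Cl \<equiv> additive_closure C"

lemma closure_Hom:
  "f \<in> Hom Cl xs ys \<longleftrightarrow> (\<exists>M. f = (xs, ys, M) \<and> set xs \<subseteq> Obj C \<and> set ys \<subseteq> Obj C \<and>
     M \<in> carrier_mat (length xs) (length ys) \<and>
     (\<forall>i < length xs. \<forall>j < length ys. M $$ (i, j) \<in> Hom C (xs ! i) (ys ! j)))"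
  by (cases f) (auto simp: Hom_def additive_closure_def)

lemma closure_Obj: "xs \<in> Obj Cl \<longleftrightarrow> set xs \<subseteq> Obj C"
  by (simp add: additive_closure_def)

lemma closure_Comp:
  "(xs, ys, M) \<odot>\<^bsub>Cl\<^esub> (ys', zs, N) = (xs, zs, mat (length xs) (length zs)
     (\<lambda>(i, k). lsum (xs ! i) (zs ! k) (\<lambda>j. M $$ (i, j) \<odot> N $$ (j, k)) [0..<length ys]))"
  by (simp add: additive_closure_def lsum_def)

lemma closure_Add:
  "(xs, ys, M) \<oplus>\<^bsub>Cl\<^esub> (xs', ys', N) = (xs, ys, mat (length xs) (length ys)
     (\<lambda>(i, j). M $$ (i, j) \<oplus> N $$ (i, j)))"
  by (simp add: additive_closure_def)

lemma closure_Nul: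
  "Nul Cl xs ys = (xs, ys, mat (length xs) (length ys) (\<lambda>(i, j). Nul C (xs ! i) (ys ! j)))"
  by (simp add: additive_closure_def)

lemma closure_Ident:
  "Ident Cl xs = (xs, xs, mat (length xs) (length xs)
        (\<lambda>(i, j). if i = j then Ident C (xs ! i) else Nul C (xs ! i) (xs ! j)))"
  by (simp add: additive_closure_def)

lemma nth_Obj: "set xs \<subseteq> Obj C \<Longrightarrow> i < length xs \<Longrightarrow> xs ! i \<in> Obj C"
  by auto

text \<open>
  Matrices whose entries are identities or zero: entry \<open>(i, j)\<close> is the identity where \<open>r i j\<close>
  holds. Inclusions, projections and identities of tuples are of this form.
\<close>

definition sel :: "'o list \<Rightarrow> 'o list \<Rightarrow> (nat \<Rightarrow> nat \<Rightarrow> bool) \<Rightarrow> ('o, 'm) add_arr" where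
  "sel xs ys r = (xs, ys, mat (length xs) (length ys)
     (\<lambda>(i, j). if r i j then Ident C (xs ! i) else Nul C (xs ! i) (ys ! j)))"

definition sel_ok :: "'o list \<Rightarrow> 'o list \<Rightarrow> (nat \<Rightarrow> nat \<Rightarrow> bool) \<Rightarrow> bool" where
  "sel_ok xs ys r \<longleftrightarrow> set xs \<subseteq> Obj C \<and> set ys \<subseteq> Obj C \<and>
     (\<forall>i < length xs. \<forall>j < length ys. r i j \<longrightarrow> xs ! i = ys ! j)"

lemma sel_in: "sel_ok xs ys r \<Longrightarrow> sel xs ys r \<in> Hom Cl xs ys"
  by (auto simp: closure_Hom sel_def sel_ok_def intro!: Nul_in nth_Obj)
    (metis Ident_in nth_Obj)

text \<open>
  Each row of the left factor has at most one nonzero entry, so every entry of the product is a sum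
  with at most one nonzero term.
\<close>

lemma sel_Comp:
  assumes "sel_ok xs ys r" "sel_ok ys zs r'"
    and func: "\<And>i j j'. i < length xs \<Longrightarrow> j < length ys \<Longrightarrow> j' < length ys \<Longrightarrow> r i j \<Longrightarrow> r i j' \<Longrightarrow> j = j'"
  shows "sel xs ys r \<odot>\<^bsub>Cl\<^esub> sel ys zs r' = sel xs zs (\<lambda>i k. \<exists>j < length ys. r i j \<and> r' j k)"
proof -
  have "lsum (xs ! i) (zs ! k)
          (\<lambda>j. (if r i j then Ident C (xs ! i) else Nul C (xs ! i) (ys ! j)) \<odot>
               (if r' j k then Ident C (ys ! j) else Nul C (ys ! j) (zs ! k))) [0..<length ys] =
        (if \<exists>j < length ys. r i j \<and> r' j k then Ident C (xs ! i) else Nul C (xs ! i) (zs ! k))"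
    (is "lsum _ _ ?F _ = ?R")
    if ik: "i < length xs" "k < length zs" for i k
  proof -
    have y: "ys ! j \<in> Obj C" if "j < length ys" for j
      using assms that by (auto simp: sel_ok_def)
    have xz: "xs ! i \<in> Obj C" "zs ! k \<in> Obj C"
      using assms ik by (auto simp: sel_ok_def)
    have yz: "r' l k \<Longrightarrow> ys ! l = zs ! k" if "l < length ys" for l
      using assms(2) that ik by (auto simp: sel_ok_def)
    show ?thesis
    proof (cases "\<exists>j < length ys. r i j")
      case True
      then obtain j where j: "j < length ys" "r i j" by blast
      have xy: "xs ! i = ys ! j" using assms(1) ik j by (auto simp: sel_ok_def)
      have uniq: "j' = j" if "j' < length ys" "r i j'" for j'
        using func ik(1) j that by blast
      have ex: "(\<exists>j < length ys. r i j \<and> r' j k) \<longleftrightarrow> r' j k"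
        using j uniq by blast
      have F: "?F j = ?R"
        unfolding ex using j xy xz by (simp flip: xy)
      have "?R \<in> Hom C (xs ! i) (zs ! k)"
        unfolding ex using xz xy j yz by (auto simp: in_Hom)
      moreover have "?F l = Nul C (xs ! i) (zs ! k)" if "l \<in> set [0..<length ys]" "l \<noteq> j" for l
        using uniq[of l] that y[of l] yz[of l] xz by auto
      ultimately have "lsum (xs ! i) (zs ! k) ?F [0..<length ys] = ?F j"
        using j xz F by (intro lsum_delta) auto
      then show ?thesis using F by simp
    next
      case False
      then show ?thesis using xz y yz by (subst lsum_Nul) auto
    qed
  qed
  then show ?thesis
    by (auto simp: sel_def closure_Comp intro!: cong_mat)
qed

lemma sel_cong:
  "(\<And>i j. i < length xs \<Longrightarrow> j < length ys \<Longrightarrow> r i j = r' i j) \<Longrightarrow> sel xs ys r = sel xs ys r'"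
  by (auto simp: sel_def intro!: cong_mat)

theorem preadditive_closure: "preadditive_category Cl"
proof (unfold_locales, goal_cases)
  case (1 f) then show ?case by (auto simp: additive_closure_def)
next
  case (2 f) then show ?case by (auto simp: additive_closure_def)
next
  case (3 x)
  then show ?case
    by (auto simp: closure_Obj closure_Hom closure_Ident intro!: Nul_in Ident_in nth_Obj)
next
  case (4 f xs ys g zs)
  then obtain M N where eq: "f = (xs, ys, M)" "g = (ys, zs, N)"
    and o: "set xs \<subseteq> Obj C" "set ys \<subseteq> Obj C" "set zs \<subseteq> Obj C"
    and M: "\<And>i j. i < length xs \<Longrightarrow> j < length ys \<Longrightarrow> M $$ (i, j) \<in> Hom C (xs ! i) (ys ! j)"
    and N: "\<And>i j. i < length ys \<Longrightarrow> j < length zs \<Longrightarrow> N $$ (i, j) \<in> Hom C (ys ! i) (zs ! j)"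
    by (auto simp: closure_Hom)
  then show ?case
    by (auto simp: closure_Hom closure_Comp intro!: lsum_in nth_Obj Comp_in[OF M N])
next
  case (5 f ws xs g ys h zs)
  then obtain M N P where eq: "f = (ws, xs, M)" "g = (xs, ys, N)" "h = (ys, zs, P)"
    and o: "set ws \<subseteq> Obj C" "set xs \<subseteq> Obj C" "set ys \<subseteq> Obj C" "set zs \<subseteq> Obj C"
    and M: "\<And>i j. i < length ws \<Longrightarrow> j < length xs \<Longrightarrow> M $$ (i, j) \<in> Hom C (ws ! i) (xs ! j)"
    and N: "\<And>i j. i < length xs \<Longrightarrow> j < length ys \<Longrightarrow> N $$ (i, j) \<in> Hom C (xs ! i) (ys ! j)"
    and P: "\<And>i j. i < length ys \<Longrightarrow> j < length zs \<Longrightarrow> P $$ (i, j) \<in> Hom C (ys ! i) (zs ! j)"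
    by (auto simp: closure_Hom)
  have "lsum (ws ! i) (zs ! l) (\<lambda>k. lsum (ws ! i) (ys ! k) (\<lambda>j. M $$ (i, j) \<odot> N $$ (j, k)) [0..<length xs]
          \<odot> P $$ (k, l)) [0..<length ys] =
        lsum (ws ! i) (zs ! l) (\<lambda>j. M $$ (i, j) \<odot>
          lsum (xs ! j) (zs ! l) (\<lambda>k. N $$ (j, k) \<odot> P $$ (k, l)) [0..<length ys]) [0..<length xs]"
    (is "?L = ?R") if il: "i < length ws" "l < length zs" for i l
  proof -
    note MN = Comp_in[OF M N] and NP = Comp_in[OF N P]
    note ob = nth_Obj[OF o(1) il(1)] nth_Obj[OF o(4) il(2)] nth_Obj[OF o(2)] nth_Obj[OF o(3)]
    have "?L = lsum (ws ! i) (zs ! l) (\<lambda>k. lsum (ws ! i) (zs ! l)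
        (\<lambda>j. (M $$ (i, j) \<odot> N $$ (j, k)) \<odot> P $$ (k, l)) [0..<length xs]) [0..<length ys]"
      using il ob MN by (intro lsum_cong, intro lsum_Comp[OF _ _ _ P]) auto
    also have "\<dots> = lsum (ws ! i) (zs ! l) (\<lambda>k. lsum (ws ! i) (zs ! l)
        (\<lambda>j. M $$ (i, j) \<odot> (N $$ (j, k) \<odot> P $$ (k, l))) [0..<length xs]) [0..<length ys]"
      using il by (intro lsum_cong Comp_assoc[OF M N P]) auto
    also have "\<dots> = lsum (ws ! i) (zs ! l) (\<lambda>j. lsum (ws ! i) (zs ! l)
        (\<lambda>k. M $$ (i, j) \<odot> (N $$ (j, k) \<odot> P $$ (k, l))) [0..<length ys]) [0..<length xs]"
      using il ob by (intro lsum_swap) (auto intro!: Comp_in[OF M NP])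
    also have "\<dots> = ?R"
      using il ob NP by (intro lsum_cong, intro Comp_lsum[symmetric, OF _ _ _ M]) auto
    finally show ?thesis .
  qed
  then show ?case by (auto simp: eq closure_Comp intro!: cong_mat)
next
  case (6 f xs ys)
  then obtain M where eq: "f = (xs, ys, M)"
    and o: "set xs \<subseteq> Obj C" "set ys \<subseteq> Obj C" "M \<in> carrier_mat (length xs) (length ys)"
    and M: "\<And>i j. i < length xs \<Longrightarrow> j < length ys \<Longrightarrow> M $$ (i, j) \<in> Hom C (xs ! i) (ys ! j)"
    by (auto simp: closure_Hom)
  have "lsum (xs ! i) (ys ! k) (\<lambda>j. (if i = j then Ident C (xs ! i) else Nul C (xs ! i) (xs ! j))
      \<odot> M $$ (j, k)) [0..<length xs] = M $$ (i, k)" if "i < length xs" "k < length ys" for i k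
  proof -
    have "xs ! j \<in> Obj C" if "j < length xs" for j using o that by auto
    moreover have "M $$ (i, k) \<in> Hom C (xs ! i) (ys ! k)" using M that by blast
    ultimately show ?thesis using that o M[of _ k]
      by (subst lsum_delta[where i = i]) (auto simp: in_Hom)
  qed
  then show ?case using o by (auto simp: eq closure_Comp closure_Ident)
next
  case (7 f xs ys)
  then obtain M where eq: "f = (xs, ys, M)"
    and o: "set xs \<subseteq> Obj C" "set ys \<subseteq> Obj C" "M \<in> carrier_mat (length xs) (length ys)"
    and M: "\<And>i j. i < length xs \<Longrightarrow> j < length ys \<Longrightarrow> M $$ (i, j) \<in> Hom C (xs ! i) (ys ! j)"
    by (auto simp: closure_Hom)
  have "lsum (xs ! i) (ys ! k) (\<lambda>j. M $$ (i, j) \<odot>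
      (if j = k then Ident C (ys ! j) else Nul C (ys ! j) (ys ! k))) [0..<length ys] = M $$ (i, k)"
    if "i < length xs" "k < length ys" for i k
  proof -
    have "ys ! j \<in> Obj C" if "j < length ys" for j using o that by auto
    moreover have "M $$ (i, k) \<in> Hom C (xs ! i) (ys ! k)" using M that by blast
    ultimately show ?thesis using that o M[of i]
      by (subst lsum_delta[where i = k]) (auto simp: in_Hom)
  qed
  then show ?case using o by (auto simp: eq closure_Comp closure_Ident)
next
  case (8 xs ys)
  then show ?case by (auto simp: closure_Obj closure_Hom closure_Nul intro!: Nul_in nth_Obj)
next
  case (9 f xs ys g)
  then show ?case by (auto simp: closure_Hom closure_Add intro!: Add_in)
next
  case (10 f xs ys g h)
  then obtain M N P where "f = (xs, ys, M)" "g = (xs, ys, N)" "h = (xs, ys, P)"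
    "\<And>i j. i < length xs \<Longrightarrow> j < length ys \<Longrightarrow> M $$ (i, j) \<in> Hom C (xs ! i) (ys ! j)"
    "\<And>i j. i < length xs \<Longrightarrow> j < length ys \<Longrightarrow> N $$ (i, j) \<in> Hom C (xs ! i) (ys ! j)"
    "\<And>i j. i < length xs \<Longrightarrow> j < length ys \<Longrightarrow> P $$ (i, j) \<in> Hom C (xs ! i) (ys ! j)"
    by (auto simp: closure_Hom)
  then show ?case by (auto simp: closure_Add in_Hom add_assoc intro!: cong_mat)
next
  case (11 f xs ys g)
  then obtain M N where "f = (xs, ys, M)" "g = (xs, ys, N)"
    "\<And>i j. i < length xs \<Longrightarrow> j < length ys \<Longrightarrow> M $$ (i, j) \<in> Hom C (xs ! i) (ys ! j)"
    "\<And>i j. i < length xs \<Longrightarrow> j < length ys \<Longrightarrow> N $$ (i, j) \<in> Hom C (xs ! i) (ys ! j)"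
    by (auto simp: closure_Hom)
  then show ?case by (auto simp: closure_Add in_Hom add_commute intro!: cong_mat)
next
  case (12 f xs ys)
  then show ?case by (auto simp: closure_Hom closure_Add closure_Nul intro!: eq_matI Add_Nul)
next
  case (13 f xs ys)
  then obtain M where eq: "f = (xs, ys, M)"
    and o: "set xs \<subseteq> Obj C" "set ys \<subseteq> Obj C" "M \<in> carrier_mat (length xs) (length ys)"
    and M: "\<And>i j. i < length xs \<Longrightarrow> j < length ys \<Longrightarrow> M $$ (i, j) \<in> Hom C (xs ! i) (ys ! j)"
    by (auto simp: closure_Hom)
  have neg: "neg C (M $$ (i, j)) \<in> Hom C (xs ! i) (ys ! j)"
    "M $$ (i, j) \<oplus> neg C (M $$ (i, j)) = Nul C (xs ! i) (ys ! j)"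
    if "i < length xs" "j < length ys" for i j
    using M[OF that] by (auto simp: in_Hom)
  then show ?case using o
    by (intro bexI[of _ "(xs, ys, mat (length xs) (length ys) (\<lambda>(i, j). neg C (M $$ (i, j))))"])
      (auto simp: eq closure_Hom closure_Add closure_Nul intro!: cong_mat)
next
  case (14 f xs ys f' g zs)
  then obtain M M' N where eq: "f = (xs, ys, M)" "f' = (xs, ys, M')" "g = (ys, zs, N)"
    and o: "set xs \<subseteq> Obj C" "set ys \<subseteq> Obj C" "set zs \<subseteq> Obj C"
    and M: "\<And>i j. i < length xs \<Longrightarrow> j < length ys \<Longrightarrow> M $$ (i, j) \<in> Hom C (xs ! i) (ys ! j)"
     "\<And>i j. i < length xs \<Longrightarrow> j < length ys \<Longrightarrow> M' $$ (i, j) \<in> Hom C (xs ! i) (ys ! j)"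
     "\<And>i j. i < length ys \<Longrightarrow> j < length zs \<Longrightarrow> N $$ (i, j) \<in> Hom C (ys ! i) (zs ! j)"
    by (auto simp: closure_Hom)
  have "lsum (xs ! i) (zs ! k) (\<lambda>j. (M $$ (i, j) \<oplus> M' $$ (i, j)) \<odot> N $$ (j, k)) [0..<length ys] =
      lsum (xs ! i) (zs ! k) (\<lambda>j. M $$ (i, j) \<odot> N $$ (j, k)) [0..<length ys] \<oplus>
      lsum (xs ! i) (zs ! k) (\<lambda>j. M' $$ (i, j) \<odot> N $$ (j, k)) [0..<length ys]"
    if "i < length xs" "k < length zs" for i k
    using o that M
    by (subst lsum_add[symmetric]) (auto intro!: lsum_cong Comp_Add_left[OF M] Comp_in[OF M(1,3)] Comp_in[OF M(2,3)])
  then show ?case by (auto simp: eq closure_Comp closure_Add intro!: cong_mat)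
next
  case (15 f xs ys g zs g')
  then obtain M N N' where eq: "f = (xs, ys, M)" "g = (ys, zs, N)" "g' = (ys, zs, N')"
    and o: "set xs \<subseteq> Obj C" "set ys \<subseteq> Obj C" "set zs \<subseteq> Obj C"
    and M: "\<And>i j. i < length xs \<Longrightarrow> j < length ys \<Longrightarrow> M $$ (i, j) \<in> Hom C (xs ! i) (ys ! j)"
     "\<And>i j. i < length ys \<Longrightarrow> j < length zs \<Longrightarrow> N $$ (i, j) \<in> Hom C (ys ! i) (zs ! j)"
     "\<And>i j. i < length ys \<Longrightarrow> j < length zs \<Longrightarrow> N' $$ (i, j) \<in> Hom C (ys ! i) (zs ! j)"
    by (auto simp: closure_Hom)
  have "lsum (xs ! i) (zs ! k) (\<lambda>j. M $$ (i, j) \<odot> (N $$ (j, k) \<oplus> N' $$ (j, k))) [0..<length ys] =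
      lsum (xs ! i) (zs ! k) (\<lambda>j. M $$ (i, j) \<odot> N $$ (j, k)) [0..<length ys] \<oplus>
      lsum (xs ! i) (zs ! k) (\<lambda>j. M $$ (i, j) \<odot> N' $$ (j, k)) [0..<length ys]"
    if "i < length xs" "k < length zs" for i k
    using o that M
    by (subst lsum_add[symmetric]) (auto intro!: lsum_cong Comp_Add_right[OF M] Comp_in[OF M(1,2)] Comp_in[OF M(1,3)])
  then show ?case by (auto simp: eq closure_Comp closure_Add intro!: cong_mat)
qed

theorem additive_closure_additive: "additive_category Cl"
proof -
  interpret Cl: preadditive_category Cl by (rule preadditive_closure)
  show ?thesis
  proof
    have "zero_object Cl []"
      by (rule Cl.zero_objectI) (auto simp: closure_Obj closure_Ident closure_Nul)
    then show "\<exists>z. zero_object Cl z" by blast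
    fix xs ys assume "xs \<in> Obj Cl" "ys \<in> Obj Cl"
    then have o: "set xs \<subseteq> Obj C" "set ys \<subseteq> Obj C" by (auto simp: closure_Obj)
    let ?n = "length xs"
    let ?r = "\<lambda>i j::nat. i = j"
    let ?s = "\<lambda>i j. j = ?n + i" let ?s' = "\<lambda>i j. i = ?n + j"
    let ?i = "sel xs (xs @ ys) ?r" let ?j = "sel ys (xs @ ys) ?s"
    let ?p = "sel (xs @ ys) xs ?r" let ?q = "sel (xs @ ys) ys ?s'"
    have ok: "sel_ok xs (xs @ ys) ?r" "sel_ok ys (xs @ ys) ?s"
      "sel_ok (xs @ ys) xs ?r" "sel_ok (xs @ ys) ys ?s'"
      using o by (auto simp: sel_ok_def nth_append)
    have Id: "Ident Cl zs = sel zs zs ?r" for zs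
      by (simp add: closure_Ident sel_def)
    have Nu: "Nul Cl zs zs' = sel zs zs' (\<lambda>_ _. False)" for zs zs'
      by (simp add: closure_Nul sel_def)
    have "?i \<odot>\<^bsub>Cl\<^esub> ?p = Ident Cl xs" "?j \<odot>\<^bsub>Cl\<^esub> ?q = Ident Cl ys"
      "?i \<odot>\<^bsub>Cl\<^esub> ?q = Nul Cl xs ys" "?j \<odot>\<^bsub>Cl\<^esub> ?p = Nul Cl ys xs"
      unfolding Id Nu using ok
      by (simp_all add: sel_Comp[OF ok(1,3)] sel_Comp[OF ok(2,4)] sel_Comp[OF ok(1,4)]
          sel_Comp[OF ok(2,3)]) (auto intro!: sel_cong)
    moreover have "(?p \<odot>\<^bsub>Cl\<^esub> ?i) \<oplus>\<^bsub>Cl\<^esub> (?q \<odot>\<^bsub>Cl\<^esub> ?j) = Ident Cl (xs @ ys)"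
    proof -
      have pi: "?p \<odot>\<^bsub>Cl\<^esub> ?i = sel (xs @ ys) (xs @ ys) (\<lambda>i j. \<exists>k < length xs. i = k \<and> k = j)"
        and qj: "?q \<odot>\<^bsub>Cl\<^esub> ?j = sel (xs @ ys) (xs @ ys) (\<lambda>i j. \<exists>k < length ys. i = ?n + k \<and> j = ?n + k)"
        by (auto simp: sel_Comp[OF ok(3,1)] sel_Comp[OF ok(4,2)])
      have "(xs @ ys) ! i \<in> Obj C" if "i < length (xs @ ys)" for i
        using o that by (intro nth_Obj) auto
      then show ?thesis
        unfolding pi qj Id unfolding sel_def closure_Add
        by (auto intro!: cong_mat) presburger+
    qed
    ultimately have "is_biproduct Cl xs ys (xs @ ys) ?i ?j ?p ?q"
      using ok[THEN sel_in] by (simp add: is_biproduct_def)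
    then show "\<exists>s i j p q. is_biproduct Cl xs ys s i j p q" by blast
  qed
qed

end


section \<open>Representatives of morphisms of the Adelman category\<close>

text \<open>
  A morphism is a class of representatives modulo those of the form \<open>\<sigma>\<^sub>1 \<odot> \<rho>' \<oplus> \<gamma> \<odot> \<sigma>\<^sub>2\<close>, called null
  here. Kernels, cokernels, monomorphisms and epimorphisms are first treated as properties of
  representatives: passing to the opposite category leaves the sets of representatives and of null
  arrows unchanged and merely swaps the two arrows of each object, so that statements about
  representatives dualise literally.
\<close>

definition adel_ob :: "('o, 'm) precat \<Rightarrow> 'm adel_obj set" where
  "adel_ob A = {(\<rho>, \<gamma>). \<rho> \<in> Arr A \<and> \<gamma> \<in> Arr A \<and> Cod A \<rho> = Dom A \<gamma>}"

definition adel_null :: "('o, 'm) precat \<Rightarrow> 'm adel_obj \<Rightarrow> 'm adel_obj \<Rightarrow> 'm \<Rightarrow> bool" where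
  "adel_null A = (\<lambda>(\<rho>, \<gamma>) (\<rho>', \<gamma>') \<phi>.
     \<exists>\<sigma>\<^sub>1 \<in> Hom A (Cod A \<rho>) (Dom A \<rho>'). \<exists>\<sigma>\<^sub>2 \<in> Hom A (Cod A \<gamma>) (Cod A \<rho>').
       \<phi> = (\<sigma>\<^sub>1 \<odot>\<^bsub>A\<^esub> \<rho>') \<oplus>\<^bsub>A\<^esub> (\<gamma> \<odot>\<^bsub>A\<^esub> \<sigma>\<^sub>2))"

definition rep_cokernel ::
  "('o, 'm) precat \<Rightarrow> 'm adel_obj \<Rightarrow> 'm adel_obj \<Rightarrow> 'm \<Rightarrow> 'm adel_obj \<Rightarrow> 'm \<Rightarrow> bool" where
  "rep_cokernel A X Y \<phi> K \<pi> \<longleftrightarrow> K \<in> adel_ob A \<and> \<pi> \<in> adel_reps A Y K \<and>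
     adel_null A X K (\<phi> \<odot>\<^bsub>A\<^esub> \<pi>) \<and>
     (\<forall>Z \<in> adel_ob A. \<forall>\<tau> \<in> adel_reps A Y Z. adel_null A X Z (\<phi> \<odot>\<^bsub>A\<^esub> \<tau>) \<longrightarrow>
        (\<exists>u \<in> adel_reps A K Z. adel_null A Y Z (\<pi> \<odot>\<^bsub>A\<^esub> u \<oplus>\<^bsub>A\<^esub> neg A \<tau>))) \<and>
     (\<forall>Z \<in> adel_ob A. \<forall>u \<in> adel_reps A K Z. adel_null A Y Z (\<pi> \<odot>\<^bsub>A\<^esub> u) \<longrightarrow> adel_null A K Z u)"

definition rep_kernel ::
  "('o, 'm) precat \<Rightarrow> 'm adel_obj \<Rightarrow> 'm adel_obj \<Rightarrow> 'm \<Rightarrow> 'm adel_obj \<Rightarrow> 'm \<Rightarrow> bool" where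
  "rep_kernel A X Y \<phi> K k \<longleftrightarrow> K \<in> adel_ob A \<and> k \<in> adel_reps A K X \<and>
     adel_null A K Y (k \<odot>\<^bsub>A\<^esub> \<phi>) \<and>
     (\<forall>Z \<in> adel_ob A. \<forall>\<tau> \<in> adel_reps A Z X. adel_null A Z Y (\<tau> \<odot>\<^bsub>A\<^esub> \<phi>) \<longrightarrow>
        (\<exists>u \<in> adel_reps A Z K. adel_null A Z X (u \<odot>\<^bsub>A\<^esub> k \<oplus>\<^bsub>A\<^esub> neg A \<tau>))) \<and>
     (\<forall>Z \<in> adel_ob A. \<forall>u \<in> adel_reps A Z K. adel_null A Z X (u \<odot>\<^bsub>A\<^esub> k) \<longrightarrow> adel_null A Z K u)"

definition rep_monic :: "('o, 'm) precat \<Rightarrow> 'm adel_obj \<Rightarrow> 'm adel_obj \<Rightarrow> 'm \<Rightarrow> bool" where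
  "rep_monic A X Y \<phi> \<longleftrightarrow> (\<forall>Z \<in> adel_ob A. \<forall>t \<in> adel_reps A Z X.
     adel_null A Z Y (t \<odot>\<^bsub>A\<^esub> \<phi>) \<longrightarrow> adel_null A Z X t)"

definition rep_epic :: "('o, 'm) precat \<Rightarrow> 'm adel_obj \<Rightarrow> 'm adel_obj \<Rightarrow> 'm \<Rightarrow> bool" where
  "rep_epic A X Y \<phi> \<longleftrightarrow> (\<forall>Z \<in> adel_ob A. \<forall>t \<in> adel_reps A Y Z.
     adel_null A X Z (\<phi> \<odot>\<^bsub>A\<^esub> t) \<longrightarrow> adel_null A Y Z t)"

text \<open>
  The meaning of \<open>in_rep_image\<close>: the arrow \<open>\<tau>\<close> from \<open>W\<close> to \<open>Y\<close> is congruent to \<open>a\<^sub>2 \<odot> \<phi>\<close>, and \<open>a\<^sub>2\<close> is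
  compatible with the right-hand arrows of \<open>W\<close> and \<open>X\<close>. Only compatibility with the left-hand
  arrows is missing for a factorisation of \<open>\<tau>\<close> through \<open>\<phi>\<close>.
\<close>

definition in_rep_image ::
  "('o, 'm) precat \<Rightarrow> 'm adel_obj \<Rightarrow> 'm adel_obj \<Rightarrow> 'm adel_obj \<Rightarrow> 'm \<Rightarrow> 'm \<Rightarrow> bool" where
  "in_rep_image A W X Y \<phi> \<tau> \<longleftrightarrow>
     (\<exists>a\<^sub>1 \<in> Hom A (Cod A (fst W)) (Dom A (fst Y)). \<exists>a\<^sub>2 \<in> Hom A (Cod A (fst W)) (Cod A (fst X)).
      \<exists>b\<^sub>1 \<in> Hom A (Cod A (snd W)) (Cod A (fst Y)). \<exists>b\<^sub>2 \<in> Hom A (Cod A (snd W)) (Cod A (snd X)).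
        \<tau> = a\<^sub>1 \<odot>\<^bsub>A\<^esub> fst Y \<oplus>\<^bsub>A\<^esub> (a\<^sub>2 \<odot>\<^bsub>A\<^esub> \<phi> \<oplus>\<^bsub>A\<^esub> snd W \<odot>\<^bsub>A\<^esub> b\<^sub>1) \<and>
        a\<^sub>2 \<odot>\<^bsub>A\<^esub> snd X \<oplus>\<^bsub>A\<^esub> snd W \<odot>\<^bsub>A\<^esub> b\<^sub>2 = Nul A (Cod A (fst W)) (Cod A (snd X)))"

definition in_rep_coimage ::
  "('o, 'm) precat \<Rightarrow> 'm adel_obj \<Rightarrow> 'm adel_obj \<Rightarrow> 'm adel_obj \<Rightarrow> 'm \<Rightarrow> 'm \<Rightarrow> bool" where
  "in_rep_coimage A X Y W \<phi> \<tau> \<longleftrightarrow>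
     (\<exists>a\<^sub>1 \<in> Hom A (Cod A (snd X)) (Cod A (fst W)). \<exists>a\<^sub>2 \<in> Hom A (Cod A (fst Y)) (Cod A (fst W)).
      \<exists>b\<^sub>1 \<in> Hom A (Cod A (fst X)) (Dom A (fst W)). \<exists>b\<^sub>2 \<in> Hom A (Dom A (fst Y)) (Dom A (fst W)).
        \<tau> = snd X \<odot>\<^bsub>A\<^esub> a\<^sub>1 \<oplus>\<^bsub>A\<^esub> (\<phi> \<odot>\<^bsub>A\<^esub> a\<^sub>2 \<oplus>\<^bsub>A\<^esub> b\<^sub>1 \<odot>\<^bsub>A\<^esub> fst W) \<and>
        fst Y \<odot>\<^bsub>A\<^esub> a\<^sub>2 \<oplus>\<^bsub>A\<^esub> b\<^sub>2 \<odot>\<^bsub>A\<^esub> fst W = Nul A (Dom A (fst Y)) (Cod A (fst W)))"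

lemma adel_ob_opposite: "(Z \<in> adel_ob (opposite A)) \<longleftrightarrow> prod.swap Z \<in> adel_ob A"
  by (auto simp: adel_ob_def)

lemma Ball_adel_ob_opposite:
  "(\<forall>Z \<in> adel_ob (opposite A). P Z) \<longleftrightarrow> (\<forall>Z \<in> adel_ob A. P (prod.swap Z))"
  by (metis adel_ob_opposite swap_swap)

lemma neg_opposite: "neg (opposite A) f = neg A f"
  by (simp add: neg_def)

context preadditive_category
begin

lemma reps_opposite:
  assumes "X \<in> adel_ob C" "Y \<in> adel_ob C"
  shows "adel_reps (opposite C) (prod.swap Y) (prod.swap X) = adel_reps C X Y"
proof -
  have sym: "(\<exists>s \<in> H. f s = g s) \<longleftrightarrow> (\<exists>s \<in> H. g s = f s)" for H and f g :: "'m \<Rightarrow> 'm"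
    by metis
  obtain \<rho> \<gamma> \<rho>' \<gamma>' where [simp]: "X = (\<rho>, \<gamma>)" "Y = (\<rho>', \<gamma>')"
    by (cases X; cases Y)
  have [simp]: "Dom C \<gamma> = Cod C \<rho>" "Dom C \<gamma>' = Cod C \<rho>'"
    using assms by (auto simp: adel_ob_def)
  show ?thesis
    by (simp add: adel_reps_def) (subst (2) sym, subst (3) sym, blast)
qed

lemma null_opposite:
  assumes "X \<in> adel_ob C" "Y \<in> adel_ob C"
  shows "adel_null (opposite C) (prod.swap Y) (prod.swap X) \<phi> = adel_null C X Y \<phi>"
proof -
  obtain \<rho> \<gamma> \<rho>' \<gamma>' where [simp]: "X = (\<rho>, \<gamma>)" "Y = (\<rho>', \<gamma>')"
    by (cases X; cases Y)
  have [simp]: "\<rho> \<in> Arr C" "\<gamma> \<in> Arr C" "\<rho>' \<in> Arr C" "\<gamma>' \<in> Arr C" "Dom C \<gamma> = Cod C \<rho>" "Dom C \<gamma>' = Cod C \<rho>'"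
    using assms by (auto simp: adel_ob_def)
  have "s \<odot> \<rho>' \<oplus> \<gamma> \<odot> t = \<gamma> \<odot> t \<oplus> s \<odot> \<rho>'"
    if "s \<in> Hom C (Cod C \<rho>) (Dom C \<rho>')" "t \<in> Hom C (Cod C \<gamma>) (Cod C \<rho>')" for s t
    using that by (intro add_commute) (auto simp: in_Hom)
  then show ?thesis by (simp add: adel_null_def) metis
qed

lemma rep_kernel_opposite:
  assumes "X \<in> adel_ob C" "Y \<in> adel_ob C" "K \<in> adel_ob C"
  shows "rep_cokernel (opposite C) (prod.swap Y) (prod.swap X) \<phi> (prod.swap K) k \<longleftrightarrow>
    rep_kernel C X Y \<phi> K k"
  using assms
  by (simp add: rep_kernel_def rep_cokernel_def Ball_adel_ob_opposite reps_opposite null_opposite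
      neg_opposite adel_ob_opposite cong: ball_cong conj_cong)

lemma rep_monic_opposite:
  assumes "X \<in> adel_ob C" "Y \<in> adel_ob C"
  shows "rep_monic (opposite C) (prod.swap Y) (prod.swap X) \<phi> \<longleftrightarrow> rep_epic C X Y \<phi>"
  using assms
  by (simp add: rep_monic_def rep_epic_def Ball_adel_ob_opposite reps_opposite null_opposite cong: ball_cong)

lemma rep_cokernel_opposite:
  assumes "X \<in> adel_ob C" "Y \<in> adel_ob C" "K \<in> adel_ob C"
  shows "rep_kernel (opposite C) (prod.swap Y) (prod.swap X) \<phi> (prod.swap K) k \<longleftrightarrow>
    rep_cokernel C X Y \<phi> K k"
  using assms
  by (simp add: rep_kernel_def rep_cokernel_def Ball_adel_ob_opposite reps_opposite null_opposite
      neg_opposite adel_ob_opposite cong: ball_cong conj_cong)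

lemma in_rep_image_opposite:
  assumes "X \<in> adel_ob C" "Y \<in> adel_ob C" "W \<in> adel_ob C"
  shows "in_rep_image (opposite C) (prod.swap W) (prod.swap Y) (prod.swap X) \<phi> \<tau> \<longleftrightarrow>
    in_rep_coimage C X Y W \<phi> \<tau>"
proof -
  have "Dom C (snd X) = Cod C (fst X)" "Dom C (snd Y) = Cod C (fst Y)" "Dom C (snd W) = Cod C (fst W)"
    using assms by (auto simp: adel_ob_def)
  then show ?thesis by (simp add: in_rep_image_def in_rep_coimage_def)
qed

lemma in_reps_iff:
  "\<phi> \<in> adel_reps C (\<rho>, \<gamma>) (\<rho>', \<gamma>') \<longleftrightarrow> \<phi> \<in> Arr C \<and> Dom C \<phi> = Cod C \<rho> \<and> Cod C \<phi> = Cod C \<rho>' \<and>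
     (\<exists>\<omega> \<in> Arr C. Dom C \<omega> = Dom C \<rho> \<and> Cod C \<omega> = Dom C \<rho>' \<and> \<rho> \<odot> \<phi> = \<omega> \<odot> \<rho>') \<and>
     (\<exists>\<psi> \<in> Arr C. Dom C \<psi> = Cod C \<gamma> \<and> Cod C \<psi> = Cod C \<gamma>' \<and> \<gamma> \<odot> \<psi> = \<phi> \<odot> \<gamma>')"
  by (auto simp: adel_reps_def in_Hom)

lemma reps_typed:
  assumes "\<phi> \<in> adel_reps C X Y"
  shows "\<phi> \<in> Arr C" "Dom C \<phi> = Cod C (fst X)" "Cod C \<phi> = Cod C (fst Y)"
  using assms by (cases X; cases Y; simp add: in_reps_iff)+

lemma null_iff:
  "adel_null C (\<rho>, \<gamma>) (\<rho>', \<gamma>') \<phi> \<longleftrightarrow> (\<exists>\<sigma>\<^sub>1 \<in> Arr C. \<exists>\<sigma>\<^sub>2 \<in> Arr C.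
     Dom C \<sigma>\<^sub>1 = Cod C \<rho> \<and> Cod C \<sigma>\<^sub>1 = Dom C \<rho>' \<and> Dom C \<sigma>\<^sub>2 = Cod C \<gamma> \<and> Cod C \<sigma>\<^sub>2 = Cod C \<rho>' \<and>
     \<phi> = (\<sigma>\<^sub>1 \<odot> \<rho>') \<oplus> (\<gamma> \<odot> \<sigma>\<^sub>2))"
  unfolding adel_null_def prod.case Bex_def in_Hom by blast

lemma diff_eq_iff:
  assumes "f \<in> Arr C" "g \<in> Arr C" "h \<in> Arr C"
    "Dom C f = Dom C g" "Cod C f = Cod C g" "Dom C h = Dom C g" "Cod C h = Cod C g"
  shows "f \<oplus> neg C g = h \<longleftrightarrow> f = h \<oplus> g" "h = f \<oplus> neg C g \<longleftrightarrow> h \<oplus> g = f"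
proof -
  show *: "f \<oplus> neg C g = h \<longleftrightarrow> f = h \<oplus> g"
    using assms by (metis add_assoc add_Nul neg_simps)
  show "h = f \<oplus> neg C g \<longleftrightarrow> h \<oplus> g = f"
    using * by metis
qed

lemma adel_obE:
  assumes "X \<in> adel_ob C"
  obtains \<rho> \<gamma> where "X = (\<rho>, \<gamma>)" "\<rho> \<in> Arr C" "\<gamma> \<in> Arr C" "Dom C \<gamma> = Cod C \<rho>"
  using assms by (auto simp: adel_ob_def)

lemma in_repsE:
  assumes "\<phi> \<in> adel_reps C (\<rho>, \<gamma>) (\<rho>', \<gamma>')"
  obtains \<omega> \<psi> where "\<phi> \<in> Arr C" "Dom C \<phi> = Cod C \<rho>" "Cod C \<phi> = Cod C \<rho>'"
    "\<omega> \<in> Arr C" "Dom C \<omega> = Dom C \<rho>" "Cod C \<omega> = Dom C \<rho>'" "\<rho> \<odot> \<phi> = \<omega> \<odot> \<rho>'"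
    "\<psi> \<in> Arr C" "Dom C \<psi> = Cod C \<gamma>" "Cod C \<psi> = Cod C \<gamma>'" "\<gamma> \<odot> \<psi> = \<phi> \<odot> \<gamma>'"
  using assms by (auto simp: in_reps_iff)

lemma nullE:
  assumes "adel_null C (\<rho>, \<gamma>) (\<rho>', \<gamma>') \<phi>"
  obtains s t where "s \<in> Arr C" "Dom C s = Cod C \<rho>" "Cod C s = Dom C \<rho>'"
    "t \<in> Arr C" "Dom C t = Cod C \<gamma>" "Cod C t = Cod C \<rho>'" "\<phi> = (s \<odot> \<rho>') \<oplus> (\<gamma> \<odot> t)"
  using assms by (auto simp: null_iff)

lemma nullI:
  assumes "s \<in> Arr C" "t \<in> Arr C" "Dom C s = Cod C \<rho>" "Cod C s = Dom C \<rho>'"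
    "Dom C t = Cod C \<gamma>" "Cod C t = Cod C \<rho>'" "\<phi> = (s \<odot> \<rho>') \<oplus> (\<gamma> \<odot> t)"
  shows "adel_null C (\<rho>, \<gamma>) (\<rho>', \<gamma>') \<phi>"
  unfolding null_iff using assms by blast

lemma null_add:
  assumes X: "X \<in> adel_ob C" and Y: "Y \<in> adel_ob C" and f: "adel_null C X Y f" and g: "adel_null C X Y g"
  shows "adel_null C X Y (f \<oplus> g)"
proof -
  from X obtain \<rho> \<gamma> where [simp]: "X = (\<rho>, \<gamma>)" "\<rho> \<in> Arr C" "\<gamma> \<in> Arr C" "Dom C \<gamma> = Cod C \<rho>"
    by (rule adel_obE)
  from Y obtain \<rho>' \<gamma>' where [simp]: "Y = (\<rho>', \<gamma>')" "\<rho>' \<in> Arr C" "\<gamma>' \<in> Arr C" "Dom C \<gamma>' = Cod C \<rho>'"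
    by (rule adel_obE)
  from f[simplified] obtain s t where [simp]: "s \<in> Arr C" "Dom C s = Cod C \<rho>" "Cod C s = Dom C \<rho>'"
    "t \<in> Arr C" "Dom C t = Cod C \<gamma>" "Cod C t = Cod C \<rho>'" and fe: "f = (s \<odot> \<rho>') \<oplus> (\<gamma> \<odot> t)"
    by (rule nullE)
  from g[simplified] obtain s' t' where [simp]: "s' \<in> Arr C" "Dom C s' = Cod C \<rho>" "Cod C s' = Dom C \<rho>'"
    "t' \<in> Arr C" "Dom C t' = Cod C \<gamma>" "Cod C t' = Cod C \<rho>'" and ge: "g = (s' \<odot> \<rho>') \<oplus> (\<gamma> \<odot> t')"
    by (rule nullE)
  show ?thesis
    unfolding fe ge \<open>X = _\<close> \<open>Y = _\<close>
    by (rule nullI[of "s \<oplus> s'" "t \<oplus> t'"]) (simp_all add: distribs add_ac)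
qed

lemma null_neg:
  assumes X: "X \<in> adel_ob C" and Y: "Y \<in> adel_ob C" and f: "adel_null C X Y f"
  shows "adel_null C X Y (neg C f)"
proof -
  from X obtain \<rho> \<gamma> where [simp]: "X = (\<rho>, \<gamma>)" "\<rho> \<in> Arr C" "\<gamma> \<in> Arr C" "Dom C \<gamma> = Cod C \<rho>"
    by (rule adel_obE)
  from Y obtain \<rho>' \<gamma>' where [simp]: "Y = (\<rho>', \<gamma>')" "\<rho>' \<in> Arr C" "\<gamma>' \<in> Arr C" "Dom C \<gamma>' = Cod C \<rho>'"
    by (rule adel_obE)
  from f[simplified] obtain s t where [simp]: "s \<in> Arr C" "Dom C s = Cod C \<rho>" "Cod C s = Dom C \<rho>'"
    "t \<in> Arr C" "Dom C t = Cod C \<gamma>" "Cod C t = Cod C \<rho>'" and fe: "f = (s \<odot> \<rho>') \<oplus> (\<gamma> \<odot> t)"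
    by (rule nullE)
  show ?thesis
    unfolding fe \<open>X = _\<close> \<open>Y = _\<close>
    by (rule nullI[of "neg C s" "neg C t"]) (simp_all add: neg_add neg_Comp Comp_neg)
qed

lemma null_Nul:
  assumes X: "X \<in> adel_ob C" and Y: "Y \<in> adel_ob C"
  shows "adel_null C X Y (Nul C (Cod C (fst X)) (Cod C (fst Y)))"
proof -
  from X obtain \<rho> \<gamma> where [simp]: "X = (\<rho>, \<gamma>)" "\<rho> \<in> Arr C" "\<gamma> \<in> Arr C" "Dom C \<gamma> = Cod C \<rho>"
    by (rule adel_obE)
  from Y obtain \<rho>' \<gamma>' where [simp]: "Y = (\<rho>', \<gamma>')" "\<rho>' \<in> Arr C" "\<gamma>' \<in> Arr C" "Dom C \<gamma>' = Cod C \<rho>'"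
    by (rule adel_obE)
  show ?thesis
    unfolding  \<open>X = _\<close> \<open>Y = _\<close>
    by (rule nullI[of "Nul C (Cod C \<rho>) (Dom C \<rho>')" "Nul C (Cod C \<gamma>) (Cod C \<rho>')"]) (simp_all)
qed

lemma null_Comp_right:
  assumes X: "X \<in> adel_ob C" and Y: "Y \<in> adel_ob C" and Z: "Z \<in> adel_ob C"
    and f: "adel_null C X Y f" and g: "g \<in> adel_reps C Y Z"
  shows "adel_null C X Z (f \<odot> g)"
proof -
  from X obtain \<rho> \<gamma> where [simp]: "X = (\<rho>, \<gamma>)" "\<rho> \<in> Arr C" "\<gamma> \<in> Arr C" "Dom C \<gamma> = Cod C \<rho>"
    by (rule adel_obE)
  from Y obtain \<rho>' \<gamma>' where [simp]: "Y = (\<rho>', \<gamma>')" "\<rho>' \<in> Arr C" "\<gamma>' \<in> Arr C" "Dom C \<gamma>' = Cod C \<rho>'"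
    by (rule adel_obE)
  from Z obtain \<rho>'' \<gamma>'' where [simp]: "Z = (\<rho>'', \<gamma>'')" "\<rho>'' \<in> Arr C" "\<gamma>'' \<in> Arr C" "Dom C \<gamma>'' = Cod C \<rho>''"
    by (rule adel_obE)
  from f[simplified] obtain s t where [simp]: "s \<in> Arr C" "Dom C s = Cod C \<rho>" "Cod C s = Dom C \<rho>'"
    "t \<in> Arr C" "Dom C t = Cod C \<gamma>" "Cod C t = Cod C \<rho>'" and fe: "f = (s \<odot> \<rho>') \<oplus> (\<gamma> \<odot> t)"
    by (rule nullE)
  from g[simplified] obtain \<omega> \<psi> where [simp]: "g \<in> Arr C" "Dom C g = Cod C \<rho>'" "Cod C g = Cod C \<rho>''"
    "\<omega> \<in> Arr C" "Dom C \<omega> = Dom C \<rho>'" "Cod C \<omega> = Dom C \<rho>''" "\<rho>' \<odot> g = \<omega> \<odot> \<rho>''"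
    by (rule in_repsE) blast
  show ?thesis
    unfolding fe \<open>X = _\<close> \<open>Z = _\<close>
    by (rule nullI[of "s \<odot> \<omega>" "t \<odot> g"]) (simp_all add: distribs)
qed

lemma null_Comp_left:
  assumes X: "X \<in> adel_ob C" and Y: "Y \<in> adel_ob C" and Z: "Z \<in> adel_ob C"
    and f: "f \<in> adel_reps C X Y" and g: "adel_null C Y Z g"
  shows "adel_null C X Z (f \<odot> g)"
  using preadditive_category.null_Comp_right[OF preadditive_opposite, of "prod.swap Z" "prod.swap Y" "prod.swap X" g f]
    assms by (simp add: adel_ob_opposite null_opposite reps_opposite)

lemma reps_Comp:
  assumes X: "X \<in> adel_ob C" and Y: "Y \<in> adel_ob C" and Z: "Z \<in> adel_ob C"
    and f: "f \<in> adel_reps C X Y" and g: "g \<in> adel_reps C Y Z"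
  shows "f \<odot> g \<in> adel_reps C X Z"
proof -
  from X obtain \<rho> \<gamma> where [simp]: "X = (\<rho>, \<gamma>)" "\<rho> \<in> Arr C" "\<gamma> \<in> Arr C" "Dom C \<gamma> = Cod C \<rho>"
    by (rule adel_obE)
  from Y obtain \<rho>' \<gamma>' where [simp]: "Y = (\<rho>', \<gamma>')" "\<rho>' \<in> Arr C" "\<gamma>' \<in> Arr C" "Dom C \<gamma>' = Cod C \<rho>'"
    by (rule adel_obE)
  from Z obtain \<rho>'' \<gamma>'' where [simp]: "Z = (\<rho>'', \<gamma>'')" "\<rho>'' \<in> Arr C" "\<gamma>'' \<in> Arr C" "Dom C \<gamma>'' = Cod C \<rho>''"
    by (rule adel_obE)
  from f[simplified] obtain \<omega> \<psi> where [simp]: "f \<in> Arr C" "Dom C f = Cod C \<rho>" "Cod C f = Cod C \<rho>'"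
    "\<omega> \<in> Arr C" "Dom C \<omega> = Dom C \<rho>" "Cod C \<omega> = Dom C \<rho>'"
    "\<psi> \<in> Arr C" "Dom C \<psi> = Cod C \<gamma>" "Cod C \<psi> = Cod C \<gamma>'"
    and 1: "\<rho> \<odot> f = \<omega> \<odot> \<rho>'" "\<gamma> \<odot> \<psi> = f \<odot> \<gamma>'"
    by (rule in_repsE)
  from g[simplified] obtain \<omega>' \<psi>' where [simp]: "g \<in> Arr C" "Dom C g = Cod C \<rho>'" "Cod C g = Cod C \<rho>''"
    "\<omega>' \<in> Arr C" "Dom C \<omega>' = Dom C \<rho>'" "Cod C \<omega>' = Dom C \<rho>''"
    "\<psi>' \<in> Arr C" "Dom C \<psi>' = Cod C \<gamma>'" "Cod C \<psi>' = Cod C \<gamma>''"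
    and 2: "\<rho>' \<odot> g = \<omega>' \<odot> \<rho>''" "\<gamma>' \<odot> \<psi>' = g \<odot> \<gamma>''"
    by (rule in_repsE)
  have "\<rho> \<odot> (f \<odot> g) = (\<omega> \<odot> \<omega>') \<odot> \<rho>''"
    by (simp flip: assoc add: 1, simp add: 2)
  moreover have "\<gamma> \<odot> (\<psi> \<odot> \<psi>') = (f \<odot> g) \<odot> \<gamma>''"
    by (simp flip: assoc add: 1, simp add: 2)
  ultimately show ?thesis
    unfolding \<open>X = _\<close> \<open>Z = _\<close> in_reps_iff
    by (intro conjI bexI[of _ "\<omega> \<odot> \<omega>'"] bexI[of _ "\<psi> \<odot> \<psi>'"]) simp_all
qed

lemma reps_Add:
  assumes X: "X \<in> adel_ob C" and Y: "Y \<in> adel_ob C"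
    and f: "f \<in> adel_reps C X Y" and g: "g \<in> adel_reps C X Y"
  shows "f \<oplus> g \<in> adel_reps C X Y"
proof -
  from X obtain \<rho> \<gamma> where [simp]: "X = (\<rho>, \<gamma>)" "\<rho> \<in> Arr C" "\<gamma> \<in> Arr C" "Dom C \<gamma> = Cod C \<rho>"
    by (rule adel_obE)
  from Y obtain \<rho>' \<gamma>' where [simp]: "Y = (\<rho>', \<gamma>')" "\<rho>' \<in> Arr C" "\<gamma>' \<in> Arr C" "Dom C \<gamma>' = Cod C \<rho>'"
    by (rule adel_obE)
  from f[simplified] obtain \<omega> \<psi> where [simp]: "f \<in> Arr C" "Dom C f = Cod C \<rho>" "Cod C f = Cod C \<rho>'"
    "\<omega> \<in> Arr C" "Dom C \<omega> = Dom C \<rho>" "Cod C \<omega> = Dom C \<rho>'" "\<rho> \<odot> f = \<omega> \<odot> \<rho>'"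
    "\<psi> \<in> Arr C" "Dom C \<psi> = Cod C \<gamma>" "Cod C \<psi> = Cod C \<gamma>'" "\<gamma> \<odot> \<psi> = f \<odot> \<gamma>'"
    by (rule in_repsE)
  from g[simplified] obtain \<omega>' \<psi>' where [simp]: "g \<in> Arr C" "Dom C g = Cod C \<rho>" "Cod C g = Cod C \<rho>'"
    "\<omega>' \<in> Arr C" "Dom C \<omega>' = Dom C \<rho>" "Cod C \<omega>' = Dom C \<rho>'" "\<rho> \<odot> g = \<omega>' \<odot> \<rho>'"
    "\<psi>' \<in> Arr C" "Dom C \<psi>' = Cod C \<gamma>" "Cod C \<psi>' = Cod C \<gamma>'" "\<gamma> \<odot> \<psi>' = g \<odot> \<gamma>'"
    by (rule in_repsE)
  show ?thesis
    unfolding \<open>X = _\<close> \<open>Y = _\<close> in_reps_iff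
    by (intro conjI bexI[of _ "\<omega> \<oplus> \<omega>'"] bexI[of _ "\<psi> \<oplus> \<psi>'"]) (simp_all add: distribs)
qed

lemma reps_neg:
  assumes X: "X \<in> adel_ob C" and Y: "Y \<in> adel_ob C" and f: "f \<in> adel_reps C X Y"
  shows "neg C f \<in> adel_reps C X Y"
proof -
  from X obtain \<rho> \<gamma> where [simp]: "X = (\<rho>, \<gamma>)" "\<rho> \<in> Arr C" "\<gamma> \<in> Arr C" "Dom C \<gamma> = Cod C \<rho>"
    by (rule adel_obE)
  from Y obtain \<rho>' \<gamma>' where [simp]: "Y = (\<rho>', \<gamma>')" "\<rho>' \<in> Arr C" "\<gamma>' \<in> Arr C" "Dom C \<gamma>' = Cod C \<rho>'"
    by (rule adel_obE)
  from f[simplified] obtain \<omega> \<psi> where [simp]: "f \<in> Arr C" "Dom C f = Cod C \<rho>" "Cod C f = Cod C \<rho>'"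
    "\<omega> \<in> Arr C" "Dom C \<omega> = Dom C \<rho>" "Cod C \<omega> = Dom C \<rho>'" "\<rho> \<odot> f = \<omega> \<odot> \<rho>'"
    "\<psi> \<in> Arr C" "Dom C \<psi> = Cod C \<gamma>" "Cod C \<psi> = Cod C \<gamma>'" "\<gamma> \<odot> \<psi> = f \<odot> \<gamma>'"
    by (rule in_repsE)
  show ?thesis
    unfolding \<open>X = _\<close> \<open>Y = _\<close> in_reps_iff
    by (intro conjI bexI[of _ "neg C \<omega>"] bexI[of _ "neg C \<psi>"]) (simp_all add: neg_Comp Comp_neg)
qed

lemma reps_Nul:
  assumes X: "X \<in> adel_ob C" and Y: "Y \<in> adel_ob C"
  shows "Nul C (Cod C (fst X)) (Cod C (fst Y)) \<in> adel_reps C X Y"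
proof -
  from X obtain \<rho> \<gamma> where [simp]: "X = (\<rho>, \<gamma>)" "\<rho> \<in> Arr C" "\<gamma> \<in> Arr C" "Dom C \<gamma> = Cod C \<rho>"
    by (rule adel_obE)
  from Y obtain \<rho>' \<gamma>' where [simp]: "Y = (\<rho>', \<gamma>')" "\<rho>' \<in> Arr C" "\<gamma>' \<in> Arr C" "Dom C \<gamma>' = Cod C \<rho>'"
    by (rule adel_obE)
  show ?thesis
    unfolding \<open>X = _\<close> \<open>Y = _\<close> in_reps_iff
    by (intro conjI bexI[of _ "Nul C (Dom C \<rho>) (Dom C \<rho>')"] bexI[of _ "Nul C (Cod C \<gamma>) (Cod C \<gamma>')"]) simp_all
qed

lemma reps_Ident:
  assumes X: "X \<in> adel_ob C"
  shows "Ident C (Cod C (fst X)) \<in> adel_reps C X X"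
proof -
  from X obtain \<rho> \<gamma> where [simp]: "X = (\<rho>, \<gamma>)" "\<rho> \<in> Arr C" "\<gamma> \<in> Arr C" "Dom C \<gamma> = Cod C \<rho>"
    by (rule adel_obE)
  show ?thesis
    unfolding \<open>X = _\<close> in_reps_iff
    by (intro conjI bexI[of _ "Ident C (Dom C \<rho>)"] bexI[of _ "Ident C (Cod C \<gamma>)"]) simp_all
qed

text \<open>
  A difference is shown to be null from an equation without subtraction, which the simplifier
  decides by distributivity and reordering alone.
\<close>

lemma null_diffI:
  assumes X: "(\<rho>, \<gamma>) \<in> adel_ob C" and Y: "(\<rho>', \<gamma>') \<in> adel_ob C"
    and f: "f \<in> Arr C" "Dom C f = Cod C \<rho>" "Cod C f = Cod C \<rho>'"
    and g: "g \<in> Arr C" "Dom C g = Cod C \<rho>" "Cod C g = Cod C \<rho>'"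
    and s: "s \<in> Arr C" "Dom C s = Cod C \<rho>" "Cod C s = Dom C \<rho>'"
    and s': "s' \<in> Arr C" "Dom C s' = Cod C \<rho>" "Cod C s' = Dom C \<rho>'"
    and t: "t \<in> Arr C" "Dom C t = Cod C \<gamma>" "Cod C t = Cod C \<rho>'"
    and t': "t' \<in> Arr C" "Dom C t' = Cod C \<gamma>" "Cod C t' = Cod C \<rho>'"
    and eq: "f \<oplus> (s \<odot> \<rho>' \<oplus> \<gamma> \<odot> t) = g \<oplus> (s' \<odot> \<rho>' \<oplus> \<gamma> \<odot> t')"
  shows "adel_null C (\<rho>, \<gamma>) (\<rho>', \<gamma>') (f \<oplus> neg C g)"
proof -
  note [simp] = f g s s' t t'
  have [simp]: "\<rho> \<in> Arr C" "\<gamma> \<in> Arr C" "\<rho>' \<in> Arr C" "\<gamma>' \<in> Arr C" "Dom C \<gamma> = Cod C \<rho>" "Dom C \<gamma>' = Cod C \<rho>'"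
    using X Y by (auto simp: adel_ob_def)
  let ?n = "s \<odot> \<rho>' \<oplus> \<gamma> \<odot> t" and ?n' = "s' \<odot> \<rho>' \<oplus> \<gamma> \<odot> t'"
  have "adel_null C (\<rho>, \<gamma>) (\<rho>', \<gamma>') ?n" "adel_null C (\<rho>, \<gamma>) (\<rho>', \<gamma>') ?n'"
    by (rule nullI[of s t] nullI[of s' t']; simp)+
  then have "adel_null C (\<rho>, \<gamma>) (\<rho>', \<gamma>') (?n' \<oplus> neg C ?n)"
    by (blast intro: null_add[OF X Y] null_neg[OF X Y])
  moreover have "f = (g \<oplus> ?n') \<oplus> neg C ?n"
    by (subst eq[symmetric], subst diff_eq_iff) simp_all
  then have "f \<oplus> neg C g = ?n' \<oplus> neg C ?n"
    by (subst diff_eq_iff) (simp_all add: add_ac)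
  ultimately show ?thesis by simp
qed

end

section \<open>Kernels and cokernels of representatives\<close>

context additive_category
begin

text \<open>
  A factorisation of \<open>\<tau>\<close> from \<open>y\<close> over the cokernel must record \<open>\<tau>\<close> together with the arrow \<open>\<sigma>\<^sub>2\<close>
  from \<open>c\<close> that witnesses, with some \<open>\<sigma>\<^sub>1\<close> from \<open>x\<close>, that \<open>\<phi> \<odot> \<tau>\<close> is null. Hence its middle object is
  \<open>y \<oplus> c\<close>, and the relation between \<open>\<tau>\<close> and \<open>\<sigma>\<^sub>2\<close> is imposed by the row \<open>(\<phi>, \<gamma>)\<close> from \<open>x\<close>. The second
  conclusion reads off what it means for a composite with the projection to be null.
\<close>

lemma rep_cokernel_exists:
  assumes X: "X \<in> adel_ob C" and Y: "Y \<in> adel_ob C" and phi: "\<phi> \<in> adel_reps C X Y"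
  obtains K \<pi> where "rep_cokernel C X Y \<phi> K \<pi>"
    "\<And>W \<tau>. W \<in> adel_ob C \<Longrightarrow> \<tau> \<in> adel_reps C W Y \<Longrightarrow> adel_null C W K (\<tau> \<odot> \<pi>) \<Longrightarrow>
       in_rep_image C W X Y \<phi> \<tau>"
proof -
  from X obtain \<rho> \<gamma> where X' [simp]: "X = (\<rho>, \<gamma>)" "\<rho> \<in> Arr C" "\<gamma> \<in> Arr C" "Dom C \<gamma> = Cod C \<rho>"
    by (rule adel_obE)
  from Y obtain \<rho>' \<gamma>' where Y' [simp]: "Y = (\<rho>', \<gamma>')" "\<rho>' \<in> Arr C" "\<gamma>' \<in> Arr C" "Dom C \<gamma>' = Cod C \<rho>'"
    by (rule adel_obE)
  from phi[simplified] have [simp]: "\<phi> \<in> Arr C" "Dom C \<phi> = Cod C \<rho>" "Cod C \<phi> = Cod C \<rho>'"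
    by (auto simp: in_reps_iff)
  obtain R i1 j1 p1 q1 where B1: "is_biproduct C (Dom C \<rho>') (Cod C \<rho>) R i1 j1 p1 q1"
    using is_biproduct_exists[of "Dom C \<rho>'" "Cod C \<rho>"] by auto
  obtain M i2 j2 p2 q2 where B2: "is_biproduct C (Cod C \<rho>') (Cod C \<gamma>) M i2 j2 p2 q2"
    using is_biproduct_exists[of "Cod C \<rho>'" "Cod C \<gamma>"] by auto
  obtain D i3 j3 p3 q3 where B3: "is_biproduct C (Cod C \<gamma>') (Cod C \<gamma>) D i3 j3 p3 q3"
    using is_biproduct_exists[of "Cod C \<gamma>'" "Cod C \<gamma>"] by auto
  note [simp] = is_biproduct_simps[OF B1] is_biproduct_simps[OF B2] is_biproduct_simps[OF B3]
  note Id2 = is_biproduct_Ident[OF B2]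
  define \<rho>k where "\<rho>k = p1 \<odot> (\<rho>' \<odot> i2) \<oplus> (q1 \<odot> (\<phi> \<odot> i2) \<oplus> q1 \<odot> (\<gamma> \<odot> j2))"
  define \<gamma>k where "\<gamma>k = p2 \<odot> (\<gamma>' \<odot> i3) \<oplus> q2 \<odot> j3"
  have [simp]: "\<rho>k \<in> Arr C" "Dom C \<rho>k = R" "Cod C \<rho>k = M" "\<gamma>k \<in> Arr C" "Dom C \<gamma>k = M" "Cod C \<gamma>k = D"
    by (simp_all add: \<rho>k_def \<gamma>k_def)
  let ?K = "(\<rho>k, \<gamma>k)"
  have K: "?K \<in> adel_ob C" by (simp add: adel_ob_def)
  have pi: "i2 \<in> adel_reps C Y ?K"
    unfolding Y' in_reps_iff
    by (intro conjI bexI[of _ i1] bexI[of _ i3]) (simp_all add: \<rho>k_def \<gamma>k_def distribs)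
  have ann: "adel_null C X ?K (\<phi> \<odot> i2)"
    unfolding X' null_iff
    by (intro bexI[of _ j1] bexI[of _ "neg C j2"])
      (simp_all add: \<rho>k_def distribs Comp_neg add_assoc)
  have univ: "\<exists>u \<in> adel_reps C ?K Z. adel_null C Y Z (i2 \<odot> u \<oplus> neg C \<tau>)"
    if Z: "Z \<in> adel_ob C" and tau: "\<tau> \<in> adel_reps C Y Z" and nul: "adel_null C X Z (\<phi> \<odot> \<tau>)" for Z \<tau>
  proof -
    from Z obtain \<rho>z \<gamma>z where Z' [simp]: "Z = (\<rho>z, \<gamma>z)" "\<rho>z \<in> Arr C" "\<gamma>z \<in> Arr C" "Dom C \<gamma>z = Cod C \<rho>z"
      by (rule adel_obE)
    from tau[simplified] obtain \<omega> \<psi> where [simp]: "\<tau> \<in> Arr C" "Dom C \<tau> = Cod C \<rho>'" "Cod C \<tau> = Cod C \<rho>z"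
      "\<omega> \<in> Arr C" "Dom C \<omega> = Dom C \<rho>'" "Cod C \<omega> = Dom C \<rho>z" "\<rho>' \<odot> \<tau> = \<omega> \<odot> \<rho>z"
      "\<psi> \<in> Arr C" "Dom C \<psi> = Cod C \<gamma>'" "Cod C \<psi> = Cod C \<gamma>z" "\<gamma>' \<odot> \<psi> = \<tau> \<odot> \<gamma>z"
      by (rule in_repsE)
    from nul[simplified] obtain s t where [simp]: "s \<in> Arr C" "Dom C s = Cod C \<rho>" "Cod C s = Dom C \<rho>z"
      "t \<in> Arr C" "Dom C t = Cod C \<gamma>" "Cod C t = Cod C \<rho>z" and st: "\<phi> \<odot> \<tau> = (s \<odot> \<rho>z) \<oplus> (\<gamma> \<odot> t)"
      by (rule nullE)
    \<comment> \<open>the row \<open>(\<phi>, \<gamma>)\<close> of \<open>\<rho>k\<close> forces the sign of the second component\<close>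
    let ?u = "p2 \<odot> \<tau> \<oplus> neg C (q2 \<odot> t)"
    have "\<rho>k \<odot> ?u = (p1 \<odot> \<omega> \<oplus> q1 \<odot> s) \<odot> \<rho>z"
      by (simp add: \<rho>k_def distribs Comp_neg st add_assoc)
    moreover have "\<gamma>k \<odot> (p3 \<odot> \<psi> \<oplus> neg C (q3 \<odot> (t \<odot> \<gamma>z))) = ?u \<odot> \<gamma>z"
      by (simp add: \<gamma>k_def distribs Comp_neg neg_Comp)
    ultimately have "?u \<in> adel_reps C ?K Z"
      unfolding Z' in_reps_iff
      by (intro conjI bexI[of _ "p1 \<odot> \<omega> \<oplus> q1 \<odot> s"] bexI[of _ "p3 \<odot> \<psi> \<oplus> neg C (q3 \<odot> (t \<odot> \<gamma>z))"]) simp_all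
    moreover have "i2 \<odot> ?u \<oplus> neg C \<tau> = Nul C (Cod C (fst Y)) (Cod C (fst Z))"
      by (simp add: distribs Comp_neg)
    ultimately show ?thesis
      using null_Nul[OF Y Z] by metis
  qed
  have uniq: "adel_null C ?K Z u"
    if Z: "Z \<in> adel_ob C" and u: "u \<in> adel_reps C ?K Z" and nul: "adel_null C Y Z (i2 \<odot> u)" for Z u
  proof -
    from Z obtain \<rho>z \<gamma>z where Z' [simp]: "Z = (\<rho>z, \<gamma>z)" "\<rho>z \<in> Arr C" "\<gamma>z \<in> Arr C" "Dom C \<gamma>z = Cod C \<rho>z"
      by (rule adel_obE)
    from u[simplified] have [simp]: "u \<in> Arr C" "Dom C u = M" "Cod C u = Cod C \<rho>z"
      by (auto simp: in_reps_iff)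
    from nul[simplified] obtain s t where [simp]: "s \<in> Arr C" "Dom C s = Cod C \<rho>'" "Cod C s = Dom C \<rho>z"
      "t \<in> Arr C" "Dom C t = Cod C \<gamma>'" "Cod C t = Cod C \<rho>z" and st: "i2 \<odot> u = (s \<odot> \<rho>z) \<oplus> (\<gamma>' \<odot> t)"
      by (rule nullE)
    have "u = (p2 \<odot> i2 \<oplus> q2 \<odot> j2) \<odot> u"
      by (simp add: Id2)
    also have "\<dots> = p2 \<odot> (i2 \<odot> u) \<oplus> q2 \<odot> (j2 \<odot> u)"
      by (simp add: distribs)
    also have "\<dots> = (p2 \<odot> s) \<odot> \<rho>z \<oplus> \<gamma>k \<odot> (p3 \<odot> t \<oplus> q3 \<odot> (j2 \<odot> u))"
      by (simp add: st \<gamma>k_def distribs add_assoc)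
    finally show ?thesis
      unfolding Z' null_iff
      by (intro bexI[of _ "p2 \<odot> s"] bexI[of _ "p3 \<odot> t \<oplus> q3 \<odot> (j2 \<odot> u)"] conjI) simp_all
  qed
  show thesis
  proof (rule that[of ?K i2])
    show "rep_cokernel C X Y \<phi> ?K i2"
      unfolding rep_cokernel_def using K pi ann univ uniq by blast
    fix W \<tau>
    assume W: "W \<in> adel_ob C" and tau: "\<tau> \<in> adel_reps C W Y" and nul: "adel_null C W ?K (\<tau> \<odot> i2)"
    from W obtain \<rho>w \<gamma>w where W' [simp]: "W = (\<rho>w, \<gamma>w)" "\<rho>w \<in> Arr C" "\<gamma>w \<in> Arr C" "Dom C \<gamma>w = Cod C \<rho>w"
      by (rule adel_obE)
    from tau[simplified] have [simp]: "\<tau> \<in> Arr C" "Dom C \<tau> = Cod C \<rho>w" "Cod C \<tau> = Cod C \<rho>'"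
      by (auto simp: in_reps_iff)
    from nul[simplified] obtain a b where [simp]: "a \<in> Arr C" "Dom C a = Cod C \<rho>w" "Cod C a = R"
      "b \<in> Arr C" "Dom C b = Cod C \<gamma>w" "Cod C b = M" and ab: "\<tau> \<odot> i2 = (a \<odot> \<rho>k) \<oplus> (\<gamma>w \<odot> b)"
      by (rule nullE) simp
    have "\<tau> = (\<tau> \<odot> i2) \<odot> p2" by simp
    also have "\<dots> = (a \<odot> p1) \<odot> \<rho>' \<oplus> ((a \<odot> q1) \<odot> \<phi> \<oplus> \<gamma>w \<odot> (b \<odot> p2))"
      unfolding ab by (simp add: \<rho>k_def distribs add_assoc)
    finally have 1: "\<tau> = (a \<odot> p1) \<odot> \<rho>' \<oplus> ((a \<odot> q1) \<odot> \<phi> \<oplus> \<gamma>w \<odot> (b \<odot> p2))" .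
    have "Nul C (Cod C \<rho>w) (Cod C \<gamma>) = (\<tau> \<odot> i2) \<odot> q2" by simp
    also have "\<dots> = (a \<odot> q1) \<odot> \<gamma> \<oplus> \<gamma>w \<odot> (b \<odot> q2)"
      unfolding ab by (simp add: \<rho>k_def distribs)
    finally have 2: "(a \<odot> q1) \<odot> \<gamma> \<oplus> \<gamma>w \<odot> (b \<odot> q2) = Nul C (Cod C \<rho>w) (Cod C \<gamma>)" ..
    show "in_rep_image C W X Y \<phi> \<tau>"
      unfolding in_rep_image_def
      by (rule bexI[of _ "a \<odot> p1"], rule bexI[of _ "a \<odot> q1"], rule bexI[of _ "b \<odot> p2"],
          rule bexI[of _ "b \<odot> q2"]) (use 1 2 in \<open>simp_all add: in_Hom\<close>)
  qed
qed

end


context additive_category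
begin

lemma rep_kernel_exists:
  assumes X: "X \<in> adel_ob C" and Y: "Y \<in> adel_ob C" and phi: "\<phi> \<in> adel_reps C X Y"
  obtains K k where "rep_kernel C X Y \<phi> K k"
    "\<And>W \<tau>. W \<in> adel_ob C \<Longrightarrow> \<tau> \<in> adel_reps C X W \<Longrightarrow> adel_null C K W (k \<odot> \<tau>) \<Longrightarrow>
       in_rep_coimage C X Y W \<phi> \<tau>"
proof -
  interpret op: additive_category "opposite C" by (rule additive_opposite)
  have phi': "\<phi> \<in> adel_reps (opposite C) (prod.swap Y) (prod.swap X)"
    using phi reps_opposite[OF X Y] by simp
  have XY': "prod.swap Y \<in> adel_ob (opposite C)" "prod.swap X \<in> adel_ob (opposite C)"
    using X Y by (simp_all add: adel_ob_opposite)
  obtain K' k where K': "rep_cokernel (opposite C) (prod.swap Y) (prod.swap X) \<phi> K' k"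
    and *: "\<And>W \<tau>. W \<in> adel_ob (opposite C) \<Longrightarrow> \<tau> \<in> adel_reps (opposite C) W (prod.swap X) \<Longrightarrow>
        adel_null (opposite C) W K' (\<tau> \<odot>\<^bsub>opposite C\<^esub> k) \<Longrightarrow>
        in_rep_image (opposite C) W (prod.swap Y) (prod.swap X) \<phi> \<tau>"
    using op.rep_cokernel_exists[OF XY' phi'] by blast
  have Kob: "prod.swap K' \<in> adel_ob C" using K' by (simp add: rep_cokernel_def adel_ob_opposite)
  show thesis
  proof (rule that)
    show "rep_kernel C X Y \<phi> (prod.swap K') k"
      using K' rep_kernel_opposite[OF X Y Kob] by simp
    fix W \<tau> assume W: "W \<in> adel_ob C" and tau: "\<tau> \<in> adel_reps C X W"
      and nul: "adel_null C (prod.swap K') W (k \<odot> \<tau>)"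
    have "prod.swap W \<in> adel_ob (opposite C)" "\<tau> \<in> adel_reps (opposite C) (prod.swap W) (prod.swap X)"
      "adel_null (opposite C) (prod.swap W) K' (\<tau> \<odot>\<^bsub>opposite C\<^esub> k)"
      using W tau nul reps_opposite[OF X W] null_opposite[OF Kob W] by (simp_all add: adel_ob_opposite)
    from *[OF this] show "in_rep_coimage C X Y W \<phi> \<tau>"
      using in_rep_image_opposite[OF X Y W] by simp
  qed
qed

text \<open>
  The kernel \<open>k\<close> of a monomorphism is null, and by the description of arrows annihilated by \<open>k\<close> this
  is an equation \<open>1 = \<gamma> \<odot> p \<oplus> (\<phi> \<odot> q \<oplus> s \<odot> \<rho>)\<close> with \<open>\<rho>' \<odot> q = t \<odot> \<rho>\<close>. An arrow \<open>\<tau>\<close> killed by the cokernel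
  equals \<open>a1 \<odot> \<rho>' \<oplus> (a2 \<odot> \<phi> \<oplus> \<gamma>z \<odot> b1)\<close>, but its candidate lift \<open>a2\<close> need not respect the left-hand
  arrows, whereas \<open>\<tau> \<odot> q\<close> does and need not respect the right-hand ones. Both agree up to terms of
  the form \<open>_ \<odot> \<rho>\<close> and \<open>\<gamma>z \<odot> _\<close>; the lift \<open>u\<close> is \<open>\<tau> \<odot> q\<close> corrected by terms of the first form, and also
  \<open>a2\<close> corrected by terms of the second form.
\<close>

lemma rep_monic_is_kernel:
  assumes X: "X \<in> adel_ob C" and Y: "Y \<in> adel_ob C" and phi: "\<phi> \<in> adel_reps C X Y"
    and mono: "rep_monic C X Y \<phi>"
  obtains K \<pi> where "K \<in> adel_ob C" "\<pi> \<in> adel_reps C Y K" "rep_kernel C Y K \<pi> X \<phi>"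
proof -
  from X obtain \<rho> \<gamma> where X' [simp]: "X = (\<rho>, \<gamma>)" "\<rho> \<in> Arr C" "\<gamma> \<in> Arr C" "Dom C \<gamma> = Cod C \<rho>"
    by (rule adel_obE)
  from Y obtain \<rho>' \<gamma>' where Y' [simp]: "Y = (\<rho>', \<gamma>')" "\<rho>' \<in> Arr C" "\<gamma>' \<in> Arr C" "Dom C \<gamma>' = Cod C \<rho>'"
    by (rule adel_obE)
  from phi[simplified] have [simp]: "\<phi> \<in> Arr C" "Dom C \<phi> = Cod C \<rho>" "Cod C \<phi> = Cod C \<rho>'"
    by (auto simp: in_reps_iff)
  obtain K \<pi> where K: "rep_cokernel C X Y \<phi> K \<pi>"
    and descr: "\<And>W \<tau>. W \<in> adel_ob C \<Longrightarrow> \<tau> \<in> adel_reps C W Y \<Longrightarrow> adel_null C W K (\<tau> \<odot> \<pi>) \<Longrightarrow>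
       in_rep_image C W X Y \<phi> \<tau>"
    using rep_cokernel_exists[OF X Y phi] by blast
  obtain L k where L: "rep_kernel C X Y \<phi> L k"
    and descrk: "\<And>W \<tau>. W \<in> adel_ob C \<Longrightarrow> \<tau> \<in> adel_reps C X W \<Longrightarrow> adel_null C L W (k \<odot> \<tau>) \<Longrightarrow>
       in_rep_coimage C X Y W \<phi> \<tau>"
    using rep_kernel_exists[OF X Y phi] by blast
  have k: "k \<in> adel_reps C L X" "L \<in> adel_ob C" "adel_null C L Y (k \<odot> \<phi>)"
    using L by (auto simp: rep_kernel_def)
  have "adel_null C L X k"
    using mono k by (auto simp: rep_monic_def)
  then have "adel_null C L X (k \<odot> Ident C (Cod C (fst X)))"
    using reps_typed[OF k(1)] by simp
  from descrk[OF X reps_Ident[OF X] this, unfolded in_rep_coimage_def, simplified] obtain p q s t0 where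
    [simp]: "p \<in> Arr C" "Dom C p = Cod C \<gamma>" "Cod C p = Cod C \<rho>" "q \<in> Arr C" "Dom C q = Cod C \<rho>'"
      "Cod C q = Cod C \<rho>" "s \<in> Arr C" "Dom C s = Cod C \<rho>" "Cod C s = Dom C \<rho>"
      "t0 \<in> Arr C" "Dom C t0 = Dom C \<rho>'" "Cod C t0 = Dom C \<rho>"
    and id: "Ident C (Cod C \<rho>) = \<gamma> \<odot> p \<oplus> (\<phi> \<odot> q \<oplus> s \<odot> \<rho>)"
    and t0: "\<rho>' \<odot> q \<oplus> t0 \<odot> \<rho> = Nul C (Dom C \<rho>') (Cod C \<rho>)"
    by (auto simp: in_Hom)
  define t where "t = neg C t0"
  have [simp]: "t \<in> Arr C" "Dom C t = Dom C \<rho>'" "Cod C t = Dom C \<rho>"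
    by (simp_all add: t_def)
  have t: "\<rho>' \<odot> q = t \<odot> \<rho>"
    using t0 neg_unique[of "t0 \<odot> \<rho>" "\<rho>' \<odot> q"] by (simp add: t_def neg_Comp add_commute)
  have lift: "\<exists>u \<in> adel_reps C Z X. adel_null C Z Y (u \<odot> \<phi> \<oplus> neg C \<tau>)"
    if Z: "Z \<in> adel_ob C" and tau: "\<tau> \<in> adel_reps C Z Y" and nul: "adel_null C Z K (\<tau> \<odot> \<pi>)" for Z \<tau>
  proof -
    from Z obtain \<rho>z \<gamma>z where Z' [simp]: "Z = (\<rho>z, \<gamma>z)" "\<rho>z \<in> Arr C" "\<gamma>z \<in> Arr C" "Dom C \<gamma>z = Cod C \<rho>z"
      by (rule adel_obE)
    from tau[simplified] obtain \<omega> \<psi> where [simp]: "\<tau> \<in> Arr C" "Dom C \<tau> = Cod C \<rho>z" "Cod C \<tau> = Cod C \<rho>'"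
      "\<omega> \<in> Arr C" "Dom C \<omega> = Dom C \<rho>z" "Cod C \<omega> = Dom C \<rho>'" and om: "\<rho>z \<odot> \<tau> = \<omega> \<odot> \<rho>'"
      by (rule in_repsE)
    from descr[OF Z tau nul, unfolded in_rep_image_def, simplified] obtain a1 a2 b1 b0 where [simp]:
      "a1 \<in> Arr C" "Dom C a1 = Cod C \<rho>z" "Cod C a1 = Dom C \<rho>'"
      "a2 \<in> Arr C" "Dom C a2 = Cod C \<rho>z" "Cod C a2 = Cod C \<rho>"
      "b1 \<in> Arr C" "Dom C b1 = Cod C \<gamma>z" "Cod C b1 = Cod C \<rho>'"
      "b0 \<in> Arr C" "Dom C b0 = Cod C \<gamma>z" "Cod C b0 = Cod C \<gamma>"
      and tau_eq: "\<tau> = a1 \<odot> \<rho>' \<oplus> (a2 \<odot> \<phi> \<oplus> \<gamma>z \<odot> b1)"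
      and b0: "a2 \<odot> \<gamma> \<oplus> \<gamma>z \<odot> b0 = Nul C (Cod C \<rho>z) (Cod C \<gamma>)"
      by (auto simp: in_Hom)
    define b2 where "b2 = neg C b0"
    have [simp]: "b2 \<in> Arr C" "Dom C b2 = Cod C \<gamma>z" "Cod C b2 = Cod C \<gamma>"
      by (simp_all add: b2_def)
    have b2: "a2 \<odot> \<gamma> = \<gamma>z \<odot> b2"
      using b0 neg_unique[of "\<gamma>z \<odot> b0" "a2 \<odot> \<gamma>"] by (simp add: b2_def Comp_neg add_commute)
    have b2': "a2 \<odot> (\<gamma> \<odot> f) = \<gamma>z \<odot> (b2 \<odot> f)" if "f \<in> Arr C" "Dom C f = Cod C \<gamma>" for f
      using that b2 by (simp flip: assoc)
    have t': "\<rho>' \<odot> (q \<odot> f) = t \<odot> (\<rho> \<odot> f)" if "f \<in> Arr C" "Dom C f = Cod C \<rho>" for f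
      using that t by (simp flip: assoc)
    have om': "\<rho>z \<odot> (\<tau> \<odot> f) = \<omega> \<odot> (\<rho>' \<odot> f)" if "f \<in> Arr C" "Dom C f = Cod C \<rho>'" for f
      using that om by (simp flip: assoc)
    define u where "u = a2 \<odot> (s \<odot> \<rho>) \<oplus> (\<tau> \<odot> q \<oplus> neg C (a1 \<odot> (t \<odot> \<rho>)))"
    have [simp]: "u \<in> Arr C" "Dom C u = Cod C \<rho>z" "Cod C u = Cod C \<rho>"
      by (simp_all add: u_def)
    have "\<tau> \<odot> q = a1 \<odot> (t \<odot> \<rho>) \<oplus> (a2 \<odot> (\<phi> \<odot> q) \<oplus> \<gamma>z \<odot> (b1 \<odot> q))"
      unfolding tau_eq by (simp add: distribs t)
    then have "\<tau> \<odot> q \<oplus> neg C (a1 \<odot> (t \<odot> \<rho>)) = a2 \<odot> (\<phi> \<odot> q) \<oplus> \<gamma>z \<odot> (b1 \<odot> q)"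
      by (subst diff_eq_iff) (simp_all add: add_ac)
    then have u: "u = a2 \<odot> (s \<odot> \<rho>) \<oplus> (a2 \<odot> (\<phi> \<odot> q) \<oplus> \<gamma>z \<odot> (b1 \<odot> q))"
      by (simp add: u_def)
    have "a2 = a2 \<odot> Ident C (Cod C \<rho>)" by simp
    also have "\<dots> = \<gamma>z \<odot> (b2 \<odot> p) \<oplus> (a2 \<odot> (\<phi> \<odot> q) \<oplus> a2 \<odot> (s \<odot> \<rho>))"
      unfolding id by (simp add: distribs b2')
    finally have a2: "u \<oplus> \<gamma>z \<odot> (b2 \<odot> p) = a2 \<oplus> \<gamma>z \<odot> (b1 \<odot> q)"
      by (simp add: u add_ac)
    have "\<rho>z \<odot> u = (\<rho>z \<odot> (a2 \<odot> s) \<oplus> (\<omega> \<odot> t \<oplus> neg C (\<rho>z \<odot> (a1 \<odot> t)))) \<odot> \<rho>"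
      by (simp add: u_def distribs om' t neg_Comp Comp_neg)
    moreover have "u \<odot> \<gamma> \<oplus> \<gamma>z \<odot> (b2 \<odot> (p \<odot> \<gamma>)) = \<gamma>z \<odot> (b2 \<oplus> b1 \<odot> (q \<odot> \<gamma>))"
    proof -
      have "u \<odot> \<gamma> \<oplus> \<gamma>z \<odot> (b2 \<odot> (p \<odot> \<gamma>)) = (u \<oplus> \<gamma>z \<odot> (b2 \<odot> p)) \<odot> \<gamma>"
        by (simp add: distribs)
      then show ?thesis unfolding a2 by (simp add: distribs b2)
    qed
    then have "\<gamma>z \<odot> (b2 \<oplus> b1 \<odot> (q \<odot> \<gamma>) \<oplus> neg C (b2 \<odot> (p \<odot> \<gamma>))) = u \<odot> \<gamma>"
      by (simp add: Comp_add_right[of \<gamma>z "b2 \<oplus> b1 \<odot> (q \<odot> \<gamma>)"] Comp_neg diff_eq_iff)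
    ultimately have u_rep: "u \<in> adel_reps C Z X"
      unfolding Z' X' in_reps_iff
      by (intro conjI bexI[of _ "\<rho>z \<odot> (a2 \<odot> s) \<oplus> (\<omega> \<odot> t \<oplus> neg C (\<rho>z \<odot> (a1 \<odot> t)))"]
          bexI[of _ "b2 \<oplus> b1 \<odot> (q \<odot> \<gamma>) \<oplus> neg C (b2 \<odot> (p \<odot> \<gamma>))"]) simp_all
    have "u \<odot> \<phi> \<oplus> \<gamma>z \<odot> (b2 \<odot> (p \<odot> \<phi>)) = (u \<oplus> \<gamma>z \<odot> (b2 \<odot> p)) \<odot> \<phi>"
      by (simp add: distribs)
    then have "u \<odot> \<phi> \<oplus> \<gamma>z \<odot> (b2 \<odot> (p \<odot> \<phi>)) = a2 \<odot> \<phi> \<oplus> \<gamma>z \<odot> (b1 \<odot> (q \<odot> \<phi>))"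
      unfolding a2 by (simp add: distribs)
    then have "(u \<odot> \<phi> \<oplus> \<gamma>z \<odot> (b2 \<odot> (p \<odot> \<phi>))) \<oplus> (a1 \<odot> \<rho>' \<oplus> \<gamma>z \<odot> b1) =
        (a2 \<odot> \<phi> \<oplus> \<gamma>z \<odot> (b1 \<odot> (q \<odot> \<phi>))) \<oplus> (a1 \<odot> \<rho>' \<oplus> \<gamma>z \<odot> b1)" by simp
    then have "u \<odot> \<phi> \<oplus> (a1 \<odot> \<rho>' \<oplus> \<gamma>z \<odot> (b2 \<odot> (p \<odot> \<phi>) \<oplus> b1)) =
        \<tau> \<oplus> (Nul C (Cod C \<rho>z) (Dom C \<rho>') \<odot> \<rho>' \<oplus> \<gamma>z \<odot> (b1 \<odot> (q \<odot> \<phi>)))"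
      by (simp add: tau_eq distribs add_ac)
    then have "adel_null C Z Y (u \<odot> \<phi> \<oplus> neg C \<tau>)"
      unfolding Z' Y' by (intro null_diffI[where s = a1 and t = "b2 \<odot> (p \<odot> \<phi>) \<oplus> b1"
            and s' = "Nul C (Cod C \<rho>z) (Dom C \<rho>')" and t' = "b1 \<odot> (q \<odot> \<phi>)"])
        (use Y Z in simp_all)
    with u_rep show ?thesis by blast
  qed
  have "rep_kernel C Y K \<pi> X \<phi>"
    using X phi K lift mono by (auto simp: rep_kernel_def rep_cokernel_def rep_monic_def)
  then show thesis using K by (intro that) (auto simp: rep_cokernel_def)
qed

lemma rep_epic_is_cokernel:
  assumes X: "X \<in> adel_ob C" and Y: "Y \<in> adel_ob C" and phi: "\<phi> \<in> adel_reps C X Y"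
    and epi: "rep_epic C X Y \<phi>"
  obtains K k where "K \<in> adel_ob C" "k \<in> adel_reps C K X" "rep_cokernel C K X k Y \<phi>"
proof -
  interpret op: additive_category "opposite C" by (rule additive_opposite)
  have "\<phi> \<in> adel_reps (opposite C) (prod.swap Y) (prod.swap X)"
     "prod.swap Y \<in> adel_ob (opposite C)" "prod.swap X \<in> adel_ob (opposite C)"
     "rep_monic (opposite C) (prod.swap Y) (prod.swap X) \<phi>"
    using X Y phi epi reps_opposite[OF X Y] by (simp_all add: adel_ob_opposite rep_monic_opposite)
  then obtain K k where K: "K \<in> adel_ob (opposite C)" "k \<in> adel_reps (opposite C) (prod.swap X) K"
    "rep_kernel (opposite C) (prod.swap X) K k (prod.swap Y) \<phi>"
    using op.rep_monic_is_kernel by metis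
  show thesis
    by (rule that[of "prod.swap K" k])
      (use K X Y reps_opposite[of "prod.swap K" X] rep_cokernel_opposite[of "prod.swap K" X Y]
        in \<open>simp_all add: adel_ob_opposite\<close>)
qed

end

section \<open>The Adelman category is abelian\<close>

context preadditive_category
begin

abbreviation Adel :: "('m adel_obj, 'm adel_arr) precat" where
  "Adel \<equiv> adelman C"

lemma Obj_adelman [simp]: "Obj Adel = adel_ob C"
  by (simp add: adelman_def adel_ob_def Let_def)

lemma adel_rel_iff:
  assumes X: "X \<in> adel_ob C" and Y: "Y \<in> adel_ob C"
  shows "(\<phi>, \<phi>') \<in> adel_rel C X Y \<longleftrightarrow> \<phi> \<in> adel_reps C X Y \<and> \<phi>' \<in> adel_reps C X Y \<and>
    adel_null C X Y (\<phi> \<oplus> neg C \<phi>')"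
proof -
  have "(\<exists>\<sigma>\<^sub>1 \<in> Hom C (Cod C \<rho>) (Dom C \<rho>'). \<exists>\<sigma>\<^sub>2 \<in> Hom C (Cod C \<gamma>) (Cod C \<rho>').
          \<phi> = \<phi>' \<oplus> ((\<sigma>\<^sub>1 \<odot> \<rho>') \<oplus> (\<gamma> \<odot> \<sigma>\<^sub>2))) \<longleftrightarrow> adel_null C (\<rho>, \<gamma>) (\<rho>', \<gamma>') (\<phi> \<oplus> neg C \<phi>')"
    if "X = (\<rho>, \<gamma>)" "Y = (\<rho>', \<gamma>')" "\<phi> \<in> adel_reps C X Y" "\<phi>' \<in> adel_reps C X Y" for \<rho> \<gamma> \<rho>' \<gamma>'
  proof -
    have [simp]: "\<rho> \<in> Arr C" "\<gamma> \<in> Arr C" "\<rho>' \<in> Arr C" "\<gamma>' \<in> Arr C" "Dom C \<gamma> = Cod C \<rho>"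
      using that X Y by (auto simp: adel_ob_def)
    note [simp] = reps_typed[OF that(3)] reps_typed[OF that(4)] that(1,2)
    have "\<phi> = \<phi>' \<oplus> ((s \<odot> \<rho>') \<oplus> (\<gamma> \<odot> t)) \<longleftrightarrow> \<phi> \<oplus> neg C \<phi>' = (s \<odot> \<rho>') \<oplus> (\<gamma> \<odot> t)"
      if "s \<in> Hom C (Cod C \<rho>) (Dom C \<rho>')" "t \<in> Hom C (Cod C \<gamma>) (Cod C \<rho>')" for s t
      using that by (subst diff_eq_iff) (simp_all add: in_Hom add_commute)
    then show ?thesis by (simp add: adel_null_def)
  qed
  then show ?thesis
    unfolding adel_rel_def by (cases X; cases Y) fastforce
qed

lemma equiv_adel_rel:
  assumes X: "X \<in> adel_ob C" and Y: "Y \<in> adel_ob C"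
  shows "equiv (adel_reps C X Y) (adel_rel C X Y)"
proof (rule equivI)
  note r = adel_rel_iff[OF X Y]
  note typed = reps_typed[of _ X Y]
  show "adel_rel C X Y \<subseteq> adel_reps C X Y \<times> adel_reps C X Y"
    using r by auto
  show "refl_on (adel_reps C X Y) (adel_rel C X Y)"
    using null_Nul[OF X Y] typed by (auto simp: refl_on_def r)
  show "sym (adel_rel C X Y)"
  proof (rule symI)
    fix f g assume fg: "(f, g) \<in> adel_rel C X Y"
    then have "adel_null C X Y (neg C (f \<oplus> neg C g))"
      by (intro null_neg[OF X Y]) (simp add: r)
    then show "(g, f) \<in> adel_rel C X Y"
      using fg typed[of f] typed[of g] by (simp add: r neg_add add_commute)
  qed
  show "trans (adel_rel C X Y)"
  proof (rule transI)
    fix f g h assume fgh: "(f, g) \<in> adel_rel C X Y" "(g, h) \<in> adel_rel C X Y"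
    then have "adel_null C X Y ((f \<oplus> neg C g) \<oplus> (g \<oplus> neg C h))"
      by (intro null_add[OF X Y, of "f \<oplus> neg C g"]) (simp_all add: r)
    moreover have "(f \<oplus> neg C g) \<oplus> (g \<oplus> neg C h) = f \<oplus> neg C h"
      using fgh[unfolded r] typed[of f] typed[of g] typed[of h] by (simp add: add_assoc)
    ultimately show "(f, h) \<in> adel_rel C X Y"
      using fgh by (simp add: r)
  qed
qed

abbreviation cls :: "'m adel_obj \<Rightarrow> 'm adel_obj \<Rightarrow> 'm \<Rightarrow> 'm adel_arr" where
  "cls \<equiv> adel_class C"

lemma class_simps [simp]:
  "Dom Adel (cls X Y \<phi>) = X" "Cod Adel (cls X Y \<phi>) = Y"
  by (simp_all add: adelman_def adel_class_def Let_def)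

lemma class_eq_iff:
  assumes "X \<in> adel_ob C" "Y \<in> adel_ob C" "\<phi> \<in> adel_reps C X Y" "\<phi>' \<in> adel_reps C X Y"
  shows "cls X Y \<phi> = cls X Y \<phi>' \<longleftrightarrow> adel_null C X Y (\<phi> \<oplus> neg C \<phi>')"
  using eq_equiv_class_iff[OF equiv_adel_rel[OF assms(1,2)] assms(3,4)] assms
  by (simp add: adel_class_def adel_rel_iff)

lemma class_eq_Nul_iff:
  assumes "X \<in> adel_ob C" "Y \<in> adel_ob C" "\<phi> \<in> adel_reps C X Y"
  shows "cls X Y \<phi> = Nul Adel X Y \<longleftrightarrow> adel_null C X Y \<phi>"
proof -
  have "Nul Adel X Y = cls X Y (Nul C (Cod C (fst X)) (Cod C (fst Y)))"
    by (simp add: adelman_def Let_def)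
  moreover have "Cod C (fst X) \<in> Obj C" "Cod C (fst Y) \<in> Obj C"
    using assms by (auto simp: adel_ob_def)
  ultimately show ?thesis
    using class_eq_iff[OF assms reps_Nul[OF assms(1,2)]] reps_typed[OF assms(3)] by simp
qed

lemma Hom_adelman:
  "f \<in> Hom Adel X Y \<longleftrightarrow> X \<in> adel_ob C \<and> Y \<in> adel_ob C \<and> (\<exists>\<phi> \<in> adel_reps C X Y. f = cls X Y \<phi>)"
  by (cases f) (auto simp: Hom_def adelman_def adel_class_def quotient_def Let_def adel_ob_def)

lemma Hom_adelE:
  assumes "f \<in> Hom Adel X Y"
  obtains \<phi> where "X \<in> adel_ob C" "Y \<in> adel_ob C" "\<phi> \<in> adel_reps C X Y" "f = cls X Y \<phi>"
  using assms Hom_adelman by blast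

lemma class_in_Hom:
  "X \<in> adel_ob C \<Longrightarrow> Y \<in> adel_ob C \<Longrightarrow> \<phi> \<in> adel_reps C X Y \<Longrightarrow> cls X Y \<phi> \<in> Hom Adel X Y"
  by (auto simp: Hom_adelman)

lemma class_in_Arr [simp]:
  "X \<in> adel_ob C \<Longrightarrow> Y \<in> adel_ob C \<Longrightarrow> \<phi> \<in> adel_reps C X Y \<Longrightarrow> cls X Y \<phi> \<in> Arr Adel"
  using class_in_Hom by (auto simp: in_Hom)

lemma ArrE:
  assumes "f \<in> Arr Adel"
  obtains X Y \<phi> where "X \<in> adel_ob C" "Y \<in> adel_ob C" "\<phi> \<in> adel_reps C X Y" "f = cls X Y \<phi>"
  using assms Hom_adelman[of f "Dom Adel f" "Cod Adel f"] unfolding in_Hom by blast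

lemma class_Comp:
  assumes X: "X \<in> adel_ob C" and Y: "Y \<in> adel_ob C" and Z: "Z \<in> adel_ob C"
    and f: "f \<in> adel_reps C X Y" and g: "g \<in> adel_reps C Y Z"
  shows "cls X Y f \<odot>\<^bsub>Adel\<^esub> cls Y Z g = cls X Z (f \<odot> g)"
proof -
  note E = equiv_adel_rel[OF X Y] equiv_adel_rel[OF Y Z]
  have "(\<Union>f' \<in> adel_rel C X Y `` {f}. \<Union>g' \<in> adel_rel C Y Z `` {g}.
      adel_rel C X Z `` {f' \<odot> g'}) = adel_rel C X Z `` {f \<odot> g}"
  proof (rule UN_equiv_class2[OF E _ f g])
    show "congruent2 (adel_rel C X Y) (adel_rel C Y Z) (\<lambda>f g. adel_rel C X Z `` {f \<odot> g})"
    proof (rule congruent2I[OF E])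
      fix g f f' assume *: "g \<in> adel_reps C Y Z" "(f, f') \<in> adel_rel C X Y"
      then have "adel_null C X Z ((f \<oplus> neg C f') \<odot> g)"
        by (intro null_Comp_right[OF X Y Z]) (auto simp: adel_rel_iff[OF X Y])
      then show "adel_rel C X Z `` {f \<odot> g} = adel_rel C X Z `` {f' \<odot> g}"
        using * reps_typed[of f X Y] reps_typed[of f' X Y] reps_typed[OF *(1)] reps_Comp[OF X Y Z]
        by (intro equiv_class_eq[OF equiv_adel_rel[OF X Z]])
          (simp add: adel_rel_iff X Y Z distribs neg_Comp)
    next
      fix f g g' assume *: "f \<in> adel_reps C X Y" "(g, g') \<in> adel_rel C Y Z"
      then have "adel_null C X Z (f \<odot> (g \<oplus> neg C g'))"
        by (intro null_Comp_left[OF X Y Z]) (auto simp: adel_rel_iff[OF Y Z])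
      then show "adel_rel C X Z `` {f \<odot> g} = adel_rel C X Z `` {f \<odot> g'}"
        using * reps_typed[of g Y Z] reps_typed[of g' Y Z] reps_typed[OF *(1)] reps_Comp[OF X Y Z]
        by (intro equiv_class_eq[OF equiv_adel_rel[OF X Z]])
          (simp add: adel_rel_iff X Y Z distribs Comp_neg)
    qed
  qed
  then show ?thesis by (simp add: adelman_def adel_class_def Let_def)
qed

lemma class_Add:
  assumes X: "X \<in> adel_ob C" and Y: "Y \<in> adel_ob C"
    and f: "f \<in> adel_reps C X Y" and g: "g \<in> adel_reps C X Y"
  shows "cls X Y f \<oplus>\<^bsub>Adel\<^esub> cls X Y g = cls X Y (f \<oplus> g)"
proof -
  note E = equiv_adel_rel[OF X Y]
  have "(\<Union>f' \<in> adel_rel C X Y `` {f}. \<Union>g' \<in> adel_rel C X Y `` {g}.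
      adel_rel C X Y `` {f' \<oplus> g'}) = adel_rel C X Y `` {f \<oplus> g}"
  proof (rule UN_equiv_class2[OF E E _ f g])
    show "congruent2 (adel_rel C X Y) (adel_rel C X Y) (\<lambda>f g. adel_rel C X Y `` {f \<oplus> g})"
    proof (rule congruent2_commuteI[OF E])
      fix f g assume "f \<in> adel_reps C X Y" "g \<in> adel_reps C X Y"
      then show "adel_rel C X Y `` {f \<oplus> g} = adel_rel C X Y `` {g \<oplus> f}"
        using reps_typed by (subst add_commute) auto
    next
      fix h f f' assume *: "h \<in> adel_reps C X Y" "(f, f') \<in> adel_rel C X Y"
      then have f: "f \<in> adel_reps C X Y" "f' \<in> adel_reps C X Y"
        by (auto simp: adel_rel_iff X Y)
      have "(h \<oplus> f) \<oplus> neg C (h \<oplus> f') = f \<oplus> neg C f'"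
        using reps_typed[OF *(1)] f[THEN reps_typed(1)] f[THEN reps_typed(2)] f[THEN reps_typed(3)]
        by (simp add: neg_add add_commute[of h f] add_assoc)
      then show "adel_rel C X Y `` {h \<oplus> f} = adel_rel C X Y `` {h \<oplus> f'}"
        using * f reps_Add[OF X Y]
        by (intro equiv_class_eq[OF equiv_adel_rel[OF X Y]]) (simp add: adel_rel_iff X Y)
    qed
  qed
  then show ?thesis by (simp add: adelman_def adel_class_def Let_def)
qed

lemma adelman_Ident: "Ident Adel X = cls X X (Ident C (Cod C (fst X)))"
  by (simp add: adelman_def Let_def)

lemma adelman_Nul: "Nul Adel X Y = cls X Y (Nul C (Cod C (fst X)) (Cod C (fst Y)))"
  by (simp add: adelman_def Let_def)

lemma adel_ob_Obj [simp]: "X \<in> adel_ob C \<Longrightarrow> Cod C (fst X) \<in> Obj C"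
  by (auto simp: adel_ob_def)

theorem preadditive_adelman: "preadditive_category Adel"
proof (unfold_locales, goal_cases)
  case (1 f) then show ?case by (auto elim: ArrE)
next
  case (2 f) then show ?case by (auto elim: ArrE)
next
  case (3 x)
  then show ?case by (auto simp: adelman_Ident intro!: class_in_Hom reps_Ident)
next
  case (4 f X Y g Z)
  then show ?case by (elim Hom_adelE) (auto simp: class_Comp intro!: class_in_Hom reps_Comp[of X Y Z])
next
  case (5 f W X g Y h Z)
  then show ?case by (elim Hom_adelE) (simp add: class_Comp reps_Comp reps_typed)
next
  case (6 f X Y)
  then show ?case by (elim Hom_adelE) (simp add: class_Comp adelman_Ident reps_Ident reps_typed)
next
  case (7 f X Y)
  then show ?case by (elim Hom_adelE) (simp add: class_Comp adelman_Ident reps_Ident reps_typed)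
next
  case (8 X Y)
  then show ?case by (auto simp: adelman_Nul intro!: class_in_Hom reps_Nul)
next
  case (9 f X Y g)
  then show ?case by (elim Hom_adelE) (auto simp: class_Add intro!: class_in_Hom reps_Add)
next
  case (10 f X Y g h)
  then show ?case by (elim Hom_adelE) (simp add: class_Add reps_Add reps_typed add_assoc)
next
  case (11 f X Y g)
  then show ?case by (elim Hom_adelE) (simp add: class_Add reps_typed add_commute)
next
  case (12 f X Y)
  then show ?case by (elim Hom_adelE) (simp add: class_Add adelman_Nul reps_Nul reps_typed)
next
  case (13 f X Y)
  then obtain \<phi> where "X \<in> adel_ob C" "Y \<in> adel_ob C" "\<phi> \<in> adel_reps C X Y" "f = cls X Y \<phi>"
    by (auto simp: Hom_adelman)
  then show ?case
    by (intro bexI[of _ "cls X Y (neg C \<phi>)"])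
      (auto simp: class_Add reps_neg adelman_Nul reps_typed intro!: class_in_Hom)
next
  case (14 f X Y f' g Z)
  then show ?case by (elim Hom_adelE) (simp add: class_Add class_Comp reps_Add reps_Comp reps_typed distribs)
next
  case (15 f X Y g Z g')
  then show ?case by (elim Hom_adelE) (simp add: class_Add class_Comp reps_Add reps_Comp reps_typed distribs)
qed

lemma is_kernel_class:
  assumes X: "X \<in> adel_ob C" and Y: "Y \<in> adel_ob C" and phi: "\<phi> \<in> adel_reps C X Y"
    and ker: "rep_kernel C X Y \<phi> K k"
  shows "is_kernel Adel (cls X Y \<phi>) (cls K X k)"
  unfolding is_kernel_def class_simps
proof (intro conjI ballI impI)
  have K: "K \<in> adel_ob C" "k \<in> adel_reps C K X" "adel_null C K Y (k \<odot> \<phi>)"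
    using ker unfolding rep_kernel_def by blast+
  show "cls K X k \<in> Hom Adel K X" using K X by (intro class_in_Hom)
  show "cls K X k \<odot>\<^bsub>Adel\<^esub> cls X Y \<phi> = Nul Adel K Y"
    using K X Y phi by (simp add: class_Comp class_eq_Nul_iff reps_Comp[of K X Y])
  fix W t assume "W \<in> Obj Adel" "t \<in> Hom Adel W X" and tn: "t \<odot>\<^bsub>Adel\<^esub> cls X Y \<phi> = Nul Adel W Y"
  then obtain \<tau> where W: "W \<in> adel_ob C" and tau: "\<tau> \<in> adel_reps C W X" "t = cls W X \<tau>"
    by (auto simp: Hom_adelman)
  have "adel_null C W Y (\<tau> \<odot> \<phi>)"
    using tn W tau X Y phi by (simp add: class_Comp class_eq_Nul_iff reps_Comp[of W X Y])
  then obtain u where u: "u \<in> adel_reps C W K" "adel_null C W X (u \<odot> k \<oplus> neg C \<tau>)"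
    using ker W tau(1) unfolding rep_kernel_def by blast
  have eq: "cls W K u \<odot>\<^bsub>Adel\<^esub> cls K X k = t"
    using u K X W tau by (simp add: class_Comp class_eq_iff reps_Comp[of W K X])
  show "\<exists>!u. u \<in> Hom Adel W K \<and> u \<odot>\<^bsub>Adel\<^esub> cls K X k = t"
  proof (intro ex1I conjI)
    show "cls W K u \<in> Hom Adel W K" using W K u by (intro class_in_Hom)
    show "cls W K u \<odot>\<^bsub>Adel\<^esub> cls K X k = t" by (rule eq)
    fix v assume v: "v \<in> Hom Adel W K \<and> v \<odot>\<^bsub>Adel\<^esub> cls K X k = t"
    then obtain v' where v': "v' \<in> adel_reps C W K" "v = cls W K v'"
      by (auto simp: Hom_adelman)
    have "cls W K v' \<odot>\<^bsub>Adel\<^esub> cls K X k = cls W K u \<odot>\<^bsub>Adel\<^esub> cls K X k"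
      using v v' eq by simp
    then have "adel_null C W X (v' \<odot> k \<oplus> neg C (u \<odot> k))"
      using v' u K X W by (simp add: class_Comp class_eq_iff reps_Comp[of W K X])
    then have "adel_null C W X ((v' \<oplus> neg C u) \<odot> k)"
      using reps_typed[OF v'(1)] reps_typed[OF u(1)] reps_typed[OF K(2)]
      by (simp add: distribs neg_Comp)
    moreover have "v' \<oplus> neg C u \<in> adel_reps C W K"
      using v' u W K by (intro reps_Add reps_neg)
    ultimately have "adel_null C W K (v' \<oplus> neg C u)"
      using ker W unfolding rep_kernel_def by blast
    then show "v = cls W K u"
      using v' u W K by (simp add: class_eq_iff)
  qed
qed

lemma is_cokernel_class:
  assumes X: "X \<in> adel_ob C" and Y: "Y \<in> adel_ob C" and phi: "\<phi> \<in> adel_reps C X Y"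
    and cok: "rep_cokernel C X Y \<phi> K k"
  shows "is_cokernel Adel (cls X Y \<phi>) (cls Y K k)"
  unfolding is_cokernel_def class_simps
proof (intro conjI ballI impI)
  have K: "K \<in> adel_ob C" "k \<in> adel_reps C Y K" "adel_null C X K (\<phi> \<odot> k)"
    using cok unfolding rep_cokernel_def by blast+
  show "cls Y K k \<in> Hom Adel Y K" using K Y by (intro class_in_Hom)
  show "cls X Y \<phi> \<odot>\<^bsub>Adel\<^esub> cls Y K k = Nul Adel X K"
    using K X Y phi by (simp add: class_Comp class_eq_Nul_iff reps_Comp[of X Y K])
  fix W t assume "W \<in> Obj Adel" "t \<in> Hom Adel Y W" and tn: "cls X Y \<phi> \<odot>\<^bsub>Adel\<^esub> t = Nul Adel X W"
  then obtain \<tau> where W: "W \<in> adel_ob C" and tau: "\<tau> \<in> adel_reps C Y W" "t = cls Y W \<tau>"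
    by (auto simp: Hom_adelman)
  have "adel_null C X W (\<phi> \<odot> \<tau>)"
    using tn W tau X Y phi by (simp add: class_Comp class_eq_Nul_iff reps_Comp[of X Y W])
  then obtain u where u: "u \<in> adel_reps C K W" "adel_null C Y W (k \<odot> u \<oplus> neg C \<tau>)"
    using cok W tau(1) unfolding rep_cokernel_def by blast
  have eq: "cls Y K k \<odot>\<^bsub>Adel\<^esub> cls K W u = t"
    using u K Y W tau by (simp add: class_Comp class_eq_iff reps_Comp[of Y K W])
  show "\<exists>!u. u \<in> Hom Adel K W \<and> cls Y K k \<odot>\<^bsub>Adel\<^esub> u = t"
  proof (intro ex1I conjI)
    show "cls K W u \<in> Hom Adel K W" using W K u by (intro class_in_Hom)
    show "cls Y K k \<odot>\<^bsub>Adel\<^esub> cls K W u = t" by (rule eq)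
    fix v assume v: "v \<in> Hom Adel K W \<and> cls Y K k \<odot>\<^bsub>Adel\<^esub> v = t"
    then obtain v' where v': "v' \<in> adel_reps C K W" "v = cls K W v'"
      by (auto simp: Hom_adelman)
    have "cls Y K k \<odot>\<^bsub>Adel\<^esub> cls K W v' = cls Y K k \<odot>\<^bsub>Adel\<^esub> cls K W u"
      using v v' eq by simp
    then have "adel_null C Y W (k \<odot> v' \<oplus> neg C (k \<odot> u))"
      using v' u K Y W by (simp add: class_Comp class_eq_iff reps_Comp[of Y K W])
    then have "adel_null C Y W (k \<odot> (v' \<oplus> neg C u))"
      using reps_typed[OF v'(1)] reps_typed[OF u(1)] reps_typed[OF K(2)]
      by (simp add: distribs Comp_neg)
    moreover have "v' \<oplus> neg C u \<in> adel_reps C K W"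
      using v' u W K by (intro reps_Add reps_neg)
    ultimately have "adel_null C K W (v' \<oplus> neg C u)"
      using cok W unfolding rep_cokernel_def by blast
    then show "v = cls K W u"
      using v' u W K by (simp add: class_eq_iff)
  qed
qed

lemma monic_class_iff:
  assumes X: "X \<in> adel_ob C" and Y: "Y \<in> adel_ob C" and phi: "\<phi> \<in> adel_reps C X Y"
  shows "monic Adel (cls X Y \<phi>) \<longleftrightarrow> rep_monic C X Y \<phi>"
proof -
  interpret Ad: preadditive_category Adel by (rule preadditive_adelman)
  have *: "cls Z X t \<odot>\<^bsub>Adel\<^esub> cls X Y \<phi> = Nul Adel Z Y \<longleftrightarrow> adel_null C Z Y (t \<odot> \<phi>)"
    "cls Z X t = Nul Adel Z X \<longleftrightarrow> adel_null C Z X t"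
    if "Z \<in> adel_ob C" "t \<in> adel_reps C Z X" for Z t
    using that X Y phi by (simp_all add: class_Comp class_eq_Nul_iff reps_Comp[of Z X Y])
  show ?thesis
  proof
    assume "monic Adel (cls X Y \<phi>)"
    then show "rep_monic C X Y \<phi>"
      unfolding Ad.monic_iff rep_monic_def using X * class_in_Arr class_simps by metis
  next
    assume r: "rep_monic C X Y \<phi>"
    show "monic Adel (cls X Y \<phi>)"
      unfolding Ad.monic_iff class_simps
    proof (intro conjI ballI impI)
      fix g assume "g \<in> Arr Adel" and gX: "Cod Adel g = X"
        and g0: "g \<odot>\<^bsub>Adel\<^esub> cls X Y \<phi> = Nul Adel (Dom Adel g) Y"
      then obtain Z t where t: "Z \<in> adel_ob C" "t \<in> adel_reps C Z X" "g = cls Z X t"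
        by (metis ArrE class_simps(2))
      then show "g = Nul Adel (Dom Adel g) X"
        using r g0 * unfolding rep_monic_def by simp
    qed (use assms in simp)
  qed
qed

lemma epic_class_iff:
  assumes X: "X \<in> adel_ob C" and Y: "Y \<in> adel_ob C" and phi: "\<phi> \<in> adel_reps C X Y"
  shows "epic Adel (cls X Y \<phi>) \<longleftrightarrow> rep_epic C X Y \<phi>"
proof -
  interpret Ad: preadditive_category Adel by (rule preadditive_adelman)
  have *: "cls X Y \<phi> \<odot>\<^bsub>Adel\<^esub> cls Y Z t = Nul Adel X Z \<longleftrightarrow> adel_null C X Z (\<phi> \<odot> t)"
    "cls Y Z t = Nul Adel Y Z \<longleftrightarrow> adel_null C Y Z t"
    if "Z \<in> adel_ob C" "t \<in> adel_reps C Y Z" for Z t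
    using that X Y phi by (simp_all add: class_Comp class_eq_Nul_iff reps_Comp[of X Y Z])
  show ?thesis
  proof
    assume "epic Adel (cls X Y \<phi>)"
    then show "rep_epic C X Y \<phi>"
      unfolding Ad.epic_iff rep_epic_def using Y * class_in_Arr class_simps by metis
  next
    assume r: "rep_epic C X Y \<phi>"
    show "epic Adel (cls X Y \<phi>)"
      unfolding Ad.epic_iff class_simps
    proof (intro conjI ballI impI)
      fix g assume "g \<in> Arr Adel" and gY: "Dom Adel g = Y"
        and g0: "cls X Y \<phi> \<odot>\<^bsub>Adel\<^esub> g = Nul Adel X (Cod Adel g)"
      then obtain Z t where t: "Z \<in> adel_ob C" "t \<in> adel_reps C Y Z" "g = cls Y Z t"
        by (metis ArrE class_simps(1))
      then show "g = Nul Adel Y (Cod Adel g)"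
        using r g0 * unfolding rep_epic_def by simp
    qed (use assms in simp)
  qed
qed

end

lemma (in preadditive_category) zero_object_Ident:
  assumes "zero_object C z"
  shows "z \<in> Obj C" "Ident C z = Nul C z z"
proof -
  show z: "z \<in> Obj C" using assms by (simp add: zero_object_def)
  then have "\<exists>!f. f \<in> Hom C z z" using assms by (auto simp: zero_object_def)
  then show "Ident C z = Nul C z z" using Ident_in[OF z] Nul_in[OF z z] by blast
qed

lemma (in additive_category) reps_biproduct:
  assumes X: "X \<in> adel_ob C" and Y: "Y \<in> adel_ob C"
  obtains S i j p q where "S \<in> adel_ob C" "i \<in> adel_reps C X S" "j \<in> adel_reps C Y S"
    "p \<in> adel_reps C S X" "q \<in> adel_reps C S Y"
    "i \<odot> p = Ident C (Cod C (fst X))" "j \<odot> q = Ident C (Cod C (fst Y))"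
    "i \<odot> q = Nul C (Cod C (fst X)) (Cod C (fst Y))" "j \<odot> p = Nul C (Cod C (fst Y)) (Cod C (fst X))"
    "(p \<odot> i) \<oplus> (q \<odot> j) = Ident C (Cod C (fst S))"
proof -
  from X obtain \<rho> \<gamma> where X' [simp]: "X = (\<rho>, \<gamma>)" "\<rho> \<in> Arr C" "\<gamma> \<in> Arr C" "Dom C \<gamma> = Cod C \<rho>"
    by (rule adel_obE)
  from Y obtain \<rho>' \<gamma>' where Y' [simp]: "Y = (\<rho>', \<gamma>')" "\<rho>' \<in> Arr C" "\<gamma>' \<in> Arr C" "Dom C \<gamma>' = Cod C \<rho>'"
    by (rule adel_obE)
  obtain R i1 j1 p1 q1 where B1: "is_biproduct C (Dom C \<rho>) (Dom C \<rho>') R i1 j1 p1 q1"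
    using is_biproduct_exists[of "Dom C \<rho>" "Dom C \<rho>'"] by auto
  obtain M i2 j2 p2 q2 where B2: "is_biproduct C (Cod C \<rho>) (Cod C \<rho>') M i2 j2 p2 q2"
    using is_biproduct_exists[of "Cod C \<rho>" "Cod C \<rho>'"] by auto
  obtain D i3 j3 p3 q3 where B3: "is_biproduct C (Cod C \<gamma>) (Cod C \<gamma>') D i3 j3 p3 q3"
    using is_biproduct_exists[of "Cod C \<gamma>" "Cod C \<gamma>'"] by auto
  note [simp] = is_biproduct_simps[OF B1] is_biproduct_simps[OF B2] is_biproduct_simps[OF B3]
  note Id2 = is_biproduct_Ident[OF B2]
  let ?S = "(p1 \<odot> (\<rho> \<odot> i2) \<oplus> q1 \<odot> (\<rho>' \<odot> j2), p2 \<odot> (\<gamma> \<odot> i3) \<oplus> q2 \<odot> (\<gamma>' \<odot> j3))"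
  show thesis
  proof (rule that[of ?S i2 j2 p2 q2])
    show "?S \<in> adel_ob C" by (simp add: adel_ob_def)
    show "i2 \<in> adel_reps C X ?S"
      unfolding X' in_reps_iff
      by (intro conjI bexI[of _ i1] bexI[of _ i3]) (simp_all add: distribs)
    show "j2 \<in> adel_reps C Y ?S"
      unfolding Y' in_reps_iff
      by (intro conjI bexI[of _ j1] bexI[of _ j3]) (simp_all add: distribs)
    show "p2 \<in> adel_reps C ?S X"
      unfolding X' in_reps_iff
      by (intro conjI bexI[of _ p1] bexI[of _ p3]) (simp_all add: distribs)
    show "q2 \<in> adel_reps C ?S Y"
      unfolding Y' in_reps_iff
      by (intro conjI bexI[of _ q1] bexI[of _ q3]) (simp_all add: distribs)
  qed (simp_all add: Id2)
qed

theorem (in additive_category) abelian_adelman: "abelian_category Adel"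
proof -
  interpret Ad: preadditive_category Adel by (rule preadditive_adelman)
  show ?thesis
  proof
    obtain z where "zero_object C z" using zero_exists by blast
    note z [simp] = zero_object_Ident[OF this]
    let ?Z = "(Nul C z z, Nul C z z)"
    have Z: "?Z \<in> adel_ob C" by (simp add: adel_ob_def)
    then have "zero_object Adel ?Z"
      by (intro Ad.zero_objectI) (simp_all add: adelman_Ident adelman_Nul)
    then show "\<exists>z. zero_object Adel z" by blast
  next
    fix X Y assume "X \<in> Obj Adel" "Y \<in> Obj Adel"
    then have X: "X \<in> adel_ob C" and Y: "Y \<in> adel_ob C" by simp_all
    from reps_biproduct[OF X Y] obtain S i j p q where S: "S \<in> adel_ob C"
      and r: "i \<in> adel_reps C X S" "j \<in> adel_reps C Y S" "p \<in> adel_reps C S X" "q \<in> adel_reps C S Y"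
      and e: "i \<odot> p = Ident C (Cod C (fst X))" "j \<odot> q = Ident C (Cod C (fst Y))"
        "i \<odot> q = Nul C (Cod C (fst X)) (Cod C (fst Y))" "j \<odot> p = Nul C (Cod C (fst Y)) (Cod C (fst X))"
        "(p \<odot> i) \<oplus> (q \<odot> j) = Ident C (Cod C (fst S))"
      by metis
    show "\<exists>s i j p q. i \<in> Hom Adel X s \<and> j \<in> Hom Adel Y s \<and> p \<in> Hom Adel s X \<and> q \<in> Hom Adel s Y \<and>
            i \<odot>\<^bsub>Adel\<^esub> p = Ident Adel X \<and> j \<odot>\<^bsub>Adel\<^esub> q = Ident Adel Y \<and>
            i \<odot>\<^bsub>Adel\<^esub> q = Nul Adel X Y \<and> j \<odot>\<^bsub>Adel\<^esub> p = Nul Adel Y X \<and>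
            (p \<odot>\<^bsub>Adel\<^esub> i) \<oplus>\<^bsub>Adel\<^esub> (q \<odot>\<^bsub>Adel\<^esub> j) = Ident Adel s"
      by (rule exI[of _ S], rule exI[of _ "cls X S i"], rule exI[of _ "cls Y S j"],
          rule exI[of _ "cls S X p"], rule exI[of _ "cls S Y q"])
        (use X Y S r reps_Comp[OF S X S r(3,1)] reps_Comp[OF S Y S r(4,2)] in
          \<open>simp add: class_in_Hom class_Comp class_Add e adelman_Ident adelman_Nul\<close>)
  next
    fix f assume "f \<in> Arr Adel"
    then obtain X Y \<phi> where f: "X \<in> adel_ob C" "Y \<in> adel_ob C" "\<phi> \<in> adel_reps C X Y" "f = cls X Y \<phi>"
      by (rule ArrE)
    obtain K k where "rep_kernel C X Y \<phi> K k"
      by (rule rep_kernel_exists[OF f(1-3)])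
    then show "\<exists>k. is_kernel Adel f k" using is_kernel_class[OF f(1-3)] f(4) by blast
    obtain K k where "rep_cokernel C X Y \<phi> K k"
      by (rule rep_cokernel_exists[OF f(1-3)])
    then show "\<exists>c. is_cokernel Adel f c" using is_cokernel_class[OF f(1-3)] f(4) by blast
  next
    fix f assume m: "monic Adel f"
    then have "f \<in> Arr Adel" by (simp add: monic_def)
    then obtain X Y \<phi> where f: "X \<in> adel_ob C" "Y \<in> adel_ob C" "\<phi> \<in> adel_reps C X Y" "f = cls X Y \<phi>"
      by (rule ArrE)
    obtain K \<pi> where "K \<in> adel_ob C" "\<pi> \<in> adel_reps C Y K" "rep_kernel C Y K \<pi> X \<phi>"
      using rep_monic_is_kernel[OF f(1-3)] m f(4) monic_class_iff[OF f(1-3)] by blast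
    then show "\<exists>g \<in> Arr Adel. is_kernel Adel g f"
      using f is_kernel_class by (intro bexI[of _ "cls Y K \<pi>"]) simp_all
  next
    fix f assume m: "epic Adel f"
    then have "f \<in> Arr Adel" by (simp add: epic_def)
    then obtain X Y \<phi> where f: "X \<in> adel_ob C" "Y \<in> adel_ob C" "\<phi> \<in> adel_reps C X Y" "f = cls X Y \<phi>"
      by (rule ArrE)
    obtain K k where "K \<in> adel_ob C" "k \<in> adel_reps C K X" "rep_cokernel C K X k Y \<phi>"
      using rep_epic_is_cokernel[OF f(1-3)] m f(4) epic_class_iff[OF f(1-3)] by blast
    then show "\<exists>g \<in> Arr Adel. is_cokernel Adel g f"
      using f is_cokernel_class by (intro bexI[of _ "cls K X k"]) simp_all
  qed
qed


section \<open>Generalised elements in abelian categories\<close>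

context preadditive_category
begin

lemma epic_in_Arr: "epic C f \<Longrightarrow> f \<in> Arr C"
  by (simp add: epic_def)

lemma monic_in_Arr: "monic C f \<Longrightarrow> f \<in> Arr C"
  by (simp add: monic_def)

lemma epic_cancel:
  "epic C e \<Longrightarrow> g \<in> Arr C \<Longrightarrow> Dom C g = Cod C e \<Longrightarrow> e \<odot> g = Nul C (Dom C e) (Cod C g) \<Longrightarrow>
     g = Nul C (Cod C e) (Cod C g)"
  by (simp add: epic_iff)

lemma monic_cancel:
  "monic C m \<Longrightarrow> g \<in> Arr C \<Longrightarrow> Cod C g = Dom C m \<Longrightarrow> g \<odot> m = Nul C (Dom C g) (Cod C m) \<Longrightarrow>
     g = Nul C (Dom C g) (Dom C m)"
  by (simp add: monic_iff)

lemma epic_Comp: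
  assumes "epic C e" "epic C f" "Cod C e = Dom C f"
  shows "epic C (e \<odot> f)"
proof -
  note [simp] = epic_in_Arr[OF assms(1)] epic_in_Arr[OF assms(2)] assms(3)
  show ?thesis
    unfolding epic_iff
  proof (intro conjI ballI impI)
    fix g assume g: "g \<in> Arr C" "Dom C g = Cod C (e \<odot> f)"
      and 0: "(e \<odot> f) \<odot> g = Nul C (Dom C (e \<odot> f)) (Cod C g)"
    then have "f \<odot> g = Nul C (Dom C f) (Cod C g)"
      using epic_cancel[OF assms(1), of "f \<odot> g"] by simp
    then show "g = Nul C (Cod C (e \<odot> f)) (Cod C g)"
      using epic_cancel[OF assms(2)] g by simp
  qed simp
qed

lemma epic_right_factor:
  assumes "epic C (e \<odot> f)" "e \<in> Arr C" "f \<in> Arr C" "Cod C e = Dom C f"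
  shows "epic C f"
  unfolding epic_iff
proof (intro conjI ballI impI)
  fix g assume g: "g \<in> Arr C" "Dom C g = Cod C f" "f \<odot> g = Nul C (Dom C f) (Cod C g)"
  then show "g = Nul C (Cod C f) (Cod C g)"
    using epic_cancel[OF assms(1), of g] assms(2-) by simp
qed fact

lemma monic_left_factor:
  assumes "monic C (f \<odot> m)" "f \<in> Arr C" "m \<in> Arr C" "Cod C f = Dom C m"
  shows "monic C f"
  unfolding monic_iff
proof (intro conjI ballI impI)
  fix g assume g: "g \<in> Arr C" "Cod C g = Dom C f" "g \<odot> f = Nul C (Dom C g) (Cod C f)"
  then have "g \<odot> (f \<odot> m) = Nul C (Dom C g) (Cod C m)"
    using assms(2-) by (simp flip: assoc)
  then show "g = Nul C (Dom C g) (Dom C f)"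
    using monic_cancel[OF assms(1), of g] g assms(2-) by simp
qed fact

lemma Ident_monic: "x \<in> Obj C \<Longrightarrow> monic C (Ident C x)"
  by (simp add: monic_iff)

end

sublocale abelian_category \<subseteq> additive_category C
  by unfold_locales (rule zero_object_exists, unfold is_biproduct_def, rule biproduct_exists)

context abelian_category
begin

lemma ker_is_kernel: "f \<in> Arr C \<Longrightarrow> is_kernel C f (ker C f)"
  unfolding ker_def using kernel_exists by (rule someI_ex)

lemma coker_is_cokernel: "f \<in> Arr C \<Longrightarrow> is_cokernel C f (coker C f)"
  unfolding coker_def using cokernel_exists by (rule someI_ex)

lemma ker_simps [simp]:
  assumes "f \<in> Arr C"
  shows "ker C f \<in> Arr C" "Dom C (ker C f) = Ker C f" "Cod C (ker C f) = Dom C f"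
    "ker C f \<odot> f = Nul C (Ker C f) (Cod C f)" "Ker C f \<in> Obj C"
  using ker_is_kernel[OF assms] by (auto simp: is_kernel_def in_Hom Ker_def)

lemma coker_simps [simp]:
  assumes "f \<in> Arr C"
  shows "coker C f \<in> Arr C" "Cod C (coker C f) = Coker C f" "Dom C (coker C f) = Cod C f"
    "f \<odot> coker C f = Nul C (Dom C f) (Coker C f)" "Coker C f \<in> Obj C"
  using coker_is_cokernel[OF assms] by (auto simp: is_cokernel_def in_Hom Coker_def)

lemma ker_lift:
  assumes "f \<in> Arr C" "t \<in> Arr C" "Cod C t = Dom C f" "t \<odot> f = Nul C (Dom C t) (Cod C f)"
  obtains u where "u \<in> Arr C" "Dom C u = Dom C t" "Cod C u = Ker C f" "u \<odot> ker C f = t"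
proof -
  have "t \<in> Hom C (Dom C t) (Dom C f)" "Dom C t \<in> Obj C" using assms by (auto simp: in_Hom)
  then have "\<exists>!u. u \<in> Hom C (Dom C t) (Dom C (ker C f)) \<and> u \<odot> ker C f = t"
    using ker_is_kernel[OF assms(1)] assms(4) unfolding is_kernel_def by blast
  then show thesis using that assms(1) by (auto simp: in_Hom)
qed

lemma coker_lift:
  assumes "f \<in> Arr C" "t \<in> Arr C" "Dom C t = Cod C f" "f \<odot> t = Nul C (Dom C f) (Cod C t)"
  obtains u where "u \<in> Arr C" "Dom C u = Coker C f" "Cod C u = Cod C t" "coker C f \<odot> u = t"
proof -
  have "t \<in> Hom C (Cod C f) (Cod C t)" "Cod C t \<in> Obj C" using assms by (auto simp: in_Hom)
  then have "\<exists>!u. u \<in> Hom C (Cod C (coker C f)) (Cod C t) \<and> coker C f \<odot> u = t"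
    using coker_is_cokernel[OF assms(1)] assms(4) unfolding is_cokernel_def by blast
  then show thesis using that assms(1) by (auto simp: in_Hom)
qed

lemma is_kernel_monic:
  assumes "is_kernel C f k" "f \<in> Arr C"
  shows "monic C k"
  unfolding monic_iff
proof (intro conjI ballI impI)
  have k: "k \<in> Arr C" "Cod C k = Dom C f" "k \<odot> f = Nul C (Dom C k) (Cod C f)"
    using assms by (auto simp: is_kernel_def in_Hom)
  show "k \<in> Arr C" by fact
  fix g assume g: "g \<in> Arr C" "Cod C g = Dom C k" "g \<odot> k = Nul C (Dom C g) (Cod C k)"
  let ?nul = "Nul C (Dom C g) (Dom C f)"
  have "?nul \<in> Hom C (Dom C g) (Dom C f)" "?nul \<odot> f = Nul C (Dom C g) (Cod C f)" "Dom C g \<in> Obj C"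
    using assms(2) g(1) by (auto simp: in_Hom)
  then have "\<exists>!u. u \<in> Hom C (Dom C g) (Dom C k) \<and> u \<odot> k = ?nul"
    using assms(1) unfolding is_kernel_def by blast
  moreover have "g \<in> Hom C (Dom C g) (Dom C k) \<and> g \<odot> k = ?nul"
    "Nul C (Dom C g) (Dom C k) \<in> Hom C (Dom C g) (Dom C k) \<and> Nul C (Dom C g) (Dom C k) \<odot> k = ?nul"
    using g k by (auto simp: in_Hom)
  ultimately show "g = Nul C (Dom C g) (Dom C k)" by blast
qed

lemma monic_ker [simp]: "f \<in> Arr C \<Longrightarrow> monic C (ker C f)"
  using is_kernel_monic ker_is_kernel by blast

lemma abelian_opposite: "abelian_category (opposite C)"
proof -
  interpret op: additive_category "opposite C" by (rule additive_opposite)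
  show ?thesis
  proof
    fix x y assume "x \<in> Obj (opposite C)" "y \<in> Obj (opposite C)"
    from op.is_biproduct_exists[OF this]
    show "\<exists>s i j p q. i \<in> Hom (opposite C) x s \<and> j \<in> Hom (opposite C) y s \<and>
            p \<in> Hom (opposite C) s x \<and> q \<in> Hom (opposite C) s y \<and>
            i \<odot>\<^bsub>opposite C\<^esub> p = Ident (opposite C) x \<and> j \<odot>\<^bsub>opposite C\<^esub> q = Ident (opposite C) y \<and>
            i \<odot>\<^bsub>opposite C\<^esub> q = Nul (opposite C) x y \<and> j \<odot>\<^bsub>opposite C\<^esub> p = Nul (opposite C) y x \<and>
            (p \<odot>\<^bsub>opposite C\<^esub> i) \<oplus>\<^bsub>opposite C\<^esub> (q \<odot>\<^bsub>opposite C\<^esub> j) = Ident (opposite C) s"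
      unfolding is_biproduct_def .
  qed (use op.zero_exists kernel_exists cokernel_exists monic_is_kernel epic_is_cokernel in auto)
qed

lemma epic_coker [simp]: "f \<in> Arr C \<Longrightarrow> epic C (coker C f)"
  using abelian_category.is_kernel_monic[OF abelian_opposite, of f "coker C f"] coker_is_cokernel
  by simp

lemma epic_lift:
  assumes "epic C f" "t \<in> Arr C" "Dom C t = Dom C f" "ker C f \<odot> t = Nul C (Ker C f) (Cod C t)"
  obtains u where "u \<in> Arr C" "Dom C u = Cod C f" "Cod C u = Cod C t" "f \<odot> u = t"
proof -
  have f: "f \<in> Arr C" using assms(1) by (rule epic_in_Arr)
  obtain g where g: "g \<in> Arr C" and cok: "is_cokernel C g f"
    using epic_is_cokernel[OF assms(1)] by blast
  have gf: "Cod C g = Dom C f" "g \<odot> f = Nul C (Dom C g) (Cod C f)"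
    using cok by (auto simp: is_cokernel_def in_Hom)
  obtain g' where g': "g' \<in> Arr C" "Dom C g' = Dom C g" "Cod C g' = Ker C f" "g' \<odot> ker C f = g"
    using ker_lift[OF f g gf] .
  have "(g' \<odot> ker C f) \<odot> t = g' \<odot> (ker C f \<odot> t)"
    using g'(1-3) f assms(2,3) by simp
  then have "g \<odot> t = Nul C (Dom C g) (Cod C t)"
    unfolding g'(4) assms(4) using g'(1-3) f assms(2) by simp
  moreover have "t \<in> Hom C (Cod C g) (Cod C t)" "Cod C t \<in> Obj C"
    using assms gf by (auto simp: in_Hom)
  ultimately have "\<exists>!u. u \<in> Hom C (Cod C f) (Cod C t) \<and> f \<odot> u = t"
    using cok unfolding is_cokernel_def by blast
  then show thesis using that by (auto simp: in_Hom)
qed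

text \<open>
  Epimorphisms are stable under pullback. With \<open>d\<close> the difference of the two arrows on the
  biproduct, the pullback is \<open>Ker d\<close>. If \<open>g\<close> is killed by the projection of \<open>Ker d\<close> to \<open>Dom y\<close>, then
  \<open>q \<odot> g\<close> factors over \<open>d\<close>, because \<open>d\<close> is an epimorphism; restricting to the summand \<open>Dom f\<close> shows that
  the factor is zero.
\<close>

lemma local_lift:
  assumes "epic C f" "y \<in> Arr C" "Cod C y = Cod C f"
  obtains e x where "epic C e" "e \<in> Arr C" "x \<in> Arr C" "Cod C e = Dom C y" "Dom C x = Dom C e"
    "Cod C x = Dom C f" "e \<odot> y = x \<odot> f"
proof -
  have f [simp]: "f \<in> Arr C" using assms(1) by (rule epic_in_Arr)
  note y [simp] = assms(2,3)
  obtain s i j p q where "is_biproduct C (Dom C f) (Dom C y) s i j p q"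
    using is_biproduct_exists[of "Dom C f" "Dom C y"] by auto
  note [simp] = is_biproduct_simps[OF this]
  define d where "d = p \<odot> f \<oplus> neg C (q \<odot> y)"
  have d [simp]: "d \<in> Arr C" "Dom C d = s" "Cod C d = Cod C f"
    by (simp_all add: d_def)
  have id: "i \<odot> d = f"
    by (simp add: d_def distribs Comp_neg)
  have "epic C d"
    using assms(1) id by (intro epic_right_factor[of i d]) simp_all
  have "epic C (ker C d \<odot> q)"
    unfolding epic_iff
  proof (intro conjI ballI impI)
    fix g assume g: "g \<in> Arr C" "Dom C g = Cod C (ker C d \<odot> q)"
      and 0: "(ker C d \<odot> q) \<odot> g = Nul C (Dom C (ker C d \<odot> q)) (Cod C g)"
    have g' [simp]: "Dom C g = Dom C y" "g \<in> Arr C" using g by simp_all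
    have "ker C d \<odot> (q \<odot> g) = Nul C (Ker C d) (Cod C (q \<odot> g))"
      using 0 by simp
    then obtain v where v [simp]: "v \<in> Arr C" "Dom C v = Cod C f" "Cod C v = Cod C g"
      and dv: "d \<odot> v = q \<odot> g"
      using epic_lift[OF \<open>epic C d\<close>, of "q \<odot> g"] by auto
    have "f \<odot> v = i \<odot> (d \<odot> v)"
      using id by (simp flip: assoc)
    also have "\<dots> = Nul C (Dom C f) (Cod C v)"
      unfolding dv by simp
    finally have "v = Nul C (Cod C f) (Cod C g)"
      using epic_cancel[OF assms(1), of v] by simp
    then have "q \<odot> g = Nul C s (Cod C g)"
      using dv[symmetric] by simp
    then have "j \<odot> (q \<odot> g) = Nul C (Dom C y) (Cod C g)" by simp
    then show "g = Nul C (Cod C (ker C d \<odot> q)) (Cod C g)"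
      by simp
  qed simp
  moreover have "(ker C d \<odot> q) \<odot> y = (ker C d \<odot> p) \<odot> f"
  proof -
    have "ker C d \<odot> d = Nul C (Ker C d) (Cod C f)" by simp
    then have "ker C d \<odot> (p \<odot> f) \<oplus> neg C (ker C d \<odot> (q \<odot> y)) = Nul C (Ker C d) (Cod C f)"
      unfolding d_def[symmetric] by (simp add: d_def distribs Comp_neg)
    then show ?thesis
      using diff_eq_Nul_iff[of "ker C d \<odot> (p \<odot> f)" "ker C d \<odot> (q \<odot> y)"] by simp
  qed
  ultimately show thesis
    by (intro that[of "ker C d \<odot> q" "ker C d \<odot> p"]) simp_all
qed

lemma img_simps [simp]:
  assumes "f \<in> Arr C"
  shows "img C f \<in> Arr C" "Dom C (img C f) = Img C f" "Cod C (img C f) = Cod C f"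
    "monic C (img C f)" "Img C f \<in> Obj C" "img C f \<odot> coker C f = Nul C (Img C f) (Coker C f)"
  using assms by (simp_all add: img_def Img_def)

lemma img_lift:
  assumes "f \<in> Arr C" "t \<in> Arr C" "Cod C t = Cod C f" "t \<odot> coker C f = Nul C (Dom C t) (Coker C f)"
  obtains u where "u \<in> Arr C" "Dom C u = Dom C t" "Cod C u = Img C f" "u \<odot> img C f = t"
  using ker_lift[of "coker C f" t] assms by (auto simp: img_def Img_def)

text \<open>
  If \<open>e \<odot> g = 0\<close>, then \<open>f\<close> factors over the monomorphism from \<open>Ker g\<close> into \<open>Cod f\<close>. That monomorphism is
  a kernel of some \<open>h\<close>, and \<open>h\<close> factors over \<open>coker f\<close>; so the image already factors over \<open>Ker g\<close>,
  which forces \<open>g = 0\<close>.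
\<close>

lemma img_factorisation:
  assumes f [simp]: "f \<in> Arr C"
  obtains e where "e \<in> Arr C" "epic C e" "Dom C e = Dom C f" "Cod C e = Img C f" "e \<odot> img C f = f"
proof -
  obtain e where e [simp]: "e \<in> Arr C" "Dom C e = Dom C f" "Cod C e = Img C f"
    and ef: "e \<odot> img C f = f"
    by (rule img_lift[of f f]) simp_all
  have "epic C e"
    unfolding epic_iff
  proof (intro conjI ballI impI)
    fix g assume g: "g \<in> Arr C" "Dom C g = Cod C e" "e \<odot> g = Nul C (Dom C e) (Cod C g)"
    have g' [simp]: "g \<in> Arr C" "Dom C g = Img C f" using g by simp_all
    obtain e' where e' [simp]: "e' \<in> Arr C" "Dom C e' = Dom C f" "Cod C e' = Ker C g"
      and e'': "e' \<odot> ker C g = e"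
      using ker_lift[of g e] g by auto
    let ?k = "ker C g \<odot> img C f"
    have "monic C ?k"
      unfolding monic_iff
    proof (intro conjI ballI impI)
      fix h assume h: "h \<in> Arr C" "Cod C h = Dom C ?k" "h \<odot> ?k = Nul C (Dom C h) (Cod C ?k)"
      then have "h \<odot> ker C g = Nul C (Dom C h) (Img C f)"
        using monic_cancel[of "img C f" "h \<odot> ker C g"] by simp
      then show "h = Nul C (Dom C h) (Dom C ?k)"
        using monic_cancel[of "ker C g" h] h by simp
    qed simp
    then obtain h where h: "h \<in> Arr C" "is_kernel C h ?k"
      using monic_is_kernel by blast
    then have h' [simp]: "Dom C h = Cod C f" and kh: "?k \<odot> h = Nul C (Ker C g) (Cod C h)"
      by (auto simp: is_kernel_def in_Hom)
    have "f \<odot> h = e' \<odot> (?k \<odot> h)"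
    proof -
      have "f \<odot> h = (e \<odot> img C f) \<odot> h" by (simp add: ef)
      also have "\<dots> = ((e' \<odot> ker C g) \<odot> img C f) \<odot> h" by (simp add: e'')
      finally show ?thesis using h by simp
    qed
    also have "\<dots> = Nul C (Dom C f) (Cod C h)"
      unfolding kh using h by simp
    finally obtain h1 where h1: "h1 \<in> Arr C" "Dom C h1 = Coker C f" "Cod C h1 = Cod C h" "coker C f \<odot> h1 = h"
      using coker_lift[of f h] h by auto
    have "img C f \<odot> h = (img C f \<odot> coker C f) \<odot> h1"
      using h1 by (simp del: img_simps(6))
    also have "\<dots> = Nul C (Img C f) (Cod C h)"
      using h1 by simp
    finally have "\<exists>!m. m \<in> Hom C (Img C f) (Dom C ?k) \<and> m \<odot> ?k = img C f"
      using h unfolding is_kernel_def by (auto simp: in_Hom)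
    then obtain m where m: "m \<in> Arr C" "Dom C m = Img C f" "Cod C m = Ker C g" "m \<odot> ?k = img C f"
      by (auto simp: in_Hom)
    have "m \<odot> ker C g = Ident C (Img C f)"
      by (rule monicD[of "img C f"]) (use m in simp_all)
    then have "g = (m \<odot> ker C g) \<odot> g" by simp
    also have "\<dots> = Nul C (Img C f) (Cod C g)" using m by simp
    finally show "g = Nul C (Cod C e) (Cod C g)" by simp
  qed simp
  then show thesis using ef by (intro that[of e]) simp_all
qed

text \<open>
  Exactness in terms of generalised elements: the factor of \<open>y\<close> over the image is lifted along the
  epimorphism onto the image.
\<close>

lemma local_preimage:
  assumes "f \<in> Arr C" "y \<in> Arr C" "Cod C y = Cod C f" "y \<odot> coker C f = Nul C (Dom C y) (Coker C f)"
  obtains e x where "epic C e" "e \<in> Arr C" "x \<in> Arr C" "Cod C e = Dom C y" "Dom C x = Dom C e"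
    "Cod C x = Dom C f" "e \<odot> y = x \<odot> f"
proof -
  obtain u where u: "u \<in> Arr C" "Dom C u = Dom C y" "Cod C u = Img C f" "u \<odot> img C f = y"
    using img_lift[OF assms] .
  obtain e0 where e0: "e0 \<in> Arr C" "epic C e0" "Dom C e0 = Dom C f" "Cod C e0 = Img C f" "e0 \<odot> img C f = f"
    using img_factorisation[OF assms(1)] .
  obtain e x where ex: "epic C e" "e \<in> Arr C" "x \<in> Arr C" "Cod C e = Dom C u" "Dom C x = Dom C e"
    "Cod C x = Dom C e0" "e \<odot> u = x \<odot> e0"
    using local_lift[OF e0(2) u(1)] u e0 by auto
  have "(e \<odot> u) \<odot> img C f = (x \<odot> e0) \<odot> img C f"
    by (simp only: ex(7))
  then have "e \<odot> (u \<odot> img C f) = x \<odot> (e0 \<odot> img C f)"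
    using ex(1-6) u(1-3) e0(1-4) assms(1) by simp
  then have "e \<odot> y = x \<odot> f"
    unfolding u(4) e0(5) .
  then show thesis
    using that[of e x] ex u(2) e0(3) by simp
qed

text \<open>
  A relation between \<open>Cod s\<close> and \<open>Cod t\<close> given by a common cover is a monomorphism as soon as the same
  elements vanish on both sides. This replaces the definition of a map by choosing preimages.
\<close>

lemma monic_of_common_cover:
  assumes s: "epic C s" and t: "t \<in> Arr C" "Dom C t = Dom C s"
    and iff: "\<And>p. p \<in> Arr C \<Longrightarrow> Cod C p = Dom C s \<Longrightarrow>
      p \<odot> s = Nul C (Dom C p) (Cod C s) \<longleftrightarrow> p \<odot> t = Nul C (Dom C p) (Cod C t)"
  obtains m where "m \<in> Hom C (Cod C s) (Cod C t)" "monic C m" "s \<odot> m = t"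
proof -
  have s' [simp]: "s \<in> Arr C" using s by (rule epic_in_Arr)
  note [simp] = t
  obtain m where m [simp]: "m \<in> Arr C" "Dom C m = Cod C s" "Cod C m = Cod C t" and sm: "s \<odot> m = t"
    using epic_lift[OF s t] iff[of "ker C s"] by auto
  have "monic C m"
    unfolding monic_iff
  proof (intro conjI ballI impI)
    fix y assume y: "y \<in> Arr C" "Cod C y = Dom C m" "y \<odot> m = Nul C (Dom C y) (Cod C m)"
    obtain e p where ep: "epic C e" "e \<in> Arr C" "p \<in> Arr C" "Cod C e = Dom C y" "Dom C p = Dom C e"
      "Cod C p = Dom C s" "e \<odot> y = p \<odot> s"
      using local_lift[OF s y(1)] y by auto
    have "p \<odot> t = (p \<odot> s) \<odot> m" using ep by (simp add: sm)
    also have "\<dots> = (e \<odot> y) \<odot> m" by (simp only: ep(7))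
    also have "\<dots> = Nul C (Dom C p) (Cod C t)" using ep(1-6) y by simp
    finally have "e \<odot> y = Nul C (Dom C e) (Cod C y)" using iff[of p] ep y by simp
    then show "y = Nul C (Dom C y) (Dom C m)"
      using epic_cancel[OF ep(1) y(1)] ep y by simp
  qed simp
  then show thesis using sm by (intro that[of m]) (auto simp: in_Hom)
qed

section \<open>Induced maps on kernels, cokernels and homology\<close>

lemma ker_map_simps:
  assumes "f \<in> Arr C" "g \<in> Arr C" "v \<in> Arr C" "Dom C v = Dom C f" "Cod C v = Dom C g"
    "ker C f \<odot> (v \<odot> g) = Nul C (Ker C f) (Cod C g)"
  shows "ker_map C f g v \<in> Arr C" "Dom C (ker_map C f g v) = Ker C f"
    "Cod C (ker_map C f g v) = Ker C g" "ker_map C f g v \<odot> ker C g = ker C f \<odot> v"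
proof -
  obtain u where u: "u \<in> Arr C" "Dom C u = Ker C f" "Cod C u = Ker C g" "u \<odot> ker C g = ker C f \<odot> v"
    using ker_lift[of g "ker C f \<odot> v"] assms by auto
  have "ker_map C f g v \<in> Hom C (Ker C f) (Ker C g) \<and> ker_map C f g v \<odot> ker C g = ker C f \<odot> v"
    unfolding ker_map_def
  proof (rule theI2)
    show "u \<in> Hom C (Ker C f) (Ker C g) \<and> u \<odot> ker C g = ker C f \<odot> v" using u by (simp add: in_Hom)
    fix u' assume *: "u' \<in> Hom C (Ker C f) (Ker C g) \<and> u' \<odot> ker C g = ker C f \<odot> v"
    show "u' = u" by (rule monicD[of "ker C g"]) (use * u assms in \<open>auto simp: in_Hom\<close>)
  qed
  then show "ker_map C f g v \<in> Arr C" "Dom C (ker_map C f g v) = Ker C f"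
    "Cod C (ker_map C f g v) = Ker C g" "ker_map C f g v \<odot> ker C g = ker C f \<odot> v"
    by (auto simp: in_Hom)
qed

lemma coker_map_simps:
  assumes "f \<in> Arr C" "g \<in> Arr C" "v \<in> Arr C" "Dom C v = Cod C f" "Cod C v = Cod C g"
    "f \<odot> (v \<odot> coker C g) = Nul C (Dom C f) (Coker C g)"
  shows "coker_map C f g v \<in> Arr C" "Dom C (coker_map C f g v) = Coker C f"
    "Cod C (coker_map C f g v) = Coker C g" "coker C f \<odot> coker_map C f g v = v \<odot> coker C g"
proof -
  obtain u where u: "u \<in> Arr C" "Dom C u = Coker C f" "Cod C u = Coker C g" "coker C f \<odot> u = v \<odot> coker C g"
    using coker_lift[of f "v \<odot> coker C g"] assms by auto
  have "coker_map C f g v \<in> Hom C (Coker C f) (Coker C g) \<and> coker C f \<odot> coker_map C f g v = v \<odot> coker C g"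
    unfolding coker_map_def
  proof (rule theI2)
    show "u \<in> Hom C (Coker C f) (Coker C g) \<and> coker C f \<odot> u = v \<odot> coker C g" using u by (simp add: in_Hom)
    fix u' assume *: "u' \<in> Hom C (Coker C f) (Coker C g) \<and> coker C f \<odot> u' = v \<odot> coker C g"
    show "u' = u" by (rule epicD[of "coker C f"]) (use * u assms in \<open>auto simp: in_Hom\<close>)
  qed
  then show "coker_map C f g v \<in> Arr C" "Dom C (coker_map C f g v) = Coker C f"
    "Cod C (coker_map C f g v) = Coker C g" "coker C f \<odot> coker_map C f g v = v \<odot> coker C g"
    by (auto simp: in_Hom)
qed

lemma ker_incl_simps:
  assumes "f \<in> Arr C" "g \<in> Arr C" "Dom C f = Dom C g" "ker C f \<odot> g = Nul C (Ker C f) (Cod C g)"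
  shows "ker_incl C f g \<in> Arr C" "Dom C (ker_incl C f g) = Ker C f"
    "Cod C (ker_incl C f g) = Ker C g" "ker_incl C f g \<odot> ker C g = ker C f"
proof -
  have "ker_incl C f g = ker_map C f g (Ident C (Dom C f))"
    using assms by (simp add: ker_incl_def ker_map_def)
  moreover note ker_map_simps[of f g "Ident C (Dom C f)"]
  ultimately show "ker_incl C f g \<in> Arr C" "Dom C (ker_incl C f g) = Ker C f"
    "Cod C (ker_incl C f g) = Ker C g" "ker_incl C f g \<odot> ker C g = ker C f"
    using assms by simp_all
qed

lemma homology_arrow_simps [simp]:
  assumes "f \<in> Arr C" "g \<in> Arr C" "Cod C f = Dom C g"
  shows "homology_arrow C f g \<in> Arr C" "Dom C (homology_arrow C f g) = Ker C g"
    "Cod C (homology_arrow C f g) = Coker C f"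
  using assms by (simp_all add: homology_arrow_def)

lemma Img_homology_arrow [simp]: "Img C (homology_arrow C f g) = homology C f g"
  by (simp add: homology_def)

lemma homology_in_Obj [simp]:
  "f \<in> Arr C \<Longrightarrow> g \<in> Arr C \<Longrightarrow> Cod C f = Dom C g \<Longrightarrow> homology C f g \<in> Obj C"
  using img_simps(5)[of "homology_arrow C f g"] by simp

abbreviation himg where
  "himg f g \<equiv> img C (homology_arrow C f g)"

lemma homology_proj_simps:
  assumes "f \<in> Arr C" "g \<in> Arr C" "Cod C f = Dom C g"
  shows "homology_proj C f g \<in> Arr C" "Dom C (homology_proj C f g) = Ker C g"
    "Cod C (homology_proj C f g) = homology C f g"
    "homology_proj C f g \<odot> himg f g = ker C g \<odot> coker C f" "epic C (homology_proj C f g)"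
proof -
  note [simp] = assms
  obtain e where e: "e \<in> Arr C" "epic C e" "Dom C e = Ker C g" "Cod C e = homology C f g"
      "e \<odot> himg f g = homology_arrow C f g"
    using img_factorisation[of "homology_arrow C f g"] by auto
  have "homology_proj C f g = e"
    unfolding homology_proj_def
  proof (rule the_equality)
    show "e \<in> Hom C (Ker C g) (homology C f g) \<and> e \<odot> himg f g = homology_arrow C f g"
      using e by (simp add: in_Hom)
    fix e' assume *: "e' \<in> Hom C (Ker C g) (homology C f g) \<and> e' \<odot> himg f g = homology_arrow C f g"
    show "e' = e" by (rule monicD[of "himg f g"]) (use * e in \<open>auto simp: in_Hom\<close>)
  qed
  then show "homology_proj C f g \<in> Arr C" "Dom C (homology_proj C f g) = Ker C g"
    "Cod C (homology_proj C f g) = homology C f g"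
    "homology_proj C f g \<odot> himg f g = ker C g \<odot> coker C f" "epic C (homology_proj C f g)"
    using e by (simp_all add: homology_arrow_def)
qed

text \<open>
  The map on homology exists because the composite \<open>ker g \<rightarrow> coker f \<rightarrow> coker f'\<close> factors over \<open>ker g'\<close>,
  hence over the image \<open>H(f', g')\<close>. The last equation determines it on the cover \<open>Ker g\<close> of \<open>H(f, g)\<close>.
\<close>

lemma homology_map_simps:
  assumes arr: "f \<in> Arr C" "g \<in> Arr C" "f' \<in> Arr C" "g' \<in> Arr C" "u \<in> Arr C" "v \<in> Arr C" "w \<in> Arr C"
    and ends: "Cod C f = Dom C g" "Cod C f' = Dom C g'" "Dom C u = Dom C f" "Cod C u = Dom C f'"
      "Dom C v = Dom C g" "Cod C v = Dom C g'" "Dom C w = Cod C g" "Cod C w = Cod C g'"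
    and sq: "f \<odot> v = u \<odot> f'" "g \<odot> w = v \<odot> g'"
  shows "homology_map C (f, g) (f', g') v \<in> Arr C"
    "Dom C (homology_map C (f, g) (f', g') v) = homology C f g"
    "Cod C (homology_map C (f, g) (f', g') v) = homology C f' g'"
    "homology_proj C f g \<odot> (homology_map C (f, g) (f', g') v \<odot> himg f' g') =
       ker C g \<odot> (v \<odot> coker C f')"
proof -
  note [simp] = arr ends
  have "(f \<odot> v) \<odot> coker C f' = Nul C (Dom C f) (Coker C f')"
    unfolding sq by simp
  then have "f \<odot> (v \<odot> coker C f') = Nul C (Dom C f) (Coker C f')" by simp
  note cm = coker_map_simps[of f f' v, OF _ _ _ _ _ this, simplified]
  let ?cm = "coker_map C f f' v" and ?p = "homology_proj C f g" and ?H' = "homology_arrow C f' g'"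
  note [simp] = cm(1-3)
  note p = homology_proj_simps[of f g, simplified]
  note [simp] = p(1-3)
  have pc: "?p \<odot> (himg f g \<odot> ?cm) = ker C g \<odot> (v \<odot> coker C f')"
  proof -
    have "?p \<odot> (himg f g \<odot> ?cm) = (?p \<odot> himg f g) \<odot> ?cm" by simp
    also have "\<dots> = ker C g \<odot> (coker C f \<odot> ?cm)" unfolding p(4) by simp
    finally show ?thesis unfolding cm(4) .
  qed
  have "(ker C g \<odot> v) \<odot> g' = (ker C g \<odot> g) \<odot> w"
    by (simp add: sq(2)[symmetric] del: ker_simps(4))
  then have "(ker C g \<odot> v) \<odot> g' = Nul C (Ker C g) (Cod C g')" by simp
  then obtain l where l [simp]: "l \<in> Arr C" "Dom C l = Ker C g" "Cod C l = Ker C g'"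
    and lk: "l \<odot> ker C g' = ker C g \<odot> v"
    using ker_lift[of g' "ker C g \<odot> v"] by auto
  have "ker C g \<odot> (v \<odot> coker C f') = (l \<odot> ker C g') \<odot> coker C f'"
    by (simp add: lk)
  also have "\<dots> = l \<odot> ?H'" by (simp add: homology_arrow_def)
  finally have l': "ker C g \<odot> (v \<odot> coker C f') = l \<odot> ?H'" .
  have "?p \<odot> ((himg f g \<odot> ?cm) \<odot> coker C ?H') = (?p \<odot> (himg f g \<odot> ?cm)) \<odot> coker C ?H'"
    by simp
  also have "\<dots> = l \<odot> (?H' \<odot> coker C ?H')"
    unfolding pc l' by (simp del: coker_simps(4))
  also have "\<dots> = Nul C (Ker C g) (Coker C ?H')" by simp
  finally have "(himg f g \<odot> ?cm) \<odot> coker C ?H' = Nul C (homology C f g) (Coker C ?H')"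
    using epic_cancel[OF p(5), of "(himg f g \<odot> ?cm) \<odot> coker C ?H'"] by simp
  then obtain h where h: "h \<in> Arr C" "Dom C h = homology C f g" "Cod C h = homology C f' g'"
    "h \<odot> himg f' g' = himg f g \<odot> ?cm"
    using img_lift[of ?H' "himg f g \<odot> ?cm"] by auto
  have "homology_map C (f, g) (f', g') v = h"
    unfolding homology_map_def prod.case
  proof (rule the_equality)
    show "h \<in> Hom C (homology C f g) (homology C f' g') \<and> h \<odot> himg f' g' = himg f g \<odot> ?cm"
      using h by (simp add: in_Hom)
    fix h' assume *: "h' \<in> Hom C (homology C f g) (homology C f' g') \<and> h' \<odot> himg f' g' = himg f g \<odot> ?cm"
    show "h' = h" by (rule monicD[of "himg f' g'"]) (use * h in \<open>auto simp: in_Hom\<close>)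
  qed
  then show "homology_map C (f, g) (f', g') v \<in> Arr C"
    "Dom C (homology_map C (f, g) (f', g') v) = homology C f g"
    "Cod C (homology_map C (f, g) (f', g') v) = homology C f' g'"
    "homology_proj C f g \<odot> (homology_map C (f, g) (f', g') v \<odot> himg f' g') =
       ker C g \<odot> (v \<odot> coker C f')"
    using h pc by simp_all
qed

section \<open>Subquotients and filtrations\<close>

text \<open>
  The preimage of a subobject of a quotient is the kernel of the composite with the cokernel of the
  subobject; it maps onto the subobject because elements of the quotient lift locally.
\<close>

lemma subquotient_of_subobject_of_quotient:
  assumes m: "monic C m" "Cod C m = Cod C p" and p: "epic C p"
  shows "subquotient C (Dom C m) (Dom C p)"
proof -
  note [simp] = monic_in_Arr[OF m(1)] epic_in_Arr[OF p] m(2)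
  let ?c = "p \<odot> coker C m"
  obtain g where g: "g \<in> Arr C" "is_kernel C g m" using monic_is_kernel[OF m(1)] by blast
  have g' [simp]: "Dom C g = Cod C p" and mg: "m \<odot> g = Nul C (Dom C m) (Cod C g)"
    using g by (auto simp: is_kernel_def in_Hom)
  obtain g1 where g1 [simp]: "g1 \<in> Arr C" "Dom C g1 = Coker C m" "Cod C g1 = Cod C g" and cg: "coker C m \<odot> g1 = g"
    using coker_lift[of m g] mg g by auto
  have "(ker C ?c \<odot> p) \<odot> g = (ker C ?c \<odot> ?c) \<odot> g1"
    by (simp del: ker_simps(4) flip: cg)
  also have "\<dots> = Nul C (Ker C ?c) (Cod C g)" by simp
  finally have "(ker C ?c \<odot> p) \<odot> g = Nul C (Ker C ?c) (Cod C g)" .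
  moreover have "ker C ?c \<odot> p \<in> Hom C (Ker C ?c) (Dom C g)" "Ker C ?c \<in> Obj C"
    by (simp_all add: in_Hom)
  ultimately have "\<exists>!t. t \<in> Hom C (Ker C ?c) (Dom C m) \<and> t \<odot> m = ker C ?c \<odot> p"
    using g unfolding is_kernel_def by blast
  then obtain t where t [simp]: "t \<in> Arr C" "Dom C t = Ker C ?c" "Cod C t = Dom C m"
    and tm: "t \<odot> m = ker C ?c \<odot> p"
    by (auto simp: in_Hom)
  have "epic C t"
  proof -
    obtain e x where ex: "epic C e" "e \<in> Arr C" "x \<in> Arr C" "Cod C e = Dom C m" "Dom C x = Dom C e"
      "Cod C x = Dom C p" "e \<odot> m = x \<odot> p"
      using local_lift[OF p, of m] by auto
    have "x \<odot> ?c = (x \<odot> p) \<odot> coker C m" using ex by simp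
    also have "\<dots> = e \<odot> (m \<odot> coker C m)" using ex(2-6) by (simp add: ex(7)[symmetric] del: coker_simps(4))
    also have "\<dots> = Nul C (Dom C x) (Coker C m)" using ex by simp
    finally obtain x' where x': "x' \<in> Arr C" "Dom C x' = Dom C x" "Cod C x' = Ker C ?c" "x' \<odot> ker C ?c = x"
      using ker_lift[of ?c x] ex by auto
    have "(x' \<odot> t) \<odot> m = (x' \<odot> ker C ?c) \<odot> p"
      using x'(1-3) by (simp add: tm)
    then have eq: "(x' \<odot> t) \<odot> m = e \<odot> m"
      by (simp only: x'(4) ex(7))
    have "x' \<odot> t = e"
      by (rule monicD[OF m(1)]) (use x' ex eq in simp_all)
    then show ?thesis using epic_right_factor[of x' t] ex x' by simp
  qed
  then show ?thesis
    unfolding subquotient_def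
    by (intro bexI[of _ "Ker C ?c"] conjI bexI[of _ "ker C ?c"] bexI[of _ t]) (simp_all add: in_Hom)
qed

lemma subquotient_quotient:
  assumes "subquotient C s y" "epic C f" "Dom C f = s"
  shows "subquotient C (Cod C f) y"
proof -
  obtain t m e where t: "t \<in> Obj C" "m \<in> Hom C t y" "monic C m" "e \<in> Hom C t s" "epic C e"
    using assms(1) unfolding subquotient_def by blast
  have "e \<odot> f \<in> Hom C t (Cod C f)" "epic C (e \<odot> f)"
    using t assms epic_in_Arr[OF assms(2)] by (auto simp: in_Hom intro: epic_Comp)
  then show ?thesis unfolding subquotient_def using t by blast
qed

text \<open>The hypothesis says that the kernel of \<open>e\<close> is contained in the image of \<open>n\<close>.\<close>

lemma coker_quotient:
  assumes e: "epic C e" and n: "n \<in> Arr C" "Cod C n = Dom C e"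
    and ker: "ker C e \<odot> coker C n = Nul C (Ker C e) (Coker C n)"
  obtains f where "epic C f" "Dom C f = Cod C e" "Cod C f = Coker C n"
proof -
  note [simp] = epic_in_Arr[OF e] n
  obtain f where f: "f \<in> Arr C" "Dom C f = Cod C e" "Cod C f = Coker C n" "e \<odot> f = coker C n"
    using epic_lift[OF e, of "coker C n"] ker by auto
  then have "epic C f" by (intro epic_right_factor[of e f]) simp_all
  with f show thesis by (intro that)
qed

lemma zero_object_subquotient:
  assumes "subquotient C s y" "zero_object C y"
  shows "zero_object C s"
proof -
  obtain t m e where t: "t \<in> Obj C" "m \<in> Hom C t y" "monic C m" "e \<in> Hom C t s" "epic C e"
    using assms(1) unfolding subquotient_def by blast
  note z = zero_object_Ident[OF assms(2)]
  have s: "s \<in> Obj C" using t by (auto simp: in_Hom)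
  have "m = m \<odot> Ident C y" using t by (simp add: in_Hom)
  then have "m = Nul C t y" using t z by (simp add: in_Hom)
  then have "Ident C t = Nul C t t"
    using monic_cancel[OF t(3), of "Ident C t"] t z by (auto simp: in_Hom)
  then have "e = Nul C t s" using Ident_Comp[of e t] t s by (auto simp: in_Hom)
  then have "Ident C s = Nul C s s"
    using epic_cancel[OF t(5), of "Ident C s"] t s by (auto simp: in_Hom)
  then show ?thesis using s by (intro zero_objectI)
qed

text \<open>
  By induction along the filtration: if \<open>F k\<close> and the cokernel of \<open>F k \<rightarrow> F (k + 1)\<close> are zero, then the
  identity of \<open>F (k + 1)\<close> factors over that cokernel.
\<close>

lemma zero_object_filtered:
  assumes fil: "filtered_by_subquotients C x ys" and zero: "\<And>y. y \<in> set ys \<Longrightarrow> zero_object C y"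
  shows "zero_object C x"
proof -
  obtain F m zs where F: "mset zs = mset ys" "zero_object C (F 0)" "F (length ys) = x"
    and step: "\<And>k. k < length ys \<Longrightarrow> m k \<in> Hom C (F k) (F (Suc k)) \<and> subquotient C (Coker C (m k)) (zs ! k)"
    using fil unfolding filtered_by_subquotients_def by blast
  have "k \<le> length ys \<Longrightarrow> zero_object C (F k)" for k
  proof (induction k)
    case (Suc k)
    then have k: "k < length ys" and zk: "zero_object C (F k)" by simp_all
    note z = zero_object_Ident[OF zk]
    have "zs ! k \<in> set zs" using k mset_eq_length[OF F(1)] by simp
    then have "zero_object C (zs ! k)" using zero mset_eq_setD[OF F(1)] by simp
    then have "zero_object C (Coker C (m k))"
      using step[OF k] zero_object_subquotient by blast
    note zc = zero_object_Ident[OF this]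
    have mk: "m k \<in> Arr C" "Dom C (m k) = F k" "Cod C (m k) = F (Suc k)"
      using step[OF k] by (auto simp: in_Hom)
    have o: "F (Suc k) \<in> Obj C" using mk Cod_in by metis
    have "m k = Nul C (F k) (F (Suc k))"
      using Ident_Comp[of "m k" "F k"] mk z o by simp
    then obtain u where u: "u \<in> Arr C" "Dom C u = Coker C (m k)" "Cod C u = F (Suc k)"
      "coker C (m k) \<odot> u = Ident C (F (Suc k))"
      using coker_lift[of "m k" "Ident C (F (Suc k))"] mk o z by auto
    have "coker C (m k) = Nul C (F (Suc k)) (Coker C (m k))"
      using Comp_Ident[of "coker C (m k)" "Coker C (m k)"] mk zc o by simp
    then have "Ident C (F (Suc k)) = Nul C (F (Suc k)) (F (Suc k))"
      using u o by simp
    then show ?case using o by (intro zero_objectI)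
  qed (use F in simp)
  then show ?thesis using F(3) by blast
qed

lemma monic_of_zero_Ker:
  assumes "f \<in> Arr C" "zero_object C (Ker C f)"
  shows "monic C f"
  unfolding monic_iff
proof (intro conjI ballI impI)
  fix g assume g: "g \<in> Arr C" "Cod C g = Dom C f" "g \<odot> f = Nul C (Dom C g) (Cod C f)"
  obtain u where u: "u \<in> Arr C" "Dom C u = Dom C g" "Cod C u = Ker C f" "u \<odot> ker C f = g"
    using ker_lift[OF assms(1) g] .
  have "ker C f = Nul C (Ker C f) (Dom C f)"
    using Ident_Comp[of "ker C f" "Ker C f"] zero_object_Ident[OF assms(2)] assms(1) by simp
  then show "g = Nul C (Dom C g) (Dom C f)"
    using u assms(1) by simp
qed fact

end


section \<open>A diagram lemma for two complexes\<close>

text \<open>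
  The primed arrow \<open>\<alpha>'\<close> starts the second row. The maps below are \<open>\<theta> : ker \<epsilon> \<rightarrow> ker \<zeta>\<close>,
  \<open>\<xi> : ker \<zeta> \<rightarrow> H(\<beta>, \<gamma>)\<close> and \<open>\<chi> : H(\<alpha>, \<beta>) \<rightarrow> H(\<alpha>', \<iota>)\<close>.
\<close>

locale two_complexes = abelian_category C for C :: "('o, 'm) precat" (structure) +
  fixes \<alpha> \<beta> \<gamma> \<alpha>' \<iota> \<kappa> \<delta> \<epsilon> \<zeta> \<eta> :: 'm
  assumes arr [simp]: "\<alpha> \<in> Arr C" "\<beta> \<in> Arr C" "\<gamma> \<in> Arr C" "\<alpha>' \<in> Arr C" "\<iota> \<in> Arr C" "\<kappa> \<in> Arr C"
      "\<delta> \<in> Arr C" "\<epsilon> \<in> Arr C" "\<zeta> \<in> Arr C" "\<eta> \<in> Arr C"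
    and ends [simp]: "Cod C \<alpha> = Dom C \<beta>" "Cod C \<beta> = Dom C \<zeta>" "Dom C \<gamma> = Dom C \<zeta>"
      "Cod C \<alpha>' = Dom C \<iota>" "Cod C \<iota> = Dom C \<kappa>" "Dom C \<delta> = Dom C \<alpha>" "Cod C \<delta> = Dom C \<alpha>'"
      "Dom C \<epsilon> = Dom C \<beta>" "Cod C \<epsilon> = Dom C \<iota>" "Cod C \<zeta> = Dom C \<kappa>"
      "Dom C \<eta> = Cod C \<gamma>" "Cod C \<eta> = Cod C \<kappa>"
    and sq1: "\<alpha> \<odot> \<epsilon> = \<delta> \<odot> \<alpha>'" and sq2: "\<beta> \<odot> \<zeta> = \<epsilon> \<odot> \<iota>" and sq3: "\<gamma> \<odot> \<eta> = \<zeta> \<odot> \<kappa>"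
    and zero: "\<alpha> \<odot> \<beta> = Nul C (Dom C \<alpha>) (Dom C \<zeta>)" "\<beta> \<odot> \<gamma> = Nul C (Dom C \<beta>) (Cod C \<gamma>)"
      "\<alpha>' \<odot> \<iota> = Nul C (Dom C \<alpha>') (Dom C \<kappa>)"
    and delta: "epic C \<delta>" and eta: "monic C \<eta>"
begin

abbreviation "\<theta> \<equiv> ker_map C \<epsilon> \<zeta> \<beta>"
abbreviation "\<xi> \<equiv> ker_incl C \<zeta> \<gamma> \<odot> homology_proj C \<beta> \<gamma>"
abbreviation "\<chi> \<equiv> homology_map C (\<alpha>, \<beta>) (\<alpha>', \<iota>) \<epsilon>"

lemma theta_simps [simp]: "\<theta> \<in> Arr C" "Dom C \<theta> = Ker C \<epsilon>" "Cod C \<theta> = Ker C \<zeta>"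
  and theta_ker: "\<theta> \<odot> ker C \<zeta> = ker C \<epsilon> \<odot> \<beta>"
proof -
  have "ker C \<epsilon> \<odot> (\<beta> \<odot> \<zeta>) = (ker C \<epsilon> \<odot> \<epsilon>) \<odot> \<iota>"
    unfolding sq2 by (simp del: ker_simps(4))
  also have "\<dots> = Nul C (Ker C \<epsilon>) (Cod C \<zeta>)" by simp
  finally have "ker C \<epsilon> \<odot> (\<beta> \<odot> \<zeta>) = Nul C (Ker C \<epsilon>) (Cod C \<zeta>)" .
  note * = ker_map_simps[of \<epsilon> \<zeta> \<beta>, OF _ _ _ _ _ this, simplified]
  show "\<theta> \<in> Arr C" "Dom C \<theta> = Ker C \<epsilon>" "Cod C \<theta> = Ker C \<zeta>" "\<theta> \<odot> ker C \<zeta> = ker C \<epsilon> \<odot> \<beta>"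
    by (fact *)+
qed

lemma ker_zeta_gamma: "ker C \<zeta> \<odot> \<gamma> = Nul C (Ker C \<zeta>) (Cod C \<gamma>)"
proof -
  have "(ker C \<zeta> \<odot> \<gamma>) \<odot> \<eta> = (ker C \<zeta> \<odot> \<zeta>) \<odot> \<kappa>"
    by (simp add: sq3 del: ker_simps(4))
  also have "\<dots> = Nul C (Ker C \<zeta>) (Cod C \<eta>)" by simp
  finally show ?thesis using monic_cancel[OF eta, of "ker C \<zeta> \<odot> \<gamma>"] by simp
qed

lemmas incl_simps [simp] = ker_incl_simps(1-3)[of \<zeta> \<gamma>, OF _ _ _ ker_zeta_gamma, simplified]
lemmas ker_incl_ker = ker_incl_simps(4)[of \<zeta> \<gamma>, OF _ _ _ ker_zeta_gamma, simplified]

lemmas top_proj_simps [simp] = homology_proj_simps(1-3)[of \<beta> \<gamma>, simplified]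
lemmas top_proj_img = homology_proj_simps(4)[of \<beta> \<gamma>, simplified]

lemmas left_proj_simps [simp] = homology_proj_simps(1-3)[of \<alpha> \<beta>, simplified]
lemmas bottom_proj_simps [simp] = homology_proj_simps(1-3)[of \<alpha>' \<iota>, simplified]
lemmas bottom_proj_img = homology_proj_simps(4)[of \<alpha>' \<iota>, simplified]

lemmas chi_simps [simp] = homology_map_simps(1-3)[of \<alpha> \<beta> \<alpha>' \<iota> \<delta> \<epsilon> \<zeta>, OF _ _ _ _ _ _ _ _ _ _ _ _ _ _ _ sq1 sq2, simplified]
lemmas proj_chi = homology_map_simps(4)[of \<alpha> \<beta> \<alpha>' \<iota> \<delta> \<epsilon> \<zeta>, OF _ _ _ _ _ _ _ _ _ _ _ _ _ _ _ sq1 sq2, simplified]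

lemma xi_img: "\<xi> \<odot> himg \<beta> \<gamma> = ker C \<zeta> \<odot> coker C \<beta>"
proof -
  have "\<xi> \<odot> himg \<beta> \<gamma> = (ker_incl C \<zeta> \<gamma> \<odot> ker C \<gamma>) \<odot> coker C \<beta>"
    by (simp add: top_proj_img)
  then show ?thesis by (simp only: ker_incl_ker)
qed

lemma theta_xi: "\<theta> \<odot> \<xi> = Nul C (Ker C \<epsilon>) (homology C \<beta> \<gamma>)"
proof -
  have "(\<theta> \<odot> \<xi>) \<odot> himg \<beta> \<gamma> = \<theta> \<odot> (\<xi> \<odot> himg \<beta> \<gamma>)" by simp
  also have "\<dots> = (\<theta> \<odot> ker C \<zeta>) \<odot> coker C \<beta>" unfolding xi_img by simp
  also have "\<dots> = ker C \<epsilon> \<odot> (\<beta> \<odot> coker C \<beta>)" unfolding theta_ker by (simp del: coker_simps(4))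
  also have "\<dots> = Nul C (Ker C \<epsilon>) (Coker C \<beta>)" by simp
  finally show ?thesis using monic_cancel[of "himg \<beta> \<gamma>" "\<theta> \<odot> \<xi>"] by simp
qed

text \<open>
  By \<open>xi_img\<close>, an element of \<open>ker \<zeta>\<close> is killed by \<open>\<xi>\<close> iff it vanishes in the cokernel of \<open>\<beta>\<close>. Applied
  to the universal such element, the inclusion of \<open>Ker \<xi>\<close>, this yields one cover \<open>e\<close> on which all
  preimages under \<open>\<beta>\<close> are chosen at once.
\<close>

lemma preimage_under_beta:
  obtains e b where "epic C e" "e \<in> Arr C" "b \<in> Arr C" "Cod C e = Ker C \<xi>" "Dom C b = Dom C e"
    "Cod C b = Dom C \<beta>" "e \<odot> (ker C \<xi> \<odot> ker C \<zeta>) = b \<odot> \<beta>"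
proof -
  have "(ker C \<xi> \<odot> ker C \<zeta>) \<odot> coker C \<beta> = (ker C \<xi> \<odot> \<xi>) \<odot> himg \<beta> \<gamma>"
    using xi_img by (simp del: ker_simps(4))
  also have "\<dots> = Nul C (Ker C \<xi>) (Coker C \<beta>)" by simp
  finally show thesis
    using local_preimage[of \<beta> "ker C \<xi> \<odot> ker C \<zeta>"] that by auto
qed

text \<open>
  The element \<open>b\<close> is, locally, a sum of elements of \<open>ker \<epsilon>\<close>, \<open>ker \<beta>\<close> and \<open>im \<alpha>\<close>. Both sides of the
  monomorphism to be constructed vanish precisely under this condition, which mentions neither
  homology nor cokernels.
\<close>

definition splits :: "'m \<Rightarrow> bool" where
  "splits b \<longleftrightarrow> (\<exists>d \<in> Arr C. \<exists>a \<in> Arr C. \<exists>b' \<in> Arr C. epic C d \<and> Cod C d = Dom C b \<and>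
     Dom C a = Dom C d \<and> Cod C a = Dom C \<alpha> \<and> Dom C b' = Dom C d \<and> Cod C b' = Dom C \<beta> \<and>
     b' \<odot> \<beta> = Nul C (Dom C d) (Dom C \<zeta>) \<and> d \<odot> (b \<odot> \<epsilon>) = b' \<odot> \<epsilon> \<oplus> a \<odot> (\<alpha> \<odot> \<epsilon>))"

text \<open>
  Modulo \<open>ker \<beta>\<close> and \<open>im \<alpha>\<close>, which \<open>\<beta>\<close> kills, the element \<open>b\<close> is replaced by one in \<open>ker \<epsilon>\<close> with the
  same image under \<open>\<beta>\<close>.
\<close>

lemma splits_iff_source:
  assumes x [simp]: "x \<in> Arr C" "Cod C x = Ker C \<zeta>" and b [simp]: "b \<in> Arr C" "Dom C b = Dom C x" "Cod C b = Dom C \<beta>"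
    and xb: "x \<odot> ker C \<zeta> = b \<odot> \<beta>"
  shows "x \<odot> coker C \<theta> = Nul C (Dom C x) (Coker C \<theta>) \<longleftrightarrow> splits b"
proof
  assume "x \<odot> coker C \<theta> = Nul C (Dom C x) (Coker C \<theta>)"
  then obtain d z where d: "epic C d" and [simp]: "d \<in> Arr C" "z \<in> Arr C" "Cod C d = Dom C x" "Dom C z = Dom C d"
    "Cod C z = Ker C \<epsilon>" and dz: "d \<odot> x = z \<odot> \<theta>"
    using local_preimage[of \<theta> x] by auto
  let ?b = "d \<odot> b \<oplus> neg C (z \<odot> ker C \<epsilon>)"
  have "(d \<odot> x) \<odot> ker C \<zeta> = (z \<odot> \<theta>) \<odot> ker C \<zeta>" by (simp only: dz)
  then have "d \<odot> (b \<odot> \<beta>) = z \<odot> (ker C \<epsilon> \<odot> \<beta>)" by (simp add: xb theta_ker)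
  then have 1: "?b \<odot> \<beta> = Nul C (Dom C d) (Dom C \<zeta>)"
    by (simp add: distribs neg_Comp)
  have 2: "d \<odot> (b \<odot> \<epsilon>) = ?b \<odot> \<epsilon> \<oplus> Nul C (Dom C d) (Dom C \<alpha>) \<odot> (\<alpha> \<odot> \<epsilon>)"
    by (simp add: distribs neg_Comp)
  show "splits b"
    unfolding splits_def using d 1 2
    by (intro bexI[of _ d] bexI[of _ "Nul C (Dom C d) (Dom C \<alpha>)"] bexI[of _ ?b]) simp_all
next
  assume "splits b"
  then obtain d a b' where d: "epic C d" and [simp]: "d \<in> Arr C" "a \<in> Arr C" "b' \<in> Arr C" "Cod C d = Dom C x"
    "Dom C a = Dom C d" "Cod C a = Dom C \<alpha>" "Dom C b' = Dom C d" "Cod C b' = Dom C \<beta>"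
    and b': "b' \<odot> \<beta> = Nul C (Dom C d) (Dom C \<zeta>)" and eq: "d \<odot> (b \<odot> \<epsilon>) = b' \<odot> \<epsilon> \<oplus> a \<odot> (\<alpha> \<odot> \<epsilon>)"
    unfolding splits_def by auto
  let ?b = "d \<odot> b \<oplus> neg C (b' \<oplus> a \<odot> \<alpha>)"
  have "?b \<odot> \<epsilon> = Nul C (Dom C d) (Dom C \<iota>)"
    by (simp add: Comp_add_left neg_Comp eq)
  then obtain z where [simp]: "z \<in> Arr C" "Dom C z = Dom C d" "Cod C z = Ker C \<epsilon>" and z: "z \<odot> ker C \<epsilon> = ?b"
    using ker_lift[of \<epsilon> ?b] by auto
  have "(b' \<oplus> a \<odot> \<alpha>) \<odot> \<beta> = Nul C (Dom C d) (Dom C \<zeta>)"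
    by (simp add: distribs b' zero)
  then have "?b \<odot> \<beta> = d \<odot> (b \<odot> \<beta>)"
    by (simp add: Comp_add_left[of "d \<odot> b"] neg_Comp)
  then have "(z \<odot> \<theta>) \<odot> ker C \<zeta> = (d \<odot> x) \<odot> ker C \<zeta>"
    by (simp add: theta_ker xb flip: z)
  then have "d \<odot> x = z \<odot> \<theta>"
    by (intro monicD[of "ker C \<zeta>" "d \<odot> x" "z \<odot> \<theta>"]) simp_all
  then have "(d \<odot> x) \<odot> coker C \<theta> = (z \<odot> \<theta>) \<odot> coker C \<theta>" by (simp only:)
  then have "d \<odot> (x \<odot> coker C \<theta>) = Nul C (Dom C d) (Coker C \<theta>)" by simp
  then show "x \<odot> coker C \<theta> = Nul C (Dom C x) (Coker C \<theta>)"
    using epic_cancel[OF d, of "x \<odot> coker C \<theta>"] by simp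
qed

text \<open>
  The class of \<open>\<epsilon>(b)\<close> is hit by \<open>\<chi>\<close> iff \<open>\<epsilon>(b)\<close> equals \<open>\<epsilon>(b')\<close> with \<open>b'\<close> in \<open>ker \<beta>\<close>, up to \<open>im \<alpha>'\<close>; since
  \<open>\<delta>\<close> is an epimorphism, \<open>im \<alpha>'\<close> is the image of \<open>\<alpha> \<odot> \<epsilon>\<close>. The four covers in the first direction stem
  from the image of \<open>\<chi>\<close>, the cover of \<open>H(\<alpha>, \<beta>)\<close> by \<open>ker \<beta>\<close>, the image of \<open>\<alpha>'\<close>, and \<open>\<delta>\<close>.
\<close>

lemma splits_iff_target:
  assumes y [simp]: "y \<in> Arr C" "Cod C y = Ker C \<iota>" and b [simp]: "b \<in> Arr C" "Dom C b = Dom C y" "Cod C b = Dom C \<beta>"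
    and yb: "y \<odot> ker C \<iota> = b \<odot> \<epsilon>"
  shows "y \<odot> (homology_proj C \<alpha>' \<iota> \<odot> coker C \<chi>) = Nul C (Dom C y) (Coker C \<chi>) \<longleftrightarrow> splits b"
proof
  assume "y \<odot> (homology_proj C \<alpha>' \<iota> \<odot> coker C \<chi>) = Nul C (Dom C y) (Coker C \<chi>)"
  then have "(y \<odot> homology_proj C \<alpha>' \<iota>) \<odot> coker C \<chi> = Nul C (Dom C y) (Coker C \<chi>)" by simp
  then obtain d1 x1 where d1: "epic C d1" and [simp]: "d1 \<in> Arr C" "x1 \<in> Arr C" "Cod C d1 = Dom C y"
    "Dom C x1 = Dom C d1" "Cod C x1 = homology C \<alpha> \<beta>" and 1: "d1 \<odot> (y \<odot> homology_proj C \<alpha>' \<iota>) = x1 \<odot> \<chi>"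
    using local_preimage[of \<chi> "y \<odot> homology_proj C \<alpha>' \<iota>"] by auto
  obtain d2 x2 where d2: "epic C d2" and [simp]: "d2 \<in> Arr C" "x2 \<in> Arr C" "Cod C d2 = Dom C d1"
    "Dom C x2 = Dom C d2" "Cod C x2 = Ker C \<beta>" and 2: "d2 \<odot> x1 = x2 \<odot> homology_proj C \<alpha> \<beta>"
    using local_lift[OF homology_proj_simps(5)[of \<alpha> \<beta>], of x1] by auto
  let ?k = "x2 \<odot> ker C \<beta>" and ?d = "d2 \<odot> d1"
  have "?d \<odot> (b \<odot> (\<epsilon> \<odot> coker C \<alpha>')) = (?d \<odot> (b \<odot> \<epsilon>)) \<odot> coker C \<alpha>'" by simp
  also have "\<dots> = ?d \<odot> (y \<odot> (ker C \<iota> \<odot> coker C \<alpha>'))"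
    unfolding yb[symmetric] by simp
  also have "\<dots> = (d2 \<odot> (d1 \<odot> (y \<odot> homology_proj C \<alpha>' \<iota>))) \<odot> himg \<alpha>' \<iota>"
    by (simp add: bottom_proj_img)
  also have "\<dots> = ((d2 \<odot> x1) \<odot> \<chi>) \<odot> himg \<alpha>' \<iota>"
    unfolding 1 by simp
  also have "\<dots> = x2 \<odot> (homology_proj C \<alpha> \<beta> \<odot> (\<chi> \<odot> himg \<alpha>' \<iota>))"
    unfolding 2 by simp
  also have "\<dots> = ?k \<odot> (\<epsilon> \<odot> coker C \<alpha>')"
    unfolding proj_chi by simp
  finally have "(?d \<odot> b \<oplus> neg C ?k) \<odot> (\<epsilon> \<odot> coker C \<alpha>') = Nul C (Dom C d2) (Coker C \<alpha>')"
    by (simp add: Comp_add_left neg_Comp)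
  then have "((?d \<odot> b \<oplus> neg C ?k) \<odot> \<epsilon>) \<odot> coker C \<alpha>' = Nul C (Dom C d2) (Coker C \<alpha>')"
    by simp
  then obtain d3 a3 where d3: "epic C d3" and [simp]: "d3 \<in> Arr C" "a3 \<in> Arr C" "Cod C d3 = Dom C d2"
    "Dom C a3 = Dom C d3" "Cod C a3 = Dom C \<alpha>'" and 3: "d3 \<odot> ((?d \<odot> b \<oplus> neg C ?k) \<odot> \<epsilon>) = a3 \<odot> \<alpha>'"
    using local_preimage[of \<alpha>' "(?d \<odot> b \<oplus> neg C ?k) \<odot> \<epsilon>"] by auto
  obtain d4 a where d4: "epic C d4" and [simp]: "d4 \<in> Arr C" "a \<in> Arr C" "Cod C d4 = Dom C d3"
    "Dom C a = Dom C d4" "Cod C a = Dom C \<alpha>" and 4: "d4 \<odot> a3 = a \<odot> \<delta>"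
    using local_lift[OF delta, of a3] by auto
  let ?e = "d4 \<odot> (d3 \<odot> ?d)" and ?b = "(d4 \<odot> d3) \<odot> ?k"
  have e: "epic C ?e"
    by (intro epic_Comp d1 d2 d3 d4) simp_all
  have "(d4 \<odot> d3) \<odot> ((?d \<odot> b \<oplus> neg C ?k) \<odot> \<epsilon>) = d4 \<odot> (d3 \<odot> ((?d \<odot> b \<oplus> neg C ?k) \<odot> \<epsilon>))"
    by (rule assoc) simp_all
  also have "\<dots> = (d4 \<odot> a3) \<odot> \<alpha>'"
    unfolding 3 by simp
  also have "\<dots> = a \<odot> (\<alpha> \<odot> \<epsilon>)"
    unfolding 4 sq1 by simp
  finally have "?e \<odot> (b \<odot> \<epsilon>) \<oplus> neg C (?b \<odot> \<epsilon>) = a \<odot> (\<alpha> \<odot> \<epsilon>)"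
    by (simp add: distribs neg_Comp Comp_neg)
  then have "?e \<odot> (b \<odot> \<epsilon>) = ?b \<odot> \<epsilon> \<oplus> a \<odot> (\<alpha> \<odot> \<epsilon>)"
    by (subst (asm) diff_eq_iff) (simp_all add: add_commute)
  moreover have "?b \<odot> \<beta> = Nul C (Dom C ?e) (Dom C \<zeta>)" by simp
  ultimately show "splits b"
    unfolding splits_def using e
    by (intro bexI[of _ ?e] bexI[of _ a] bexI[of _ ?b]) simp_all
next
  assume "splits b"
  then obtain d a b' where d: "epic C d" and [simp]: "d \<in> Arr C" "a \<in> Arr C" "b' \<in> Arr C" "Cod C d = Dom C y"
    "Dom C a = Dom C d" "Cod C a = Dom C \<alpha>" "Dom C b' = Dom C d" "Cod C b' = Dom C \<beta>"
    and b': "b' \<odot> \<beta> = Nul C (Dom C d) (Dom C \<zeta>)" and eq: "d \<odot> (b \<odot> \<epsilon>) = b' \<odot> \<epsilon> \<oplus> a \<odot> (\<alpha> \<odot> \<epsilon>)"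
    unfolding splits_def by auto
  obtain x where [simp]: "x \<in> Arr C" "Dom C x = Dom C d" "Cod C x = Ker C \<beta>" and x: "x \<odot> ker C \<beta> = b'"
    using ker_lift[of \<beta> b'] b' by auto
  have "(a \<odot> (\<alpha> \<odot> \<epsilon>)) \<odot> coker C \<alpha>' = (a \<odot> \<delta>) \<odot> (\<alpha>' \<odot> coker C \<alpha>')"
    unfolding sq1 by (simp del: coker_simps(4))
  then have a0: "(a \<odot> (\<alpha> \<odot> \<epsilon>)) \<odot> coker C \<alpha>' = Nul C (Dom C d) (Coker C \<alpha>')" by simp
  have "(d \<odot> (y \<odot> homology_proj C \<alpha>' \<iota>)) \<odot> himg \<alpha>' \<iota> = (d \<odot> (y \<odot> ker C \<iota>)) \<odot> coker C \<alpha>'"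
    by (simp add: bottom_proj_img)
  also have "\<dots> = (b' \<odot> \<epsilon> \<oplus> a \<odot> (\<alpha> \<odot> \<epsilon>)) \<odot> coker C \<alpha>'"
    unfolding yb eq ..
  also have "\<dots> = (b' \<odot> \<epsilon>) \<odot> coker C \<alpha>' \<oplus> (a \<odot> (\<alpha> \<odot> \<epsilon>)) \<odot> coker C \<alpha>'"
    by (rule Comp_add_left) simp_all
  also have "\<dots> = x \<odot> (ker C \<beta> \<odot> (\<epsilon> \<odot> coker C \<alpha>'))"
    unfolding a0 x[symmetric] by simp
  also have "\<dots> = (x \<odot> (homology_proj C \<alpha> \<beta> \<odot> \<chi>)) \<odot> himg \<alpha>' \<iota>"
    unfolding proj_chi[symmetric] by simp
  finally have "d \<odot> (y \<odot> homology_proj C \<alpha>' \<iota>) = x \<odot> (homology_proj C \<alpha> \<beta> \<odot> \<chi>)"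
    by (intro monicD[of "himg \<alpha>' \<iota>" "d \<odot> (y \<odot> homology_proj C \<alpha>' \<iota>)"]) simp_all
  then have "(d \<odot> (y \<odot> homology_proj C \<alpha>' \<iota>)) \<odot> coker C \<chi> = (x \<odot> (homology_proj C \<alpha> \<beta> \<odot> \<chi>)) \<odot> coker C \<chi>"
    by (simp only:)
  then have "d \<odot> (y \<odot> (homology_proj C \<alpha>' \<iota> \<odot> coker C \<chi>)) = Nul C (Dom C d) (Coker C \<chi>)"
    by simp
  then show "y \<odot> (homology_proj C \<alpha>' \<iota> \<odot> coker C \<chi>) = Nul C (Dom C y) (Coker C \<chi>)"
    using epic_cancel[OF d, of "y \<odot> (homology_proj C \<alpha>' \<iota> \<odot> coker C \<chi>)"] by simp
qed

lemmas middle_proj_simps = homology_proj_simps[of \<theta> \<xi>, simplified]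

text \<open>
  The cover \<open>e\<close> of \<open>Ker \<xi>\<close> maps onto the source by \<open>?s\<close>, and to the target by \<open>?t\<close>, which sends the chosen
  preimage \<open>b\<close> to the class of \<open>\<epsilon>(b)\<close>. By the two criteria the same elements vanish under both.
\<close>

theorem homology_monic:
  obtains m where "m \<in> Hom C (homology C \<theta> \<xi>) (Coker C \<chi>)" "monic C m"
proof -
  note [simp] = middle_proj_simps(1-3)
  obtain e b where e: "epic C e" and [simp]: "e \<in> Arr C" "b \<in> Arr C" "Cod C e = Ker C \<xi>" "Dom C b = Dom C e"
    "Cod C b = Dom C \<beta>" and eb: "e \<odot> (ker C \<xi> \<odot> ker C \<zeta>) = b \<odot> \<beta>"
    by (rule preimage_under_beta)
  have "(b \<odot> \<epsilon>) \<odot> \<iota> = (b \<odot> \<beta>) \<odot> \<zeta>" by (simp add: sq2)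
  also have "\<dots> = e \<odot> (ker C \<xi> \<odot> (ker C \<zeta> \<odot> \<zeta>))" unfolding eb[symmetric] by (simp del: ker_simps(4))
  also have "\<dots> = Nul C (Dom C e) (Dom C \<kappa>)" by simp
  finally obtain y where [simp]: "y \<in> Arr C" "Dom C y = Dom C e" "Cod C y = Ker C \<iota>" and y: "y \<odot> ker C \<iota> = b \<odot> \<epsilon>"
    using ker_lift[of \<iota> "b \<odot> \<epsilon>"] by auto
  let ?s = "e \<odot> homology_proj C \<theta> \<xi>" and ?t = "y \<odot> (homology_proj C \<alpha>' \<iota> \<odot> coker C \<chi>)"
  have s: "epic C ?s" using e middle_proj_simps(5) by (intro epic_Comp) simp_all
  have "p \<odot> ?s = Nul C (Dom C p) (Cod C ?s) \<longleftrightarrow> p \<odot> ?t = Nul C (Dom C p) (Cod C ?t)"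
    if p: "p \<in> Arr C" "Cod C p = Dom C ?s" for p
  proof -
    have [simp]: "p \<in> Arr C" "Cod C p = Dom C e" using p by simp_all
    let ?x = "p \<odot> (e \<odot> ker C \<xi>)"
    have "(p \<odot> ?s) \<odot> himg \<theta> \<xi> = ?x \<odot> coker C \<theta>"
      by (simp add: middle_proj_simps(4))
    then have xs: "?x \<odot> coker C \<theta> = (p \<odot> ?s) \<odot> himg \<theta> \<xi>" by (rule sym)
    have "p \<odot> ?s = Nul C (Dom C p) (Cod C ?s) \<longleftrightarrow> ?x \<odot> coker C \<theta> = Nul C (Dom C p) (Coker C \<theta>)"
    proof
      assume "p \<odot> ?s = Nul C (Dom C p) (Cod C ?s)"
      then show "?x \<odot> coker C \<theta> = Nul C (Dom C p) (Coker C \<theta>)" unfolding xs by simp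
    next
      assume "?x \<odot> coker C \<theta> = Nul C (Dom C p) (Coker C \<theta>)"
      then show "p \<odot> ?s = Nul C (Dom C p) (Cod C ?s)"
        unfolding xs using monic_cancel[of "himg \<theta> \<xi>" "p \<odot> ?s"] by simp
    qed
    also have "\<dots> \<longleftrightarrow> splits (p \<odot> b)"
      using splits_iff_source[of ?x "p \<odot> b"] eb by simp
    also have "\<dots> \<longleftrightarrow> p \<odot> ?t = Nul C (Dom C p) (Cod C ?t)"
      using splits_iff_target[of "p \<odot> y" "p \<odot> b"] y by simp
    finally show ?thesis .
  qed
  then obtain m where "m \<in> Hom C (Cod C ?s) (Cod C ?t)" "monic C m"
    using monic_of_common_cover[OF s, of ?t] by auto
  then show thesis by (intro that[of m]) simp_all
qed

text \<open>
  The filtration is \<open>0 \<subseteq> im \<theta> \<subseteq> ker \<xi> \<subseteq> ker \<zeta>\<close>. Its middle graded part is a quotient of the source of the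
  monomorphism of \<open>homology_monic\<close>, and the target of that monomorphism is a quotient of \<open>H(\<alpha>', \<iota>)\<close>.
\<close>

theorem filtration:
  "filtered_by_subquotients C (Ker C \<zeta>) [Ker C \<epsilon>, homology C \<beta> \<gamma>, homology C \<alpha>' \<iota>]"
proof -
  note [simp] = middle_proj_simps(1-3)
  obtain z where z: "zero_object C z" using zero_object_exists by blast
  note z' [simp] = zero_object_Ident[OF z]
  obtain eu where eu: "epic C eu" and [simp]: "eu \<in> Arr C" "Dom C eu = Ker C \<epsilon>" "Cod C eu = Img C \<theta>"
    and eu': "eu \<odot> img C \<theta> = \<theta>"
    using img_factorisation[of \<theta>] by auto
  have "eu \<odot> (img C \<theta> \<odot> \<xi>) = (eu \<odot> img C \<theta>) \<odot> \<xi>" by simp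
  also have "\<dots> = Nul C (Dom C eu) (homology C \<beta> \<gamma>)" unfolding eu' by (simp add: theta_xi)
  finally have "img C \<theta> \<odot> \<xi> = Nul C (Img C \<theta>) (homology C \<beta> \<gamma>)"
    using epic_cancel[OF eu, of "img C \<theta> \<odot> \<xi>"] by simp
  then obtain m1 where [simp]: "m1 \<in> Arr C" "Dom C m1 = Img C \<theta>" "Cod C m1 = Ker C \<xi>" and m1: "m1 \<odot> ker C \<xi> = img C \<theta>"
    using ker_lift[of \<xi> "img C \<theta>"] by auto
  have mono_m1: "monic C m1"
    using monic_left_factor[of m1 "ker C \<xi>"] m1 by simp
  let ?m0 = "Nul C z (Img C \<theta>)"
  have mono_m0: "monic C ?m0"
    unfolding monic_iff
  proof (intro conjI ballI impI)
    fix f assume f: "f \<in> Arr C" "Cod C f = Dom C ?m0"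
    then show "f = Nul C (Dom C f) (Dom C ?m0)"
      using Comp_Ident[of f z] by simp
  qed simp

  have sq0: "subquotient C (Coker C ?m0) (Ker C \<epsilon>)"
  proof -
    have "epic C (eu \<odot> coker C ?m0)" using eu by (intro epic_Comp) simp_all
    then show ?thesis
      unfolding subquotient_def using Ident_monic[of "Ker C \<epsilon>"]
      by (intro bexI[of _ "Ker C \<epsilon>"] conjI bexI[of _ "Ident C (Ker C \<epsilon>)"] bexI[of _ "eu \<odot> coker C ?m0"])
        (simp_all add: in_Hom)
  qed
  have sq1: "subquotient C (Coker C m1) (homology C \<alpha>' \<iota>)"
  proof -
    obtain m where m: "m \<in> Hom C (homology C \<theta> \<xi>) (Coker C \<chi>)" "monic C m"
      by (rule homology_monic)
    then have S: "subquotient C (homology C \<theta> \<xi>) (homology C \<alpha>' \<iota>)"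
      using subquotient_of_subobject_of_quotient[of m "coker C \<chi>"] by (simp add: in_Hom)
    let ?q = "homology_proj C \<theta> \<xi>"
    have "(ker C ?q \<odot> ker C \<xi>) \<odot> coker C \<theta> = (ker C ?q \<odot> ?q) \<odot> himg \<theta> \<xi>"
      by (simp add: middle_proj_simps(4) del: ker_simps(4))
    also have "\<dots> = Nul C (Ker C ?q) (Coker C \<theta>)" by simp
    finally obtain r where [simp]: "r \<in> Arr C" "Dom C r = Ker C ?q" "Cod C r = Img C \<theta>" and r: "r \<odot> img C \<theta> = ker C ?q \<odot> ker C \<xi>"
      using img_lift[of \<theta> "ker C ?q \<odot> ker C \<xi>"] by auto
    have "(r \<odot> m1) \<odot> ker C \<xi> = ker C ?q \<odot> ker C \<xi>"
      by (simp add: m1 r)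
    then have "r \<odot> m1 = ker C ?q"
      by (intro monicD[of "ker C \<xi>" "r \<odot> m1"]) simp_all
    then have "ker C ?q \<odot> coker C m1 = r \<odot> (m1 \<odot> coker C m1)"
      by (simp del: coker_simps(4) flip: assoc)
    then have "ker C ?q \<odot> coker C m1 = Nul C (Ker C ?q) (Coker C m1)" by simp
    then obtain f where "epic C f" "Dom C f = homology C \<theta> \<xi>" "Cod C f = Coker C m1"
      using coker_quotient[OF middle_proj_simps(5), of m1] by auto
    with S show ?thesis using subquotient_quotient by metis
  qed
  have sq2: "subquotient C (Coker C (ker C \<xi>)) (homology C \<beta> \<gamma>)"
  proof -
    obtain eg where eg: "epic C eg" and [simp]: "eg \<in> Arr C" "Dom C eg = Ker C \<zeta>" "Cod C eg = Img C \<xi>"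
      and eg': "eg \<odot> img C \<xi> = \<xi>"
      using img_factorisation[of \<xi>] by auto
    have "ker C eg \<odot> \<xi> = (ker C eg \<odot> eg) \<odot> img C \<xi>" by (simp add: eg' del: ker_simps(4))
    also have "\<dots> = Nul C (Ker C eg) (homology C \<beta> \<gamma>)" by simp
    finally obtain r where [simp]: "r \<in> Arr C" "Dom C r = Ker C eg" "Cod C r = Ker C \<xi>" and r: "r \<odot> ker C \<xi> = ker C eg"
      using ker_lift[of \<xi> "ker C eg"] by auto
    have "ker C eg \<odot> coker C (ker C \<xi>) = r \<odot> (ker C \<xi> \<odot> coker C (ker C \<xi>))"
      by (simp del: coker_simps(4) flip: r)
    then have "ker C eg \<odot> coker C (ker C \<xi>) = Nul C (Ker C eg) (Coker C (ker C \<xi>))" by simp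
    then obtain f where f: "epic C f" "Dom C f = Img C \<xi>" "Cod C f = Coker C (ker C \<xi>)"
      using coker_quotient[OF eg, of "ker C \<xi>"] by auto
    show ?thesis
      unfolding subquotient_def
      by (intro bexI[of _ "Img C \<xi>"] conjI bexI[of _ "img C \<xi>"] bexI[of _ f])
        (use f epic_in_Arr[OF f(1)] in \<open>simp_all add: in_Hom\<close>)
  qed
  let ?F = "\<lambda>k::nat. [z, Img C \<theta>, Ker C \<xi>, Ker C \<zeta>] ! k" and ?m = "\<lambda>k::nat. [?m0, m1, ker C \<xi>] ! k"
    and ?zs = "[Ker C \<epsilon>, homology C \<alpha>' \<iota>, homology C \<beta> \<gamma>]"
  have "k < 3 \<Longrightarrow> ?m k \<in> Hom C (?F k) (?F (Suc k)) \<and> monic C (?m k) \<and> subquotient C (Coker C (?m k)) (?zs ! k)" for k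
    using mono_m0 mono_m1 sq0 sq1 sq2
    by (auto simp: less_Suc_eq numeral_3_eq_3 in_Hom)
  then show ?thesis
    unfolding filtered_by_subquotients_def using z
    by (intro exI[of _ ?F] exI[of _ ?m] exI[of _ ?zs]) (simp add: numeral_3_eq_3)
qed

corollary zeta_monic:
  assumes "zero_object C (Ker C \<epsilon>)" "zero_object C (homology C \<beta> \<gamma>)" "zero_object C (homology C \<alpha>' \<iota>)"
  shows "monic C \<zeta>"
  by (rule monic_of_zero_Ker[OF _ zero_object_filtered[OF filtration]]) (use assms in auto)

end


section \<open>The diagram of the quiver\<close>

context preadditive_category
begin

lemma singleton_arr_in:
  assumes "f \<in> Hom C x y"
  shows "singleton_arr C f \<in> Hom Cl [x] [y]"
proof -
  have "x \<in> Obj C" "y \<in> Obj C" using assms Dom_in Cod_in by (auto simp: in_Hom)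
  then show ?thesis using assms unfolding closure_Hom by (simp add: singleton_arr_def in_Hom)
qed

lemma singleton_arr_Comp:
  assumes "f \<in> Hom C x y" "g \<in> Hom C y z"
  shows "singleton_arr C f \<odot>\<^bsub>Cl\<^esub> singleton_arr C g = singleton_arr C (f \<odot> g)"
  using assms by (auto simp: singleton_arr_def closure_Comp in_Hom intro!: cong_mat)

lemma singleton_arr_Nul:
  assumes "x \<in> Obj C" "y \<in> Obj C"
  shows "singleton_arr C (Nul C x y) = Nul Cl [x] [y]"
  using assms by (auto simp: singleton_arr_def closure_Nul intro!: cong_mat)

end

text \<open>
  The outer factors in the generating rule are taken to be empty paths.
\<close>

lemma relation_in_rel_ideal:
  assumes "r \<in> R" "r \<in> lincombs Q x y" "x \<in> nodes Q" "y \<in> nodes Q"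
  shows "r \<in> rel_ideal Q R x y"
proof -
  have "lincomb_mult (lincomb_mult (lincomb_of (x, [])) r) (lincomb_of (y, [])) \<in> rel_ideal Q R x y"
    using assms by (intro rel_ideal.gen) auto
  then show ?thesis
    using assms by (simp add: lincomb_mult_empty_path(1)[OF assms(2)] lincomb_mult_empty_path(2)[OF assms(2)])
qed

abbreviation "C0 \<equiv> quiver_cat Q0 R0"

interpretation C0: preadditive_category C0
  by (rule preadditive_quiver_cat)

interpretation A0: additive_category A0
  unfolding A0_def by (rule C0.additive_closure_additive)

interpretation Ad: abelian_category Ad
  unfolding Ad_def by (rule A0.abelian_adelman)

text \<open>
  Paths as arrows between one-element tuples. Composition is concatenation, so that the relations
  of the quiver become equations between words.
\<close>

definition word :: "node \<Rightarrow> node \<Rightarrow> arrow list \<Rightarrow> arr0" where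
  "word x y es = singleton_arr C0 (path_class Q0 R0 x y (lincomb_of (x, es)))"

lemma ar_word: "ar e = word (fst (arrow_ends e)) (snd (arrow_ends e)) [e]"
  by (simp add: ar_def word_def arrow_class_def path_class_def Q0_def Let_def)

lemma path_class_word_in:
  "walk Q0 x es y \<Longrightarrow> path_class Q0 R0 x y (lincomb_of (x, es)) \<in> Hom C0 x y"
  by (intro path_class_in_Hom) (auto simp: Q0_def)

lemma word_in: "walk Q0 x es y \<Longrightarrow> word x y es \<in> Hom A0 [x] [y]"
  unfolding word_def A0_def by (intro C0.singleton_arr_in path_class_word_in)

lemma word_Comp:
  assumes "walk Q0 x es y" "walk Q0 y es' z"
  shows "word x y es \<odot>\<^bsub>A0\<^esub> word y z es' = word x z (es @ es')"
  using C0.singleton_arr_Comp[OF assms[THEN path_class_word_in]] assms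
  unfolding word_def A0_def by (simp add: path_class_Comp)

lemma word_eq:
  assumes "lincomb_of (x, es) - lincomb_of (x, es') \<in> R0" "walk Q0 x es y" "walk Q0 x es' y"
  shows "word x y es = word x y es'"
proof -
  have "lincomb_of (x, es) - lincomb_of (x, es') \<in> rel_ideal Q0 R0 x y"
    using assms by (intro relation_in_rel_ideal) (auto simp: Q0_def)
  then have "path_class Q0 R0 x y (lincomb_of (x, es)) = path_class Q0 R0 x y (lincomb_of (x, es'))"
    using assms by (simp add: path_class_eq_iff)
  then show ?thesis by (simp add: word_def)
qed

lemma word_zero:
  assumes "lincomb_of (x, es) \<in> R0" "walk Q0 x es y"
  shows "word x y es = Nul A0 [x] [y]"
proof -
  have "lincomb_of (x, es) \<in> rel_ideal Q0 R0 x y"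
    using assms by (intro relation_in_rel_ideal) (auto simp: Q0_def)
  then have "path_class Q0 R0 x y (lincomb_of (x, es)) = Nul C0 x y"
    using assms by (simp add: quiver_cat_simps path_class_eq_iff)
  moreover have "x \<in> Obj C0" "y \<in> Obj C0" by (simp_all add: quiver_cat_simps Q0_def)
  ultimately show ?thesis
    unfolding word_def A0_def by (simp add: C0.singleton_arr_Nul)
qed

lemma A0_Obj [simp]: "xs \<in> Obj A0"
  unfolding A0_def C0.closure_Obj by (simp add: quiver_cat_simps Q0_def)

lemma ar_simps [simp]:
  "ar e \<in> Arr A0" "Dom A0 (ar e) = [fst (arrow_ends e)]" "Cod A0 (ar e) = [snd (arrow_ends e)]"
proof -
  have "ar e \<in> Hom A0 [fst (arrow_ends e)] [snd (arrow_ends e)]"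
    unfolding ar_word by (rule word_in) (simp add: Q0_def)
  then show "ar e \<in> Arr A0" "Dom A0 (ar e) = [fst (arrow_ends e)]" "Cod A0 (ar e) = [snd (arrow_ends e)]"
    by (simp_all add: in_Hom)
qed

lemma relations:
  "ar Alpha \<odot>\<^bsub>A0\<^esub> ar Beta = Nul A0 [na] [nc]"
  "ar Iota \<odot>\<^bsub>A0\<^esub> ar Kappa = Nul A0 [nf] [nh]"
  "ar Beta \<odot>\<^bsub>A0\<^esub> ar Zeta = ar Epsilon \<odot>\<^bsub>A0\<^esub> ar Iota"
  "ar Lambda \<odot>\<^bsub>A0\<^esub> (ar Alpha \<odot>\<^bsub>A0\<^esub> ar Epsilon) = Nul A0 [ni] [nf]"
  "ar Zeta \<odot>\<^bsub>A0\<^esub> (ar Kappa \<odot>\<^bsub>A0\<^esub> ar Mu) = Nul A0 [nc] [nj]"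
  by (simp_all add: ar_word word_Comp Q0_def word_zero word_eq R0_def)

lemma diagram_objects [simp]: "plain x \<in> adel_ob A0" "obj_la \<in> adel_ob A0" "obj_hm \<in> adel_ob A0"
  by (simp_all add: plain_def obj_la_def obj_hm_def adel_ob_def)

lemma reps_plain:
  assumes "f \<in> Arr A0" "Dom A0 f = [x]" "Cod A0 f = [y]"
  shows "f \<in> adel_reps A0 (plain x) (plain y)"
  unfolding plain_def A0.in_reps_iff using assms
  by (intro conjI bexI[of _ "Nul A0 [] []"]) simp_all

lemma reps_zeta_kappa: "ar Zeta \<odot>\<^bsub>A0\<^esub> ar Kappa \<in> adel_reps A0 (plain nc) obj_hm"
  unfolding plain_def obj_hm_def A0.in_reps_iff using relations(5)
  by (intro conjI bexI[of _ "Nul A0 [] []"] bexI[of _ "Nul A0 [] [nj]"]) simp_all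

lemma reps_alpha_epsilon: "ar Alpha \<odot>\<^bsub>A0\<^esub> ar Epsilon \<in> adel_reps A0 obj_la (plain nf)"
  unfolding plain_def obj_la_def A0.in_reps_iff using relations(4)
  by (intro conjI bexI[of _ "Nul A0 [ni] []"] bexI[of _ "Nul A0 [] []"]) simp_all

lemma reps_delta: "Ident A0 [na] \<in> adel_reps A0 (plain na) obj_la"
  unfolding plain_def obj_la_def A0.in_reps_iff
  by (intro conjI bexI[of _ "Nul A0 [] [ni]"] bexI[of _ "Nul A0 [] []"]) simp_all

lemma reps_eta: "Ident A0 [nh] \<in> adel_reps A0 obj_hm (plain nh)"
  unfolding plain_def obj_hm_def A0.in_reps_iff
  by (intro conjI bexI[of _ "Nul A0 [] []"] bexI[of _ "Nul A0 [nj] []"]) simp_all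

text \<open>
  Which arrows out of an object are null depends only on its right-hand arrow, and which arrows into
  it are null only on its left-hand arrow. Hence the identity of \<open>a\<close> represents an epimorphism and
  that of \<open>h\<close> a monomorphism.
\<close>

lemma null_plain_na: "adel_null A0 (plain na) Z t \<longleftrightarrow> adel_null A0 obj_la Z t"
  by (cases Z) (simp add: plain_def obj_la_def A0.null_iff)

lemma null_plain_nh: "adel_null A0 Z (plain nh) t \<longleftrightarrow> adel_null A0 Z obj_hm t"
  by (cases Z) (simp add: plain_def obj_hm_def A0.null_iff)

lemma delta_epic: "epic Ad (adel_class A0 (plain na) obj_la (Ident A0 [na]))"
proof -
  have "rep_epic A0 (plain na) obj_la (Ident A0 [na])"
    unfolding rep_epic_def null_plain_na
  proof (intro ballI impI)
    fix Z t assume t: "t \<in> adel_reps A0 obj_la Z" "adel_null A0 obj_la Z (Ident A0 [na] \<odot>\<^bsub>A0\<^esub> t)"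
    then show "adel_null A0 obj_la Z t"
      using A0.reps_typed[OF t(1)] by (simp add: obj_la_def)
  qed
  then show ?thesis unfolding Ad_def using A0.epic_class_iff[OF _ _ reps_delta] by simp
qed

lemma eta_monic: "monic Ad (adel_class A0 obj_hm (plain nh) (Ident A0 [nh]))"
proof -
  have "rep_monic A0 obj_hm (plain nh) (Ident A0 [nh])"
    unfolding rep_monic_def null_plain_nh
  proof (intro ballI impI)
    fix Z t assume t: "t \<in> adel_reps A0 Z obj_hm" "adel_null A0 Z obj_hm (t \<odot>\<^bsub>A0\<^esub> Ident A0 [nh])"
    then show "adel_null A0 Z obj_hm t"
      using A0.reps_typed[OF t(1)] by (simp add: obj_hm_def)
  qed
  then show ?thesis unfolding Ad_def using A0.monic_class_iff[OF _ _ reps_eta] by simp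
qed

theorem lemma2p18:
  fixes \<alpha> \<beta> \<zeta>\<kappa> \<alpha>\<epsilon> \<iota> \<kappa> \<delta> \<epsilon> \<zeta> \<eta> :: "arr0 adel_arr"
  assumes "\<alpha> = adel_class A0 (plain na) (plain nb) (ar Alpha)"
    and "\<beta> = adel_class A0 (plain nb) (plain nc) (ar Beta)"
    and "\<zeta>\<kappa> = adel_class A0 (plain nc) obj_hm (ar Zeta \<odot>\<^bsub>A0\<^esub> ar Kappa)"
    and "\<alpha>\<epsilon> = adel_class A0 obj_la (plain nf) (ar Alpha \<odot>\<^bsub>A0\<^esub> ar Epsilon)"
    and "\<iota> = adel_class A0 (plain nf) (plain ng) (ar Iota)"
    and "\<kappa> = adel_class A0 (plain ng) (plain nh) (ar Kappa)"
    and "\<delta> = adel_class A0 (plain na) obj_la (Ident A0 [na])"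
    and "\<epsilon> = adel_class A0 (plain nb) (plain nf) (ar Epsilon)"
    and "\<zeta> = adel_class A0 (plain nc) (plain ng) (ar Zeta)"
    and "\<eta> = adel_class A0 obj_hm (plain nh) (Ident A0 [nh])"
  shows "abelian_category Ad \<and>
    \<alpha> \<in> Hom Ad (plain na) (plain nb) \<and>
    \<beta> \<in> Hom Ad (plain nb) (plain nc) \<and>
    \<zeta>\<kappa> \<in> Hom Ad (plain nc) obj_hm \<and>
    \<alpha>\<epsilon> \<in> Hom Ad obj_la (plain nf) \<and>
    \<iota> \<in> Hom Ad (plain nf) (plain ng) \<and>
    \<kappa> \<in> Hom Ad (plain ng) (plain nh) \<and>
    \<delta> \<in> Hom Ad (plain na) obj_la \<and>
    \<epsilon> \<in> Hom Ad (plain nb) (plain nf) \<and>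
    \<zeta> \<in> Hom Ad (plain nc) (plain ng) \<and>
    \<eta> \<in> Hom Ad obj_hm (plain nh) \<and>
    \<alpha> \<odot>\<^bsub>Ad\<^esub> \<epsilon> = \<delta> \<odot>\<^bsub>Ad\<^esub> \<alpha>\<epsilon> \<and>
    \<beta> \<odot>\<^bsub>Ad\<^esub> \<zeta> = \<epsilon> \<odot>\<^bsub>Ad\<^esub> \<iota> \<and>
    \<zeta>\<kappa> \<odot>\<^bsub>Ad\<^esub> \<eta> = \<zeta> \<odot>\<^bsub>Ad\<^esub> \<kappa> \<and>
    \<alpha> \<odot>\<^bsub>Ad\<^esub> \<beta> = Nul Ad (plain na) (plain nc) \<and>
    \<beta> \<odot>\<^bsub>Ad\<^esub> \<zeta>\<kappa> = Nul Ad (plain nb) obj_hm \<and>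
    \<alpha>\<epsilon> \<odot>\<^bsub>Ad\<^esub> \<iota> = Nul Ad obj_la (plain ng) \<and>
    \<iota> \<odot>\<^bsub>Ad\<^esub> \<kappa> = Nul Ad (plain nf) (plain nh) \<and>
    epic Ad \<delta> \<and>
    monic Ad \<eta> \<and>
    (\<exists>m \<in> Hom Ad
         (homology Ad (ker_map Ad \<epsilon> \<zeta> \<beta>)
                      (ker_incl Ad \<zeta> \<zeta>\<kappa> \<odot>\<^bsub>Ad\<^esub> homology_proj Ad \<beta> \<zeta>\<kappa>))
         (Coker Ad (homology_map Ad (\<alpha>, \<beta>) (\<alpha>\<epsilon>, \<iota>) \<epsilon>)).
       monic Ad m) \<and>
    filtered_by_subquotients Ad (Ker Ad \<zeta>)
       [Ker Ad \<epsilon>, homology Ad \<beta> \<zeta>\<kappa>, homology Ad \<alpha>\<epsilon> \<iota>] \<and>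
    (zero_object Ad (Ker Ad \<epsilon>) \<and> zero_object Ad (homology Ad \<beta> \<zeta>\<kappa>) \<and>
       zero_object Ad (homology Ad \<alpha>\<epsilon> \<iota>) \<longrightarrow> monic Ad \<zeta>)"
proof -
  note defs = assms
  note reps = reps_plain reps_zeta_kappa reps_alpha_epsilon reps_delta reps_eta
  have hom: "\<alpha> \<in> Hom Ad (plain na) (plain nb)" "\<beta> \<in> Hom Ad (plain nb) (plain nc)"
    "\<zeta>\<kappa> \<in> Hom Ad (plain nc) obj_hm" "\<alpha>\<epsilon> \<in> Hom Ad obj_la (plain nf)"
    "\<iota> \<in> Hom Ad (plain nf) (plain ng)" "\<kappa> \<in> Hom Ad (plain ng) (plain nh)"
    "\<delta> \<in> Hom Ad (plain na) obj_la" "\<epsilon> \<in> Hom Ad (plain nb) (plain nf)"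
    "\<zeta> \<in> Hom Ad (plain nc) (plain ng)" "\<eta> \<in> Hom Ad obj_hm (plain nh)"
    unfolding defs Ad_def by (intro A0.class_in_Hom; simp add: reps)+
  have sq: "\<alpha> \<odot>\<^bsub>Ad\<^esub> \<epsilon> = \<delta> \<odot>\<^bsub>Ad\<^esub> \<alpha>\<epsilon>" "\<beta> \<odot>\<^bsub>Ad\<^esub> \<zeta> = \<epsilon> \<odot>\<^bsub>Ad\<^esub> \<iota>" "\<zeta>\<kappa> \<odot>\<^bsub>Ad\<^esub> \<eta> = \<zeta> \<odot>\<^bsub>Ad\<^esub> \<kappa>"
    unfolding defs Ad_def by (simp_all add: A0.class_Comp reps relations)
  have "ar Beta \<odot>\<^bsub>A0\<^esub> (ar Zeta \<odot>\<^bsub>A0\<^esub> ar Kappa) = ar Epsilon \<odot>\<^bsub>A0\<^esub> (ar Iota \<odot>\<^bsub>A0\<^esub> ar Kappa)"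
    using A0.assoc[of "ar Beta" "ar Zeta" "ar Kappa"] A0.assoc[of "ar Epsilon" "ar Iota" "ar Kappa"]
      relations(3) by simp
  then have bzk: "ar Beta \<odot>\<^bsub>A0\<^esub> (ar Zeta \<odot>\<^bsub>A0\<^esub> ar Kappa) = Nul A0 [nb] [nh]"
    by (simp add: relations)
  have "ar Alpha \<odot>\<^bsub>A0\<^esub> (ar Epsilon \<odot>\<^bsub>A0\<^esub> ar Iota) = (ar Alpha \<odot>\<^bsub>A0\<^esub> ar Beta) \<odot>\<^bsub>A0\<^esub> ar Zeta"
    by (simp flip: relations(3))
  then have aei: "ar Alpha \<odot>\<^bsub>A0\<^esub> (ar Epsilon \<odot>\<^bsub>A0\<^esub> ar Iota) = Nul A0 [na] [ng]"
    by (simp add: relations)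
  have fst_simps: "Cod A0 (fst (plain x)) = [x]" "Cod A0 (fst obj_la) = [na]" "Cod A0 (fst obj_hm) = [nh]" for x
    by (simp_all add: plain_def obj_la_def obj_hm_def)
  have zeros: "\<alpha> \<odot>\<^bsub>Ad\<^esub> \<beta> = Nul Ad (plain na) (plain nc)" "\<beta> \<odot>\<^bsub>Ad\<^esub> \<zeta>\<kappa> = Nul Ad (plain nb) obj_hm"
    "\<alpha>\<epsilon> \<odot>\<^bsub>Ad\<^esub> \<iota> = Nul Ad obj_la (plain ng)" "\<iota> \<odot>\<^bsub>Ad\<^esub> \<kappa> = Nul Ad (plain nf) (plain nh)"
    unfolding defs Ad_def
    by (simp_all add: A0.class_Comp reps relations bzk aei A0.adelman_Nul fst_simps)
  have epi: "epic Ad \<delta>" and mono: "monic Ad \<eta>"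
    unfolding defs by (rule delta_epic, rule eta_monic)
  interpret two_complexes Ad \<alpha> \<beta> \<zeta>\<kappa> \<alpha>\<epsilon> \<iota> \<kappa> \<delta> \<epsilon> \<zeta> \<eta>
    by unfold_locales (use hom sq zeros epi mono in \<open>simp_all add: in_Hom\<close>)
  have "\<exists>m \<in> Hom Ad
         (homology Ad (ker_map Ad \<epsilon> \<zeta> \<beta>)
                      (ker_incl Ad \<zeta> \<zeta>\<kappa> \<odot>\<^bsub>Ad\<^esub> homology_proj Ad \<beta> \<zeta>\<kappa>))
         (Coker Ad (homology_map Ad (\<alpha>, \<beta>) (\<alpha>\<epsilon>, \<iota>) \<epsilon>)). monic Ad m"
    by (rule homology_monic) blast
  then show ?thesis
    using Ad.abelian_category_axioms hom sq zeros epi mono filtration zeta_monic by blast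
qed

end
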